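(* Let $\mu$ be a finite positive $n$-dimensional measure on $\mathbb{R}^m$, $0<n\le m$. Let $T$ be a Calderón–Zygmund operator (associated to a Calderón–Zygmund kernel $\mathcal{K}$ and the measure $\mu$) bounded on $L^2(\mu)$. Assume that for each doubling cube $Q\subset\mathbb{R}^m$ there exists a constant $b_Q$ such that $$\frac{1}{\mu(Q)}\int_Q |T1-b_Q|\,d\mu\le \frac{C}{K(Q)}\quad\text{for all doubling cubes } Q$$ and $$|b_Q-b_R|\le C\,\frac{K(Q,R)}{K(Q)}\quad\text{for all doubling cubes } Q,R,\ Q\subset R,$$ where the constant $C>0$ does not depend on $Q$ and $R$; these two conditions are understood as holding for the truncated operators $T_\varepsilon$ in place of $T$, uniformly in $\varepsilon>0$. Then $T$ is bounded on $\mathrm{RBMO}(\mu)$, that is, the operators $T_\varepsilon$, $\varepsilon>0$, are uniformly bounded on $\mathrm{RBMO}(\mu)$.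
   Context: A cube is a closed cube in $\mathbb{R}^m$ with sides parallel to the axes, centered at a point of $\mathrm{supp}\,\mu$; $\ell(Q)$ is its side-length, $Q(x,\ell)$ is the cube with center $x$ and side-length $\ell$, and $\lambda Q$ is the concentric cube with side-length $\lambda\ell(Q)$. A positive Radon measure $\mu$ on $\mathbb{R}^m$ is $n$-dimensional, for a real number $n$ with $0<n\le m$, if $\mu(Q)\le C\ell^n(Q)$ for every cube $Q$ with $\ell(Q)>0$, with a universal constant $C>0$. $d(\cdot,\cdot)$ is the standard distance in $\mathbb{R}^m$. A Calderón–Zygmund kernel associated with the $n$-dimensional measure $\mu$ is a measurable function $\mathcal{K}(x,y)$ on $\mathbb{R}^m\times\mathbb{R}^m\setminus\{(x,x):x\in\mathbb{R}^m\}$ such that, for a universal constant $C>0$ and a regularity constant $\delta$, $0<\delta\le1$, specific to the kernel: (i) $|\mathcal{K}(x,y)|\le C d^{-n}(x,y)$; (ii) $|\mathcal{K}(x_1,y)-\mathcal{K}(x_2,y)|+|\mathcal{K}(y,x_1)-\mathcal{K}(y,x_2)|\le C\frac{d^\delta(x_1,x_2)}{d^{n+\delta}(x_1,y)}$ whenever $2d(x_1,x_2)\le d(x_1,y)$; (iii) $\left|\int_{Q(x,R)\setminus Q(x,r)}\mathcal{K}(x,y)\,d\mu(y)\right|\le C$ for $0<r<R$. The associated Calderón–Zygmund operator is $Tf(x)=\int_{\mathbb{R}^m}\mathcal{K}(x,y)f(y)\,d\mu(y)$ for $x\notin\mathrm{supp}(f\mu)$; its truncations are $T_\varepsilon f(x)=\int_{\mathbb{R}^m\setminus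 Q(x,\varepsilon)}\mathcal{K}(x,y)f(y)\,d\mu(y)$, $\varepsilon>0$. $T$ is said to be bounded on $L^2(\mu)$ if the operators $T_\varepsilon$ are bounded on $L^2(\mu)$ uniformly in $\varepsilon>0$. For cubes $Q\subset R$, $K(Q,R)=1+\sum_{j=1}^{N_{Q,R}}\frac{\mu(2^jQ)}{\ell^n(2^jQ)}$, where $N_{Q,R}$ is the minimal integer $k$ such that $\ell(2^kQ)\ge\ell(R)$. For a cube $Q$, $K(Q)=K(Q,2^kQ)$, where $k$ is the smallest positive integer such that $\mu(2^kQ)>\frac12\mu(\mathbb{R}^m)$. For $\alpha>1$ and $\beta>\alpha^n$, a cube $Q$ is $(\alpha,\beta)$-doubling if $\mu(\alpha Q)<\beta\mu(Q)$. For sufficiently large $\beta=\beta(\alpha,n)$, for $\mu$-almost all $x$ there is a sequence of $(\alpha,\beta)$-doubling cubes centered at $x$ with side-lengths tending to $0$; $\beta_n$ denotes two times the infimum of the corresponding constants $\beta(4,n)$. A cube is called doubling if it is $(4,\beta_n)$-doubling. $\mathrm{RBMO}(\mu)$ consists of those $f\in L^1_{loc}(\mu)$ for which there exist a constant $C_{\mathfrak E}>0$ and a collection of constants $\{f_Q\}$ (one for each doubling cube $Q$) such that $\frac1{\mu(Q)}\int_Q|f-f_Q|\,d\mu\le C_{\mathfrak E}$ and $|f_Q-f_R|\le C_{\mathfrak E}K(Q,R)$ for all doubling cubes $Q,R$ with $Q\subset R$; $\|f\|$ is the infimum of the corresponding constants $C_{\mathfrak E}$. $\|\cdot\|$ is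 a norm on the space $\mathrm{RBMO}(\mu)$ modulo constants.
   Formalization: Since the norm vanishes on constants while the truncated operators need not map constants to constants, boundedness on RBMO(μ) is stated for the norm ‖f‖ + |∫f dμ|; for f with mean zero this gives ‖T_ε f‖ ≤ B‖f‖. *)

theory Defs
  imports "HOL-Analysis.Analysis"
begin

text \<open>
  Throughout, \<open>\<mu>\<close> is a measure on the Borel sets of \<open>real ^ 'm\<close>. A finite (more generally, a
  locally finite) Borel measure on Euclidean space is automatically Radon, so no regularity
  hypothesis is needed.
\<close>

definition supp :: "('a::topological_space) measure \<Rightarrow> 'a set" where
  "supp \<mu> = {x. \<forall>U. open U \<and> x \<in> U \<longrightarrow> emeasure \<mu> U \<noteq> 0}"

text \<open>
  A cube is encoded by its center and its side-length; for positive side-length this pair is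
  determined by the underlying point set.
\<close>

type_synonym 'a cube = "'a \<times> real"

definition cube_set :: "(real ^ 'm) cube \<Rightarrow> (real ^ 'm) set" where
  "cube_set Q = cbox (fst Q - vec (snd Q / 2)) (fst Q + vec (snd Q / 2))"

definition is_cube :: "(real ^ 'm) measure \<Rightarrow> (real ^ 'm) cube \<Rightarrow> bool" where
  "is_cube \<mu> Q \<longleftrightarrow> fst Q \<in> supp \<mu> \<and> snd Q > 0"

definition dilate :: "real \<Rightarrow> (real ^ 'm) cube \<Rightarrow> (real ^ 'm) cube" where
  "dilate r Q = (fst Q, r * snd Q)"

definition n_dimensional :: "real \<Rightarrow> (real ^ 'm) measure \<Rightarrow> bool" where
  "n_dimensional n \<mu> \<longleftrightarrow>
     (\<exists>C>0. \<forall>Q. is_cube \<mu> Q \<longrightarrow> emeasure \<mu> (cube_set Q) \<le> ennreal (C * snd Q powr n))"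

text \<open>
  Kernels are total functions; their values on the diagonal are irrelevant and are not
  constrained. In the regularity condition \<open>x1 \<noteq> y\<close> forces \<open>x2 \<noteq> y\<close>. In the last condition
  \<open>x\<close> ranges over the support because cubes are centered there.
\<close>

definition CZ_kernel ::
  "real \<Rightarrow> (real ^ 'm) measure \<Rightarrow> (real ^ 'm \<Rightarrow> real ^ 'm \<Rightarrow> complex) \<Rightarrow> bool" where
  "CZ_kernel n \<mu> K \<longleftrightarrow>
     (\<lambda>(x, y). K x y) \<in> borel_measurable (restrict_space borel {(x, y). x \<noteq> y}) \<and>
     (\<exists>C>0. \<exists>\<delta>. 0 < \<delta> \<and> \<delta> \<le> 1 \<and>
        (\<forall>x y. x \<noteq> y \<longrightarrow> cmod (K x y) \<le> C * dist x y powr (- n)) \<and>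
        (\<forall>x1 x2 y. x1 \<noteq> y \<and> 2 * dist x1 x2 \<le> dist x1 y \<longrightarrow>
           cmod (K x1 y - K x2 y) + cmod (K y x1 - K y x2)
             \<le> C * (dist x1 x2 powr \<delta> / dist x1 y powr (n + \<delta>))) \<and>
        (\<forall>x\<in>supp \<mu>. \<forall>r R. 0 < r \<and> r < R \<longrightarrow>
           cmod (LINT y:cube_set (x, R) - cube_set (x, r)|\<mu>. K x y) \<le> C))"

definition truncation ::
  "(real ^ 'm) measure \<Rightarrow> (real ^ 'm \<Rightarrow> real ^ 'm \<Rightarrow> complex) \<Rightarrow> real \<Rightarrow>
   (real ^ 'm \<Rightarrow> complex) \<Rightarrow> real ^ 'm \<Rightarrow> complex" where
  "truncation \<mu> K \<epsilon> f x = (LINT y:- cube_set (x, \<epsilon>)|\<mu>. K x y * f y)"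

definition L2 :: "'a measure \<Rightarrow> ('a \<Rightarrow> complex) set" where
  "L2 \<mu> = {f \<in> borel_measurable \<mu>. integrable \<mu> (\<lambda>x. (cmod (f x))\<^sup>2)}"

definition L2_nrm :: "'a measure \<Rightarrow> ('a \<Rightarrow> complex) \<Rightarrow> real" where
  "L2_nrm \<mu> f = sqrt (LINT x|\<mu>. (cmod (f x))\<^sup>2)"

definition bounded_on_L2 ::
  "(real ^ 'm) measure \<Rightarrow> (real ^ 'm \<Rightarrow> real ^ 'm \<Rightarrow> complex) \<Rightarrow> bool" where
  "bounded_on_L2 \<mu> K \<longleftrightarrow>
     (\<exists>A. \<forall>\<epsilon>>0. \<forall>f\<in>L2 \<mu>.
        truncation \<mu> K \<epsilon> f \<in> L2 \<mu> \<and> L2_nrm \<mu> (truncation \<mu> K \<epsilon> f) \<le> A * L2_nrm \<mu> f)"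

definition N_cubes :: "(real ^ 'm) cube \<Rightarrow> (real ^ 'm) cube \<Rightarrow> nat" where
  "N_cubes Q R = (LEAST k. snd (dilate (2 ^ k) Q) \<ge> snd R)"

definition K_pair ::
  "real \<Rightarrow> (real ^ 'm) measure \<Rightarrow> (real ^ 'm) cube \<Rightarrow> (real ^ 'm) cube \<Rightarrow> real" where
  "K_pair n \<mu> Q R =
     1 + (\<Sum>j=1..N_cubes Q R.
            measure \<mu> (cube_set (dilate (2 ^ j) Q)) / snd (dilate (2 ^ j) Q) powr n)"

definition K_single :: "real \<Rightarrow> (real ^ 'm) measure \<Rightarrow> (real ^ 'm) cube \<Rightarrow> real" where
  "K_single n \<mu> Q =
     K_pair n \<mu> Q
       (dilate (2 ^ (LEAST k. k > 0 \<and> measure \<mu> (cube_set (dilate (2 ^ k) Q)) > measure \<mu> UNIV / 2)) Q)"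

definition ab_doubling ::
  "(real ^ 'm) measure \<Rightarrow> real \<Rightarrow> real \<Rightarrow> (real ^ 'm) cube \<Rightarrow> bool" where
  "ab_doubling \<mu> \<alpha> \<beta> Q \<longleftrightarrow>
     is_cube \<mu> Q \<and> measure \<mu> (cube_set (dilate \<alpha> Q)) < \<beta> * measure \<mu> (cube_set Q)"

definition admissible_beta :: "real \<Rightarrow> (real ^ 'm) measure \<Rightarrow> real \<Rightarrow> real set" where
  "admissible_beta n \<mu> \<alpha> =
     {\<beta>. \<beta> > \<alpha> powr n \<and>
          (AE x in \<mu>. \<exists>l :: nat \<Rightarrow> real. (\<forall>k. ab_doubling \<mu> \<alpha> \<beta> (x, l k)) \<and> l \<longlonglongrightarrow> 0)}"

definition beta_n :: "real \<Rightarrow> (real ^ 'm) measure \<Rightarrow> real" where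
  "beta_n n \<mu> = 2 * Inf (admissible_beta n \<mu> 4)"

definition doubling :: "real \<Rightarrow> (real ^ 'm) measure \<Rightarrow> (real ^ 'm) cube \<Rightarrow> bool" where
  "doubling n \<mu> Q \<longleftrightarrow> ab_doubling \<mu> 4 (beta_n n \<mu>) Q"

definition L1_loc :: "(real ^ 'm) measure \<Rightarrow> (real ^ 'm \<Rightarrow> complex) set" where
  "L1_loc \<mu> = {f \<in> borel_measurable \<mu>. \<forall>S. compact S \<longrightarrow> set_integrable \<mu> S f}"

definition RBMO_constant ::
  "real \<Rightarrow> (real ^ 'm) measure \<Rightarrow> (real ^ 'm \<Rightarrow> complex) \<Rightarrow> real \<Rightarrow> bool" where
  "RBMO_constant n \<mu> f C \<longleftrightarrow> C > 0 \<and>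
     (\<exists>fQ :: (real ^ 'm) cube \<Rightarrow> complex.
        (\<forall>Q. doubling n \<mu> Q \<longrightarrow>
           (LINT x:cube_set Q|\<mu>. cmod (f x - fQ Q)) / measure \<mu> (cube_set Q) \<le> C) \<and>
        (\<forall>Q R. doubling n \<mu> Q \<and> doubling n \<mu> R \<and> cube_set Q \<subseteq> cube_set R \<longrightarrow>
           cmod (fQ Q - fQ R) \<le> C * K_pair n \<mu> Q R))"

definition RBMO :: "real \<Rightarrow> (real ^ 'm) measure \<Rightarrow> (real ^ 'm \<Rightarrow> complex) set" where
  "RBMO n \<mu> = {f \<in> L1_loc \<mu>. \<exists>C. RBMO_constant n \<mu> f C}"

definition RBMO_seminorm :: "real \<Rightarrow> (real ^ 'm) measure \<Rightarrow> (real ^ 'm \<Rightarrow> complex) \<Rightarrow> real" where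
  "RBMO_seminorm n \<mu> f = Inf {C. RBMO_constant n \<mu> f C}"

text \<open>
  The quantity above is a norm only modulo constants, while a truncated operator acts on functions
  and does not in general map constants to constants, so it does not act on the quotient. For
  finite \<open>\<mu>\<close> one has \<open>RBMO n \<mu> \<subseteq> L\<^sup>1(\<mu>)\<close>, and \<open>\<bar>\<integral>f d\<mu>\<bar>\<close> takes care of the constants. Restricted
  to the representatives with \<open>\<integral>f d\<mu> = 0\<close>, one from each class modulo constants, the
  norm below is the quotient norm.
\<close>

definition RBMO_norm :: "real \<Rightarrow> (real ^ 'm) measure \<Rightarrow> (real ^ 'm \<Rightarrow> complex) \<Rightarrow> real" where
  "RBMO_norm n \<mu> f = RBMO_seminorm n \<mu> f + cmod (LINT x|\<mu>. f x)"

definition bounded_on_RBMO ::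
  "real \<Rightarrow> (real ^ 'm) measure \<Rightarrow> (real ^ 'm \<Rightarrow> real ^ 'm \<Rightarrow> complex) \<Rightarrow> bool" where
  "bounded_on_RBMO n \<mu> K \<longleftrightarrow>
     (\<exists>B. \<forall>\<epsilon>>0. \<forall>f\<in>RBMO n \<mu>.
        truncation \<mu> K \<epsilon> f \<in> RBMO n \<mu> \<and>
        RBMO_norm n \<mu> (truncation \<mu> K \<epsilon> f) \<le> B * RBMO_norm n \<mu> f)"

end

theory Submission
  imports Defs
begin

text \<open>
  Why the theorem is true.  Write f_x(\<rho>) for the number attached by the RBMO condition to the
  first doubling cube among Q(x,4^k\<rho>), k \<ge> 0 (\<open>f_anc x \<rho>\<close> below).  Fix \<epsilon> and a
  doubling cube Q = Q(x,l), put \<rho> = max(2l,\<epsilon>) and a = f_x(\<rho>), and split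
  f = a + (f-a).  On Q the function T_\<epsilon> f is then the sum of a T_\<epsilon> 1, of a local part
  T_\<epsilon>((f-a)1_{2Q}), which is present only if \<epsilon> \<le> 2l, and of a far part.  The number attached
  to Q for T_\<epsilon> f is a b_Q + c, where c is the value at the center x of the truncation of f-a
  at scale \<rho> (\<open>center_value x \<rho>\<close>).  The choice of the scale \<rho>, rather than l, is what
  copes with the sharp cutoff: T_\<epsilon> has jumps at distance about \<epsilon>, where the kernel is
  of size \<epsilon>^(-n), and there f - a has bounded mean because a belongs to that very scale.

  The four estimates behind this are as follows.

  \<^item> |a| \<le> C K(Q) (\<open>f_anc_le_K_single\<close>), because the means of f over cubes that carry more
    than half of the mass are bounded.  This factor is exactly compensated by the 1/K(Q) in the
    two hypotheses on T_\<epsilon> 1; in particular a (T_\<epsilon> 1 - b_Q) has bounded mean on Q.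

  \<^item> The local part is handled by boundedness on L^2, and needs \<integral>_{2Q} |f-a|^2 \<le> C \<mu>(Q)
    (\<open>L2_oscillation\<close>).  This is a John-Nirenberg inequality for a measure without any doubling
    property.  It rests on a Besicovitch covering lemma for cubes (\<open>besicovitch_cubes\<close>), on
    stopping cubes (\<open>stopping_cube\<close>), and on a substitute for Lebesgue's differentiation theorem
    (\<open>doubling_means_detect_deviation\<close>).

  \<^item> The far part differs from c by a bounded amount (\<open>kernel_perturbation\<close>), by the smoothness
    of the kernel summed over dyadic shells, in which f-a grows only like the number of the shell.

  \<^item> For Q \<subseteq> R the numbers c differ by at most C K(Q,R).  Summation over the shells between
    Q and R only gives K(Q,R)^2 (\<open>center_value_quadratic\<close>), but a quadratic bound for a
    chain of scales becomes linear when the chain is cut into blocks in which K is bounded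
    (\<open>chain_linear\<close>).

  All comparisons of the numbers f_x(\<rho>) go back to one fact: along a chain of non-doubling
  cubes Q(x,4^k l) the densities \<mu>(Q)/length(Q)^n at least double from one cube to the next, so
  that their sum is bounded whatever the length of the chain (\<open>nondoubling_chain\<close>).
  The constants depend on the measure, the kernel and the hypotheses, and neither on f nor on
  \<epsilon>; this gives the uniform bound.
\<close>

section \<open>A Besicovitch covering lemma for cubes\<close>

abbreviation cb :: "real ^ 'm \<Rightarrow> real \<Rightarrow> (real ^ 'm) set" where
  "cb x s \<equiv> cube_set (x, s)"

lemma mem_cb: "y \<in> cb x s \<longleftrightarrow> (\<forall>i. \<bar>y $ i - x $ i\<bar> \<le> s / 2)"
proof -
  have "(x $ i - s / 2 \<le> y $ i \<and> y $ i \<le> x $ i + s / 2) \<longleftrightarrow> \<bar>y $ i - x $ i\<bar> \<le> s / 2" for i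
    by linarith
  then show ?thesis by (simp add: cube_set_def mem_box_cart del: le_divide_eq_numeral1)
qed

text \<open>
  Cubes are selected by generations of decreasing size.  A center is available in its generation if
  it is not covered by a cube of an earlier generation, and from each cell of a grid one available
  center is picked.  Let two selected cubes of different generations contain a point z.  Their
  centers lie in different orthants around z, because otherwise the larger cube would contain the
  center of the smaller one.  So in each orthant only one generation occurs, and the grid leaves at
  most 5^m centers of it.
\<close>

lemma besicovitch_cubes:
  fixes A :: "(real ^ 'm) set" and r :: "real ^ 'm \<Rightarrow> real"
  assumes L: "L > 0" and r: "\<And>x. x \<in> A \<Longrightarrow> 0 < r x \<and> r x \<le> L"
  shows "\<exists>S\<subseteq>A. countable S \<and> A \<subseteq> (\<Union>x\<in>S. cb x (r x)) \<and>
           (\<forall>z. finite {x\<in>S. z \<in> cb x (r x)} \<and> card {x\<in>S. z \<in> cb x (r x)} \<le> 10 ^ CARD('m))"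
proof -
  have ex: "\<exists>j::nat. L / 2 ^ Suc j < r x \<and> r x \<le> L / 2 ^ j" if x: "x \<in> A" for x
  proof -
    obtain k :: nat where k: "L / r x < 2 ^ k"
      using real_arch_pow[of 2 "L / r x"] by auto
    have "L / 2 ^ k < r x" using k r[OF x] by (simp add: field_simps)
    then have P: "\<exists>k. L / 2 ^ k < r x" by blast
    define k0 where "k0 = (LEAST k. L / 2 ^ k < r x)"
    have k0: "L / 2 ^ k0 < r x" unfolding k0_def using P by (rule LeastI_ex)
    then have "k0 \<noteq> 0" using r[OF x] by (intro notI) auto
    then obtain j where j: "k0 = Suc j" by (cases k0) auto
    then have "\<not> L / 2 ^ j < r x" unfolding k0_def using not_less_Least[of j "\<lambda>k. L / 2 ^ k < r x"] by auto
    then show ?thesis using k0 j by (intro exI[of _ j]) auto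
  qed
  define gen where "gen x = (SOME j::nat. L / 2 ^ Suc j < r x \<and> r x \<le> L / 2 ^ j)" for x
  have gen: "L / 2 ^ Suc (gen x) < r x" "r x \<le> L / 2 ^ gen x" if "x \<in> A" for x
    using someI_ex[OF ex[OF that]] unfolding gen_def by auto
  \<comment> \<open>Two points of generation \<open>j\<close> in a common cell of side \<open>h j\<close> lie in each other's cubes.\<close>
  define h where "h j = L / 2 ^ (j + 2)" for j :: nat
  have h: "h j > 0" for j using L by (simp add: h_def)
  define cell :: "nat \<Rightarrow> real ^ 'm \<Rightarrow> int ^ 'm" where "cell j x = (\<chi> i. \<lfloor>x $ i / h j\<rfloor>)" for j x
  define avail where "avail j V = {x\<in>A. gen x = j} - V" for j V
  define pick where "pick j V = (\<lambda>c. SOME x. x \<in> avail j V \<and> cell j x = c) ` (cell j ` avail j V)" for j V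
  \<comment> \<open>\<open>Cv j\<close> is the part covered by the cubes selected in the generations before \<open>j\<close>.\<close>
  define Cv :: "nat \<Rightarrow> (real ^ 'm) set" where "Cv = rec_nat {} (\<lambda>j V. V \<union> (\<Union>x\<in>pick j V. cb x (r x)))"
  have Cv_Suc: "Cv (Suc j) = Cv j \<union> (\<Union>x\<in>pick j (Cv j). cb x (r x))" for j by (simp add: Cv_def)
  have Cv0: "Cv 0 = {}" by (simp add: Cv_def)
  have Cv_mono: "Cv i \<subseteq> Cv j" if "i \<le> j" for i j
    using that by (rule lift_Suc_mono_le[rotated]) (auto simp: Cv_Suc)
  define T where "T j = pick j (Cv j)" for j
  define S where "S = (\<Union>j. T j)"
  have some: "(SOME x. x \<in> avail j V \<and> cell j x = cell j y) \<in> avail j V"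
       "cell j (SOME x. x \<in> avail j V \<and> cell j x = cell j y) = cell j y" if "y \<in> avail j V" for j V y
    using someI[of "\<lambda>x. x \<in> avail j V \<and> cell j x = cell j y" y] that by auto
  have T1: "x \<in> A \<and> gen x = j \<and> x \<notin> Cv j" if "x \<in> T j" for x j
  proof -
    have "x \<in> avail j (Cv j)" using that some(1) unfolding T_def pick_def by auto
    then show ?thesis by (simp add: avail_def)
  qed
  have T2: "x = y" if "x \<in> T j" "y \<in> T j" "cell j x = cell j y" for x y j
  proof -
    define g where "g c = (SOME x. x \<in> avail j (Cv j) \<and> cell j x = c)" for c
    have pk: "T j = g ` (cell j ` avail j (Cv j))" unfolding T_def pick_def g_def ..
    from that(1)[unfolded pk] obtain u where u: "u \<in> avail j (Cv j)" "x = g (cell j u)" by (elim imageE) simp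
    from that(2)[unfolded pk] obtain v where v: "v \<in> avail j (Cv j)" "y = g (cell j v)" by (elim imageE) simp
    have "cell j (g (cell j u)) = cell j u" "cell j (g (cell j v)) = cell j v"
      unfolding g_def by (rule some(2)[OF u(1)], rule some(2)[OF v(1)])
    then have "cell j u = cell j v" using that(3) u(2) v(2) by simp
    then show ?thesis using u v by simp
  qed
  have T3: "cb x (r x) \<subseteq> Cv j" if "x \<in> T i" "i < j" for x i j
  proof -
    have "cb x (r x) \<subseteq> Cv (Suc i)" using that(1) by (auto simp: Cv_Suc T_def)
    then show ?thesis using Cv_mono[of "Suc i" j] that(2) by auto
  qed
  have CvS: "Cv j \<subseteq> (\<Union>x\<in>S. cb x (r x))" for j
    by (induction j) (auto simp: Cv0 Cv_Suc S_def T_def)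
  have SA: "S \<subseteq> A" using T1 by (auto simp: S_def)
  have cntS: "countable S"
    unfolding S_def
  proof (rule countable_UN)
    show "countable (T j)" for j unfolding T_def pick_def by (rule countable_image[OF countableI_type])
  qed simp
  have cover: "A \<subseteq> (\<Union>x\<in>S. cb x (r x))"
  proof
    fix x assume x: "x \<in> A"
    define j where "j = gen x"
    show "x \<in> (\<Union>x\<in>S. cb x (r x))"
    proof (cases "x \<in> Cv j")
      case True then show ?thesis using CvS by blast
    next
      case False
      then have av: "x \<in> avail j (Cv j)" using x by (simp add: avail_def j_def)
      define y where "y = (SOME y. y \<in> avail j (Cv j) \<and> cell j y = cell j x)"
      have yT: "y \<in> T j" unfolding T_def pick_def y_def by (rule imageI[OF imageI[OF av]])
      have ce: "cell j y = cell j x" using some(2)[OF av] unfolding y_def by simp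
      have yA: "y \<in> A" "gen y = j" using T1[OF yT] by auto
      have "\<bar>x $ i - y $ i\<bar> \<le> r y / 2" for i
      proof -
        have "\<lfloor>y $ i / h j\<rfloor> = \<lfloor>x $ i / h j\<rfloor>" using arg_cong[OF ce, of "\<lambda>v. v $ i"] by (simp add: cell_def)
        then have "\<bar>x $ i / h j - y $ i / h j\<bar> < 1" by linarith
        then have "\<bar>x $ i - y $ i\<bar> < h j" using h[of j] by (simp add: diff_divide_distrib[symmetric] pos_divide_less_eq)
        also have "h j \<le> r y / 2" using gen(1)[OF yA(1)] yA(2) by (simp add: h_def field_simps)
        finally show ?thesis by simp
      qed
      then have "x \<in> cb y (r y)" by (simp add: mem_cb)
      then show ?thesis using yT by (auto simp: S_def)
    qed
  qed
  have overlap: "finite {x\<in>S. z \<in> cb x (r x)} \<and> card {x\<in>S. z \<in> cb x (r x)} \<le> 10 ^ CARD('m)" for z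
  proof -
    \<comment> \<open>For each coordinate, the side of \<open>z\<close> and the offset of the grid cell: these data determine a selected center.\<close>
    define \<phi> :: "real ^ 'm \<Rightarrow> 'm \<Rightarrow> bool \<times> int" where
      "\<phi> x = (\<lambda>i. (x $ i \<ge> z $ i, \<lfloor>x $ i / h (gen x)\<rfloor> - \<lfloor>z $ i / h (gen x)\<rfloor>))" for x
    define B where "B = PiE (UNIV :: 'm set) (\<lambda>_. (UNIV :: bool set) \<times> {-2..2::int})"
    have B: "finite B" "card B = 10 ^ CARD('m)" by (auto simp: B_def finite_PiE card_PiE card_cartesian_product)
    have lt: False if xy: "x \<in> S" "y \<in> S" "z \<in> cb x (r x)" "z \<in> cb y (r y)" "gen x < gen y" "\<phi> x = \<phi> y" for x y
    proof -
      have xA: "x \<in> A" "y \<in> A" using xy SA by auto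
      have xT: "x \<in> T (gen x)" "y \<in> T (gen y)" using xy(1,2) T1 by (auto simp: S_def)
      have "r y \<le> L / 2 ^ gen y" by (rule gen(2)[OF xA(2)])
      also have "\<dots> \<le> L / 2 ^ Suc (gen x)" using xy(5) L by (intro divide_left_mono power_increasing mult_pos_pos) auto
      also have "\<dots> \<le> r x" using gen(1)[OF xA(1)] by simp
      finally have ryx: "r y \<le> r x" .
      have "\<bar>y $ i - x $ i\<bar> \<le> r x / 2" for i
      proof -
        have "(x $ i \<ge> z $ i) = (y $ i \<ge> z $ i)" using fun_cong[OF xy(6), of i] by (simp add: \<phi>_def)
        moreover have "\<bar>z $ i - x $ i\<bar> \<le> r x / 2" "\<bar>z $ i - y $ i\<bar> \<le> r y / 2" using xy(3,4) by (auto simp: mem_cb)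
        ultimately show ?thesis using ryx by (cases "x $ i \<ge> z $ i") linarith+
      qed
      then have "y \<in> cb x (r x)" by (simp add: mem_cb)
      then show False using T3[OF xT(1) xy(5)] T1[OF xT(2)] by blast
    qed
    have inj: "inj_on \<phi> {x\<in>S. z \<in> cb x (r x)}"
    proof (rule inj_onI)
      fix x y assume x: "x \<in> {x\<in>S. z \<in> cb x (r x)}" and y: "y \<in> {x\<in>S. z \<in> cb x (r x)}" and eq: "\<phi> x = \<phi> y"
      have g: "gen x = gen y" 
        using lt[of x y] lt[of y x] x y eq by (cases "gen x" "gen y" rule: linorder_cases) auto
      have "cell (gen x) x = cell (gen x) y"
        unfolding cell_def vec_eq_iff using fun_cong[OF eq] g by (simp add: \<phi>_def)
      moreover have "x \<in> T (gen x)" "y \<in> T (gen x)" using x y T1 g by (auto simp: S_def)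
      ultimately show "x = y" using T2 by blast
    qed
    have img: "\<phi> ` {x\<in>S. z \<in> cb x (r x)} \<subseteq> B"
    proof (rule image_subsetI)
      fix x assume x: "x \<in> {x\<in>S. z \<in> cb x (r x)}"
      then have xA: "x \<in> A" using SA by auto
      have "\<lfloor>x $ i / h (gen x)\<rfloor> - \<lfloor>z $ i / h (gen x)\<rfloor> \<in> {-2..2}" for i
      proof -
        have "\<bar>x $ i - z $ i\<bar> \<le> r x / 2" 
          using x by (simp add: mem_cb abs_minus_commute)
        also have "\<dots> \<le> 2 * h (gen x)" using gen(2)[OF xA] by (simp add: h_def field_simps)
        finally have "\<bar>x $ i / h (gen x) - z $ i / h (gen x)\<bar> \<le> 2" using h[of "gen x"]
          by (simp add: diff_divide_distrib[symmetric] pos_divide_le_eq)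
        then show ?thesis by simp linarith
      qed
      then show "\<phi> x \<in> B" by (auto simp: B_def \<phi>_def)
    qed
    have fin: "finite {x\<in>S. z \<in> cb x (r x)}" using inj_on_finite[OF inj img B(1)] .
    have "card {x\<in>S. z \<in> cb x (r x)} \<le> card B" by (rule card_inj_on_le[OF inj img B(1)])
    with fin B(2) show ?thesis by simp
  qed
  show ?thesis 
    by (intro exI[of _ S] conjI allI SA cntS cover conjunct1[OF overlap] conjunct2[OF overlap])
qed

lemma cb_borel[measurable]: "cb x s \<in> sets borel"
  unfolding cube_set_def by (rule borel_closed[OF closed_cbox])

text \<open>
  The form in which the covering lemma is used: an estimate on the cubes sums up to an estimate
  on the whole set, at the price of the overlap constant.  Two measures are allowed because small
  doubling cubes are found by a comparison with Lebesgue measure.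
\<close>

lemma besicovitch_integral:
  fixes A :: "(real ^ 'm) set" and \<mu> \<nu> :: "(real ^ 'm) measure" and \<phi> \<psi> :: "real ^ 'm \<Rightarrow> ennreal"
  assumes L: "L > 0" and r: "\<And>x. x \<in> A \<Longrightarrow> 0 < r x \<and> r x \<le> L"
    and sets[measurable_cong]: "sets \<mu> = sets borel" "sets \<nu> = sets borel"
    and [measurable]: "\<phi> \<in> borel_measurable borel" "\<psi> \<in> borel_measurable borel"
    and W[measurable]: "W \<in> sets borel" and sub: "\<And>x. x \<in> A \<Longrightarrow> cb x (r x) \<subseteq> W"
    and le: "\<And>x. x \<in> A \<Longrightarrow> (\<integral>\<^sup>+y. \<phi> y * indicator (cb x (r x)) y \<partial>\<mu>) \<le> (\<integral>\<^sup>+y. \<psi> y * indicator (cb x (r x)) y \<partial>\<nu>)"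
  shows "\<exists>U\<in>sets borel. A \<subseteq> U \<and>
    (\<integral>\<^sup>+y. \<phi> y * indicator U y \<partial>\<mu>) \<le> 10 ^ CARD('m) * (\<integral>\<^sup>+y. \<psi> y * indicator W y \<partial>\<nu>)"
proof -
  have "\<exists>S\<subseteq>A. countable S \<and> A \<subseteq> (\<Union>x\<in>S. cb x (r x)) \<and>
           (\<forall>z. finite {x\<in>S. z \<in> cb x (r x)} \<and> card {x\<in>S. z \<in> cb x (r x)} \<le> 10 ^ CARD('m))"
    by (rule besicovitch_cubes[OF L r])
  then obtain S where S: "S \<subseteq> A" "countable S" "A \<subseteq> (\<Union>x\<in>S. cb x (r x))"
    and ov: "\<And>z. finite {x\<in>S. z \<in> cb x (r x)} \<and> card {x\<in>S. z \<in> cb x (r x)} \<le> 10 ^ CARD('m)"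
    by (elim exE conjE) (rule that, assumption+, erule spec)
  define U where "U = (\<Union>x\<in>S. cb x (r x))"
  have U: "U \<in> sets borel" unfolding U_def using S(2) by (intro sets.countable_UN'') auto
  have cnt: "(\<integral>\<^sup>+x. indicator (cb x (r x)) z \<partial>count_space S) = of_nat (card {x\<in>S. z \<in> cb x (r x)})" for z
  proof -
    have "(\<integral>\<^sup>+x. indicator (cb x (r x)) z \<partial>count_space S) = (\<integral>\<^sup>+x. indicator {x\<in>S. z \<in> cb x (r x)} x \<partial>count_space S)"
      by (intro nn_integral_cong) (auto simp: indicator_def)
    also have "\<dots> = emeasure (count_space S) {x\<in>S. z \<in> cb x (r x)}" by (rule nn_integral_indicator) auto
    also have "\<dots> = of_nat (card {x\<in>S. z \<in> cb x (r x)})" using ov by (subst emeasure_count_space_finite) auto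
    finally show ?thesis .
  qed
  have "(\<integral>\<^sup>+y. \<phi> y * indicator U y \<partial>\<mu>) \<le> (\<integral>\<^sup>+y. (\<integral>\<^sup>+x. \<phi> y * indicator (cb x (r x)) y \<partial>count_space S) \<partial>\<mu>)"
  proof (rule nn_integral_mono)
    fix y
    show "\<phi> y * indicator U y \<le> (\<integral>\<^sup>+x. \<phi> y * indicator (cb x (r x)) y \<partial>count_space S)"
    proof (cases "y \<in> U")
      case True
      then obtain x where x: "x \<in> S" "y \<in> cb x (r x)" by (auto simp: U_def)
      then have "card {x\<in>S. y \<in> cb x (r x)} \<noteq> 0" using ov by auto
      then have "(1::ennreal) \<le> of_nat (card {x\<in>S. y \<in> cb x (r x)})" by (metis Suc_leI gr0I of_nat_1 of_nat_mono One_nat_def)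
      then have "\<phi> y * 1 \<le> \<phi> y * of_nat (card {x\<in>S. y \<in> cb x (r x)})" by (intro mult_left_mono) auto
      then show ?thesis using True by (simp add: nn_integral_cmult cnt)
    qed auto
  qed
  also have "\<dots> = (\<integral>\<^sup>+x. (\<integral>\<^sup>+y. \<phi> y * indicator (cb x (r x)) y \<partial>\<mu>) \<partial>count_space S)"
    by (rule nn_integral_count_space_nn_integral[OF S(2)]) measurable
  also have "\<dots> \<le> (\<integral>\<^sup>+x. (\<integral>\<^sup>+y. \<psi> y * indicator (cb x (r x)) y \<partial>\<nu>) \<partial>count_space S)"
    using S(1) by (intro nn_integral_mono le) auto
  also have "\<dots> = (\<integral>\<^sup>+y. (\<integral>\<^sup>+x. \<psi> y * indicator (cb x (r x)) y \<partial>count_space S) \<partial>\<nu>)"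
    by (rule nn_integral_count_space_nn_integral[OF S(2), symmetric]) measurable
  also have "\<dots> \<le> (\<integral>\<^sup>+y. 10 ^ CARD('m) * (\<psi> y * indicator W y) \<partial>\<nu>)"
  proof (rule nn_integral_mono)
    fix y
    show "(\<integral>\<^sup>+x. \<psi> y * indicator (cb x (r x)) y \<partial>count_space S) \<le> 10 ^ CARD('m) * (\<psi> y * indicator W y)"
    proof (cases "y \<in> W")
      case True
      have "of_nat (card {x\<in>S. y \<in> cb x (r x)}) \<le> (of_nat (10 ^ CARD('m)) :: ennreal)" using ov by (intro of_nat_mono) auto
      then show ?thesis using True by (simp add: nn_integral_cmult cnt mult.commute mult_left_mono)
    next
      case False
      then have "(\<integral>\<^sup>+x. \<psi> y * indicator (cb x (r x)) y \<partial>count_space S) = (\<integral>\<^sup>+x. 0 \<partial>count_space S)"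
        using sub S(1) by (intro nn_integral_cong) (auto simp: indicator_def)
      then show ?thesis by simp
    qed
  qed
  also have "\<dots> = 10 ^ CARD('m) * (\<integral>\<^sup>+y. \<psi> y * indicator W y \<partial>\<nu>)" by (rule nn_integral_cmult) measurable
  finally show ?thesis using U S(3) by (intro bexI[of _ U]) (auto simp: U_def)
qed

section \<open>Small doubling cubes\<close>

lemma compl_supp_null:
  fixes \<mu> :: "('a::second_countable_topology) measure"
  assumes sets: "sets \<mu> = sets borel"
  shows "- supp \<mu> \<in> null_sets \<mu>"
proof -
  define F where "F = {U. open U \<and> emeasure \<mu> U = 0}"
  obtain F' where F': "F' \<subseteq> F" "countable F'" "\<Union>F' = \<Union>F"
    using Lindelof[of F] by (auto simp: F_def)
  have "- supp \<mu> = \<Union>F'" unfolding F'(3) by (auto simp: supp_def F_def)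
  moreover have "\<Union>F' \<in> null_sets \<mu>"
  proof -
    have "(\<Union>U\<in>F'. U) \<in> null_sets \<mu>"
      using F'(1,2) sets by (intro null_sets_UN') (auto simp: F_def null_sets_def)
    then show ?thesis by simp
  qed
  ultimately show ?thesis by simp
qed

lemma cb_mono: "s \<le> t \<Longrightarrow> cb x s \<subseteq> cb x t"
  unfolding mem_cb subset_iff by (meson divide_right_mono order_trans zero_le_numeral)

lemma center_in_cb[simp]: "0 \<le> s \<Longrightarrow> x \<in> cb x s"
  by (simp add: mem_cb)

lemma ball_subset_cb: "ball x (s / 2) \<subseteq> cb x s"
proof
  fix y assume "y \<in> ball x (s / 2)"
  then have "norm (y - x) < s / 2" by (simp add: dist_norm norm_minus_commute)
  then have "\<bar>(y - x) $ i\<bar> \<le> s / 2" for i using component_le_norm_cart[of "y - x" i] by linarith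
  then show "y \<in> cb x s" by (simp add: mem_cb)
qed

lemma not_in_cb_dist:
  assumes "y \<notin> cb x s" shows "s / 2 < dist x y"
proof -
  obtain i where "s / 2 < \<bar>y $ i - x $ i\<bar>" using assms by (auto simp: mem_cb not_le)
  also have "\<dots> \<le> dist x y" using component_le_norm_cart[of "y - x" i] by (simp add: dist_norm norm_minus_commute)
  finally show ?thesis .
qed

lemma emeasure_lborel_cb:
  assumes "0 \<le> s" shows "emeasure lborel (cb (x :: real ^ 'm) s) = ennreal (s ^ CARD('m))"
proof -
  have "cbox (x - vec (s / 2)) (x + vec (s / 2)) \<noteq> {}"
    using center_in_cb[OF assms, of x] by (auto simp: cube_set_def)
  then have "measure lborel (cb x s) = s ^ CARD('m)"
    by (simp add: cube_set_def content_cbox_cart)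
  then show ?thesis
    using emeasure_bounded_finite[of "cb x s"] by (subst emeasure_eq_ennreal_measure) (auto simp: cube_set_def)
qed

lemma supp_measure_pos:
  assumes "x \<in> supp \<mu>" "s > 0" "sets \<mu> = sets borel" "finite_measure \<mu>"
  shows "measure \<mu> (cb x s) > 0"
proof -
  interpret finite_measure \<mu> by fact
  have "emeasure \<mu> (ball x (s / 2)) \<noteq> 0" using assms by (auto simp: supp_def)
  then have "measure \<mu> (ball x (s / 2)) > 0" by (simp add: emeasure_eq_measure zero_less_measure_iff)
  also have "\<dots> \<le> measure \<mu> (cb x s)" using ball_subset_cb[of x s] assms(3) by (intro finite_measure_mono) auto
  finally show ?thesis .
qed

text \<open>
  If from some scale on no cube Q(x,4^(-k)) is doubling, then \<mu>(Q(x,4^(-k))) decays faster than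
  its Lebesgue measure.  A set of such points is covered by cubes of a fixed small side with bounded
  overlap, so that its measure is at most a constant times the quotient of the two, which tends to zero.
\<close>

lemma doubling_cubes_shrinking:
  fixes \<mu> :: "(real ^ 'm) measure"
  assumes sets: "sets \<mu> = sets borel" and fin: "finite_measure \<mu>" and \<beta>: "\<beta> \<ge> 2 * 4 ^ CARD('m)"
  shows "AE x in \<mu>. \<exists>l :: nat \<Rightarrow> real. (\<forall>k. ab_doubling \<mu> 4 \<beta> (x, l k)) \<and> l \<longlonglongrightarrow> 0"
proof -
  interpret finite_measure \<mu> by fact
  note sets[measurable_cong]
  define M where "M = measure \<mu> UNIV"
  have M: "measure \<mu> X \<le> M" for X using bounded_measure[of X] sets_eq_imp_space_eq[OF sets] by (simp add: M_def)
  \<comment> \<open>The bad points, localized so that Lebesgue measure is finite.\<close>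
  define E where "E k0 N = {x \<in> supp \<mu>. (\<forall>k\<ge>k0. \<not> ab_doubling \<mu> 4 \<beta> (x, (1/4) ^ k)) \<and> x \<in> cb 0 (real N)}" for k0 N :: nat
  have ex: "\<exists>Z\<in>null_sets \<mu>. E k0 N \<subseteq> Z" for k0 N
  proof -
    have decay: "measure \<mu> (cb x ((1/4) ^ (k0 + j))) \<le> M / (2 * 4 ^ CARD('m)) ^ j" if x: "x \<in> E k0 N" for x j
    proof (induction j)
      case 0 then show ?case by (simp add: M)
    next
      case (Suc j)
      define q :: real where "q = 2 * 4 ^ CARD('m)"
      have q: "q > 0" "q \<le> \<beta>" using \<beta> by (auto simp: q_def)
      have "\<not> ab_doubling \<mu> 4 \<beta> (x, (1/4) ^ (k0 + Suc j))" 
      proof -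
        have "\<forall>k\<ge>k0. \<not> ab_doubling \<mu> 4 \<beta> (x, (1/4) ^ k)" using x by (simp add: E_def)
        then show ?thesis using le_add1[of k0 "Suc j"] by blast
      qed
      then have "\<beta> * measure \<mu> (cb x ((1/4) ^ (k0 + Suc j))) \<le> measure \<mu> (cb x (4 * (1/4) ^ (k0 + Suc j)))"
        using x by (auto simp: ab_doubling_def is_cube_def dilate_def E_def)
      also have "4 * (1/4::real) ^ (k0 + Suc j) = (1/4) ^ (k0 + j)" by simp
      also note Suc
      finally have "q * measure \<mu> (cb x ((1/4) ^ (k0 + Suc j))) \<le> M / q ^ j"
        using q mult_right_mono[OF q(2), of "measure \<mu> (cb x ((1/4) ^ (k0 + Suc j)))"] unfolding q_def by simp
      then show ?case using q(1) unfolding q_def[symmetric] by (simp add: field_simps)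
    qed
    have "\<exists>U\<in>sets borel. E k0 N \<subseteq> U \<and> emeasure \<mu> U \<le> ennreal (10 ^ CARD('m) * (M * (4 ^ (k0 * CARD('m))) * (2 * real N + 2) ^ CARD('m)) * (1/2)^j)" for j
    proof -
      \<comment> \<open>The density with respect to Lebesgue measure that the decay allows at scale \<open>k0 + j\<close>.\<close>
      define \<kappa> where "\<kappa> = M * 4 ^ (k0 * CARD('m)) / 2 ^ j"
      have M0: "M \<ge> 0" by (simp add: M_def)
      then have \<kappa>0: "\<kappa> \<ge> 0" by (simp add: \<kappa>_def)
      have "\<exists>U\<in>sets borel. E k0 N \<subseteq> U \<and> (\<integral>\<^sup>+y. (\<lambda>_. 1) y * indicator U y \<partial>\<mu>) \<le> 10 ^ CARD('m) * (\<integral>\<^sup>+y. (\<lambda>_. ennreal \<kappa>) y * indicator (cb (0::real^'m) (2 * real N + 2)) y \<partial>lborel)"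
      proof (rule besicovitch_integral[where L=1 and r="\<lambda>_. (1/4) ^ (k0 + j)"
          and A="E k0 N" and \<mu>=\<mu> and \<nu>=lborel and \<phi>="\<lambda>_. 1" and \<psi>="\<lambda>_. ennreal \<kappa>" and W="cb 0 (2 * real N + 2)"])
        fix x assume x: "x \<in> E k0 N"
        show "0 < (1/4::real) ^ (k0 + j) \<and> (1/4::real) ^ (k0 + j) \<le> 1" by (simp add: power_le_one)
        show "cb x ((1/4) ^ (k0 + j)) \<subseteq> cb 0 (2 * real N + 2)"
        proof
          fix y assume y: "y \<in> cb x ((1/4) ^ (k0 + j))"
          have "(1/4::real) ^ (k0 + j) \<le> 1" by (simp add: power_le_one)
          then have yx: "\<bar>y $ i - x $ i\<bar> \<le> 1/2" for i using y by (auto simp: mem_cb intro: order_trans)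
          have xn: "\<bar>x $ i\<bar> \<le> real N / 2" for i using x by (auto simp: E_def mem_cb)
          have yN: "\<bar>y $ i\<bar> \<le> real N + 1" for i
            using yx[of i] xn[of i] of_nat_0_le_iff[of N, where 'a=real] by linarith
          have "\<bar>y $ i\<bar> * 2 \<le> 2 * real N + 2" for i using yN[of i] by linarith
          then show "y \<in> cb 0 (2 * real N + 2)" by (simp add: mem_cb)
        qed
        have "(\<integral>\<^sup>+y. 1 * indicator (cb x ((1/4) ^ (k0 + j))) y \<partial>\<mu>) = ennreal (measure \<mu> (cb x ((1/4) ^ (k0 + j))))"
          using sets by (simp add: emeasure_eq_measure)
        also have "\<dots> \<le> ennreal (\<kappa> * ((1/4) ^ (k0 + j)) ^ CARD('m))"
        proof (rule ennreal_leI)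
          have "\<kappa> * ((1/4) ^ (k0 + j)) ^ CARD('m) = M / (2 * 4 ^ CARD('m)) ^ j"
            unfolding \<kappa>_def by (simp add: field_simps power_add power_mult power_mult_distrib flip: power_mult)
          then show "measure \<mu> (cb x ((1/4) ^ (k0 + j))) \<le> \<kappa> * ((1/4) ^ (k0 + j)) ^ CARD('m)" using decay[OF x, of j] by simp
        qed
        also have "\<dots> = (\<integral>\<^sup>+y. ennreal \<kappa> * indicator (cb x ((1/4) ^ (k0 + j))) y \<partial>lborel)"
          using M0 by (subst nn_integral_cmult_indicator) (auto simp: emeasure_lborel_cb ennreal_mult \<kappa>0)
        finally show "(\<integral>\<^sup>+y. 1 * indicator (cb x ((1/4) ^ (k0 + j))) y \<partial>\<mu>) \<le> (\<integral>\<^sup>+y. ennreal \<kappa> * indicator (cb x ((1/4) ^ (k0 + j))) y \<partial>lborel)" .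
      qed (use sets in auto)
      then obtain U where U: "U \<in> sets borel" "E k0 N \<subseteq> U"
        "(\<integral>\<^sup>+y. 1 * indicator U y \<partial>\<mu>) \<le> 10 ^ CARD('m) * (\<integral>\<^sup>+y. ennreal \<kappa> * indicator (cb (0::real^'m) (2 * real N + 2)) y \<partial>lborel)"
        by auto
      have "emeasure \<mu> U = (\<integral>\<^sup>+y. 1 * indicator U y \<partial>\<mu>)" using U(1) sets by simp
      also note U(3)
      also have "(\<integral>\<^sup>+y. ennreal \<kappa> * indicator (cb (0::real^'m) (2 * real N + 2)) y \<partial>lborel) = ennreal \<kappa> * ennreal ((2 * real N + 2) ^ CARD('m))"
        by (subst nn_integral_cmult_indicator) (auto simp: emeasure_lborel_cb)
      also have "10 ^ CARD('m) * (ennreal \<kappa> * ennreal ((2 * real N + 2) ^ CARD('m))) = ennreal (10 ^ CARD('m) * (\<kappa> * (2 * real N + 2) ^ CARD('m)))"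
        using \<kappa>0 by (simp add: ennreal_mult flip: ennreal_power)
      also have "10 ^ CARD('m) * (\<kappa> * (2 * real N + 2) ^ CARD('m)) = 10 ^ CARD('m) * (M * (4 ^ (k0 * CARD('m))) * (2 * real N + 2) ^ CARD('m)) * (1/2)^j"
        unfolding \<kappa>_def by (simp add: power_divide)
      finally show ?thesis using U by auto
    qed
    then obtain U where U: "\<And>j. U j \<in> sets borel" "\<And>j. E k0 N \<subseteq> U j"
      "\<And>j. emeasure \<mu> (U j) \<le> ennreal (10 ^ CARD('m) * (M * (4 ^ (k0 * CARD('m))) * (2 * real N + 2) ^ CARD('m)) * (1/2)^j)"
      by metis
    define c where "c = 10 ^ CARD('m) * (M * (4 ^ (k0 * CARD('m))) * (2 * real N + 2) ^ CARD('m))"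
    define Z where "Z = (\<Inter>j. U j)"
    have Zs: "Z \<in> sets \<mu>" using U(1) sets by (auto simp: Z_def)
    have "measure \<mu> Z \<le> c * (1/2) ^ j" for j
    proof -
      have "emeasure \<mu> Z \<le> emeasure \<mu> (U j)" using U(1) sets by (intro emeasure_mono) (auto simp: Z_def)
      also have "\<dots> \<le> ennreal (c * (1/2) ^ j)" using U(3) by (simp add: c_def)
      finally show ?thesis by (subst (asm) emeasure_eq_measure) (simp add: c_def M_def)
    qed
    moreover have "(\<lambda>j. c * (1/2::real) ^ j) \<longlonglongrightarrow> c * 0" by (intro tendsto_mult tendsto_const LIMSEQ_realpow_zero) auto
    ultimately have "measure \<mu> Z \<le> 0" by (intro LIMSEQ_le_const[where X="\<lambda>j. c * (1/2) ^ j"]) auto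
    then have "Z \<in> null_sets \<mu>" using Zs by (simp add: null_sets_def emeasure_eq_measure order_antisym)
    moreover have "E k0 N \<subseteq> Z" using U(2) by (auto simp: Z_def)
    ultimately show ?thesis by blast
  qed
  then obtain Z where Z: "\<And>k N. Z k N \<in> null_sets \<mu>" "\<And>k N. E k N \<subseteq> Z k N" by metis
  have "(\<Union>k. \<Union>N. Z k N) \<in> null_sets \<mu>" using Z(1) by auto
  then have "(\<Union>k. \<Union>N. Z k N) \<union> - supp \<mu> \<in> null_sets \<mu>" using compl_supp_null[OF sets] by auto
  then show ?thesis
  proof (rule AE_I')
    show "{x \<in> space \<mu>. \<not> (\<exists>l :: nat \<Rightarrow> real. (\<forall>k. ab_doubling \<mu> 4 \<beta> (x, l k)) \<and> l \<longlonglongrightarrow> 0)} \<subseteq> (\<Union>k. \<Union>N. Z k N) \<union> - supp \<mu>"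
    proof (rule subsetI, rule ccontr)
      fix x assume x: "x \<in> {x \<in> space \<mu>. \<not> (\<exists>l :: nat \<Rightarrow> real. (\<forall>k. ab_doubling \<mu> 4 \<beta> (x, l k)) \<and> l \<longlonglongrightarrow> 0)}"
        and nx: "x \<notin> (\<Union>k. \<Union>N. Z k N) \<union> - supp \<mu>"
      obtain N :: nat where N: "2 * norm x \<le> real N" using real_arch_simple by blast
      have xN: "x \<in> cb 0 (real N)"
        unfolding mem_cb
      proof
        fix i show "\<bar>x $ i - (0::real^'m) $ i\<bar> \<le> real N / 2" using N component_le_norm_cart[of x i] by simp
      qed
      have "\<exists>k\<ge>k0. ab_doubling \<mu> 4 \<beta> (x, (1/4) ^ k)" for k0
        using nx Z(2)[of k0 N] xN by (auto simp: E_def)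
      then obtain g where g: "\<And>k0. g k0 \<ge> k0" "\<And>k0. ab_doubling \<mu> 4 \<beta> (x, (1/4) ^ g k0)" by metis
      have "(\<lambda>k. (1/4::real) ^ g k) \<longlonglongrightarrow> 0"
      proof (rule tendsto_sandwich[of "\<lambda>_. 0" _ _ "\<lambda>k. (1/4) ^ k"])
        show "\<forall>\<^sub>F k in sequentially. (1/4::real) ^ g k \<le> (1/4) ^ k"
          by (intro always_eventually allI power_decreasing g(1)) auto
        show "(\<lambda>k. (1/4::real) ^ k) \<longlonglongrightarrow> 0" by (rule LIMSEQ_realpow_zero) auto
      qed auto
      then have "\<exists>l :: nat \<Rightarrow> real. (\<forall>k. ab_doubling \<mu> 4 \<beta> (x, l k)) \<and> l \<longlonglongrightarrow> 0"
        by (intro exI[of _ "\<lambda>k. (1/4) ^ g k"]) (simp add: g(2))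
      moreover have "\<not> (\<exists>l :: nat \<Rightarrow> real. (\<forall>k. ab_doubling \<mu> 4 \<beta> (x, l k)) \<and> l \<longlonglongrightarrow> 0)"
        using x by (rule CollectE) (erule conjunct2)
      ultimately show False by (rule notE[rotated])
    qed
  qed
qed

text \<open>
  The infimum in the definition of the doubling constant is over a nonempty set, hence it is not
  an arbitrary default value.
\<close>

lemma admissible_beta_nonempty:
  fixes \<mu> :: "(real ^ 'm) measure"
  assumes "sets \<mu> = sets borel" "finite_measure \<mu>"
  shows "2 * 4 ^ CARD('m) + 4 powr n \<in> admissible_beta n \<mu> 4"
  unfolding admissible_beta_def using doubling_cubes_shrinking[OF assms] by simp

text \<open>
  The factor two is the strict gain over 4^n that makes densities decay along non-doubling chains.
\<close>

lemma beta_n_ge: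
  fixes \<mu> :: "(real ^ 'm) measure"
  assumes "sets \<mu> = sets borel" "finite_measure \<mu>"
  shows "beta_n n \<mu> \<ge> 2 * 4 powr n"
proof -
  have "4 powr n \<le> Inf (admissible_beta n \<mu> 4)"
  proof (rule cInf_greatest)
    show "admissible_beta n \<mu> 4 \<noteq> {}" using admissible_beta_nonempty[OF assms, of n] by blast
  qed (simp add: admissible_beta_def)
  then show ?thesis by (simp add: beta_n_def)
qed

lemma AE_small_doubling_cubes:
  fixes \<mu> :: "(real ^ 'm) measure"
  assumes "sets \<mu> = sets borel" "finite_measure \<mu>"
  shows "AE x in \<mu>. \<forall>s>0. \<exists>l. 0 < l \<and> l \<le> s \<and> doubling n \<mu> (x, l)"
proof -
  have "Inf (admissible_beta n \<mu> 4) < beta_n n \<mu>"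
    using beta_n_ge[OF assms, of n] powr_gt_zero[of 4 n] unfolding beta_n_def by linarith
  then obtain \<beta> where \<beta>: "\<beta> \<in> admissible_beta n \<mu> 4" "\<beta> < beta_n n \<mu>"
    using cInf_lessD admissible_beta_nonempty[OF assms, of n] by blast
  have "AE x in \<mu>. \<exists>l :: nat \<Rightarrow> real. (\<forall>k. ab_doubling \<mu> 4 \<beta> (x, l k)) \<and> l \<longlonglongrightarrow> 0"
    using \<beta>(1) by (simp add: admissible_beta_def)
  then show ?thesis
  proof (rule AE_mp, intro AE_I2 impI allI)
    fix x s assume "\<exists>l :: nat \<Rightarrow> real. (\<forall>k. ab_doubling \<mu> 4 \<beta> (x, l k)) \<and> l \<longlonglongrightarrow> 0" and s: "s > (0::real)"
    then obtain l :: "nat \<Rightarrow> real" where l: "\<And>k. ab_doubling \<mu> 4 \<beta> (x, l k)" "l \<longlonglongrightarrow> 0" by blast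
    obtain k where k: "l k < s" using order_tendstoD(2)[OF l(2) s] by (auto simp: eventually_sequentially)
    have "\<beta> * measure \<mu> (cube_set (x, l k)) \<le> beta_n n \<mu> * measure \<mu> (cube_set (x, l k))"
      using \<beta>(2) by (intro mult_right_mono) auto
    then have "doubling n \<mu> (x, l k)" using l(1)[of k] by (auto simp: doubling_def ab_doubling_def)
    moreover have "l k > 0" using l(1)[of k] by (auto simp: ab_doubling_def is_cube_def)
    ultimately show "\<exists>l. 0 < l \<and> l \<le> s \<and> doubling n \<mu> (x, l)" using k by (intro exI[of _ "l k"]) auto
  qed
qed

section \<open>Sums of densities over scales\<close>

lemma cb_subset_cb:
  assumes "\<And>i. \<bar>x $ i - x' $ i\<bar> \<le> d" "s / 2 + d \<le> t / 2"
  shows "cb x s \<subseteq> cb x' t"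
proof
  fix y assume y: "y \<in> cb x s"
  have "\<bar>y $ i - x' $ i\<bar> \<le> t / 2" for i
  proof -
    have "\<bar>y $ i - x $ i\<bar> \<le> s / 2" using y by (simp add: mem_cb)
    then show ?thesis using assms(1)[of i] assms(2) by linarith
  qed
  then show "y \<in> cb x' t" by (simp add: mem_cb)
qed

lemma in_large_cube: "s > 0 \<Longrightarrow> \<exists>k::nat. y \<in> cb (x :: real ^ 'm) (2 ^ k * s)"
proof -
  assume s: "s > 0"
  obtain k :: nat where k: "2 * dist x y / s < 2 ^ k" using real_arch_pow[of 2 "2 * dist x y / s"] by auto
  have "dist x y < 2 ^ k * s / 2" using k s by (simp add: field_simps)
  then have "y \<in> ball x (2 ^ k * s / 2)" by simp
  then have "y \<in> cb x (2 ^ k * s)" by (rule subsetD[OF ball_subset_cb])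
  then show ?thesis by (rule exI)
qed

lemma incseq_cb: "s > 0 \<Longrightarrow> incseq (\<lambda>k. cb x (2 ^ k * s))"
  unfolding incseq_def by (intro allI impI cb_mono mult_right_mono power_increasing) auto

lemma UN_cb: "s > 0 \<Longrightarrow> (\<Union>k. cb (x :: real ^ 'm) (2 ^ k * s)) = UNIV"
  using in_large_cube[of s _ x] by (simp add: set_eq_iff)

lemma large_cubes:
  fixes \<mu> :: "(real ^ 'm) measure"
  assumes sets: "sets \<mu> = sets borel" and fin: "finite_measure \<mu>" and pos: "measure \<mu> UNIV > 0" and s: "s > 0"
  shows "\<exists>k0. \<forall>k\<ge>k0. measure \<mu> (cb x (2 ^ k * s)) > measure \<mu> UNIV / 2"
proof -
  interpret finite_measure \<mu> by fact
  have "(\<lambda>k. measure \<mu> (cb x (2 ^ k * s))) \<longlonglongrightarrow> measure \<mu> (\<Union>k. cb x (2 ^ k * s))"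
  proof (rule finite_Lim_measure_incseq)
    show "range (\<lambda>k. cb x (2 ^ k * s)) \<subseteq> sets \<mu>" by (simp add: sets image_subset_iff)
    show "incseq (\<lambda>k. cb x (2 ^ k * s))" by (rule incseq_cb[OF s])
  qed
  then have "\<forall>\<^sub>F k in sequentially. measure \<mu> UNIV / 2 < measure \<mu> (cb x (2 ^ k * s))"
    unfolding UN_cb[OF s] using pos by (intro order_tendstoD) auto
  then show ?thesis by (auto simp: eventually_sequentially)
qed

text \<open>
  The standing situation: a finite measure of growth n, together with a fixed cube \<open>Q(x0, L0)\<close> that
  carries more than half of the mass.  This cube serves as the reference at the largest scale.
\<close>

locale growth_measure =
  fixes \<mu> :: "(real ^ 'm) measure" and n C0 :: real and x0 :: "real ^ 'm" and L0 :: real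
  assumes n_pos: "n > 0" and sets_mu[measurable_cong, simp]: "sets \<mu> = sets borel"
    and fin_mu: "finite_measure \<mu>" and C0: "C0 > 0"
    and growth: "\<And>x s. x \<in> supp \<mu> \<Longrightarrow> s > 0 \<Longrightarrow> measure \<mu> (cb x s) \<le> C0 * s powr n"
    and x0: "x0 \<in> supp \<mu>" and L0: "L0 > 0" "measure \<mu> (cb x0 L0) > measure \<mu> UNIV / 2"

sublocale growth_measure \<subseteq> finite_measure \<mu> by (rule fin_mu)

context growth_measure begin

lemma space_mu[simp]: "space \<mu> = UNIV"
  using sets_eq_imp_space_eq[OF sets_mu] by simp

definition "dens x s = measure \<mu> (cb x s) / s powr n"
definition "\<beta> = beta_n n \<mu>"
definition "G = 2 powr n"

lemma G: "G > 1" "G * G = 4 powr n"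
proof -
  show "G > 1" using n_pos by (simp add: G_def)
  have "(4::real) powr n = (2 * 2) powr n" by simp
  then show "G * G = 4 powr n" unfolding G_def by (simp only: powr_mult)
qed

lemma beta: "\<beta> \<ge> 2 * G * G"
  using beta_n_ge[OF sets_mu fin_mu, of n] G(2) by (simp add: \<beta>_def mult.assoc)

lemma beta2: "\<beta> > 2"
proof -
  have "G * G > 1" using G(1) less_1_mult by blast
  then show ?thesis using beta by linarith
qed

lemma measure_mono_cb: "cb x s \<subseteq> cb y t \<Longrightarrow> measure \<mu> (cb x s) \<le> measure \<mu> (cb y t)"
  by (intro finite_measure_mono) auto

lemma measure_pos: "x \<in> supp \<mu> \<Longrightarrow> s > 0 \<Longrightarrow> measure \<mu> (cb x s) > 0"
  by (rule supp_measure_pos[OF _ _ sets_mu fin_mu])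

lemma total_pos: "measure \<mu> UNIV > 0"
  using measure_pos[OF x0 L0(1)] finite_measure_mono[of "cb x0 L0" UNIV] by simp

lemma doubling_iff: "doubling n \<mu> (x, s) \<longleftrightarrow> x \<in> supp \<mu> \<and> s > 0 \<and> measure \<mu> (cb x (4 * s)) < \<beta> * measure \<mu> (cb x s)"
  by (simp add: doubling_def ab_doubling_def is_cube_def dilate_def \<beta>_def)

lemma dens_nonneg: "0 \<le> dens x s" by (simp add: dens_def)

lemma dens_le: "x \<in> supp \<mu> \<Longrightarrow> s > 0 \<Longrightarrow> dens x s \<le> C0"
  using growth[of x s] by (simp add: dens_def field_simps)

lemma dens_shift:
  assumes "0 < s" "0 < t" "t \<le> c * s" "cb x s \<subseteq> cb y t" "c > 0"
  shows "dens x s \<le> c powr n * dens y t"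
proof -
  have "t powr n \<le> (c * s) powr n" using assms n_pos by (intro powr_mono2) auto
  also have "\<dots> = c powr n * s powr n" using assms by (simp add: powr_mult)
  finally have t: "t powr n \<le> c powr n * s powr n" .
  have "measure \<mu> (cb x s) * t powr n \<le> measure \<mu> (cb y t) * (c powr n * s powr n)"
    using measure_mono_cb[OF assms(4)] t by (intro mult_mono) auto
  then show ?thesis using assms by (simp add: dens_def field_simps)
qed

text \<open>
  The sum that occurs in K(Q,R), taken over the fixed grid of scales 2^k instead of the
  multiples 2^j length(Q).  On a fixed grid it is additive in the scales, and a change of the center
  is a shift of the grid.
\<close>

definition "scale_sum x a b = (\<Sum>k\<in>{\<lceil>log 2 a\<rceil>..<\<lceil>log 2 b\<rceil>}. dens x (2 powr real_of_int k))"

lemma scale_sum_nonneg: "0 \<le> scale_sum x a b"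
  unfolding scale_sum_def by (intro sum_nonneg dens_nonneg)

lemma scale_sum_mono: "0 < a \<Longrightarrow> a \<le> a' \<Longrightarrow> 0 < b' \<Longrightarrow> b' \<le> b \<Longrightarrow> scale_sum x a' b' \<le> scale_sum x a b"
  unfolding scale_sum_def
proof (intro sum_mono2 dens_nonneg)
  assume "0 < a" "a \<le> a'" "0 < b'" "b' \<le> b"
  then have "log 2 a \<le> log 2 a'" "log 2 b' \<le> log 2 b" by auto
  then have "\<lceil>log 2 a\<rceil> \<le> \<lceil>log 2 a'\<rceil>" "\<lceil>log 2 b'\<rceil> \<le> \<lceil>log 2 b\<rceil>" by (auto intro: ceiling_mono)
  then show "{\<lceil>log 2 a'\<rceil>..<\<lceil>log 2 b'\<rceil>} \<subseteq> {\<lceil>log 2 a\<rceil>..<\<lceil>log 2 b\<rceil>}" by auto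
qed simp

lemma scale_sum_empty: "0 < b \<Longrightarrow> b \<le> a \<Longrightarrow> scale_sum x a b = 0"
proof -
  assume "0 < b" "b \<le> a"
  then have "\<lceil>log 2 b\<rceil> \<le> \<lceil>log 2 a\<rceil>" by (intro ceiling_mono) auto
  then show ?thesis by (simp add: scale_sum_def)
qed

lemma scale_sum_add: "0 < a \<Longrightarrow> a \<le> b \<Longrightarrow> b \<le> c \<Longrightarrow> scale_sum x a c = scale_sum x a b + scale_sum x b c"
proof -
  assume "0 < a" "a \<le> b" "b \<le> c"
  then have "\<lceil>log 2 a\<rceil> \<le> \<lceil>log 2 b\<rceil>" "\<lceil>log 2 b\<rceil> \<le> \<lceil>log 2 c\<rceil>" by (auto intro!: ceiling_mono)
  then have "{\<lceil>log 2 a\<rceil>..<\<lceil>log 2 c\<rceil>} = {\<lceil>log 2 a\<rceil>..<\<lceil>log 2 b\<rceil>} \<union> {\<lceil>log 2 b\<rceil>..<\<lceil>log 2 c\<rceil>}" by auto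
  then show ?thesis unfolding scale_sum_def by (simp add: sum.union_disjoint)
qed

lemma scale_sum_subadd: "0 < a \<Longrightarrow> 0 < b \<Longrightarrow> 0 < c \<Longrightarrow> scale_sum x a c \<le> scale_sum x a b + scale_sum x b c"
proof -
  assume p: "0 < a" "0 < b" "0 < c"
  consider "a \<le> b \<and> b \<le> c" | "b < a" | "c < b" by linarith
  then show ?thesis
  proof cases
    case 1 then show ?thesis using scale_sum_add[of a b c x] p by simp
  next
    case 2 then have "scale_sum x a c \<le> scale_sum x b c" using p by (intro scale_sum_mono) auto
    then show ?thesis using scale_sum_nonneg[of x a b] by simp
  next
    case 3 then have "scale_sum x a c \<le> scale_sum x a b" using p by (intro scale_sum_mono) auto
    then show ?thesis using scale_sum_nonneg[of x b c] by simp
  qed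
qed

text \<open>
  An interval [s,2s) contains exactly one power of two.
\<close>

lemma scale_sum_octave:
  assumes "s > 0"
  obtains t where "s \<le> t" "t < 2 * s" "scale_sum x s (2 * s) = dens x t"
proof -
  define k where "k = \<lceil>log 2 s\<rceil>"
  have "\<lceil>log 2 (2 * s)\<rceil> = k + 1" 
  proof -
    have "log 2 (2 * s) = log 2 s + 1" using assms by (simp add: log_mult)
    then show ?thesis by (simp only: ceiling_add_one k_def)
  qed
  then have "{\<lceil>log 2 s\<rceil>..<\<lceil>log 2 (2 * s)\<rceil>} = {k}" by (auto simp: k_def)
  then have "scale_sum x s (2 * s) = dens x (2 powr real_of_int k)" by (simp add: scale_sum_def)
  moreover have "s \<le> 2 powr real_of_int k"
  proof -
    have "s = 2 powr (log 2 s)" using assms by simp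
    also have "\<dots> \<le> 2 powr real_of_int k" by (intro powr_mono) (auto simp: k_def)
    finally show ?thesis .
  qed
  moreover have "2 powr real_of_int k < 2 * s"
  proof -
    have "2 powr real_of_int k < 2 powr (log 2 s + 1)" by (intro powr_less_mono) (auto simp: k_def, linarith)
    also have "\<dots> = 2 * s" using assms by (simp add: powr_add)
    finally show ?thesis .
  qed
  ultimately show ?thesis using that by blast
qed

lemma scale_sum_octave_le: "s > 0 \<Longrightarrow> scale_sum x s (2 * s) \<le> G * dens x (2 * s)"
proof -
  assume s: "s > 0"
  obtain t where t: "s \<le> t" "t < 2 * s" "scale_sum x s (2 * s) = dens x t" using scale_sum_octave[OF s] by blast
  show ?thesis unfolding t(3) G_def using t s by (intro dens_shift cb_mono) auto
qed

lemma dens_le_scale_sum: "s > 0 \<Longrightarrow> dens x s \<le> G * scale_sum x s (2 * s)"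
proof -
  assume s: "s > 0"
  obtain t where t: "s \<le> t" "t < 2 * s" "scale_sum x s (2 * s) = dens x t" using scale_sum_octave[OF s] by blast
  show ?thesis unfolding t(3) G_def using t s by (intro dens_shift cb_mono) auto
qed

lemma scale_sum_le_sum: "l > 0 \<Longrightarrow> scale_sum x l (2 ^ N * l) \<le> G * (\<Sum>j=1..N. dens x (2 ^ j * l))"
proof (induction N)
  case 0 then show ?case by (simp add: scale_sum_empty)
next
  case (Suc N)
  have "scale_sum x l (2 ^ Suc N * l) = scale_sum x l (2 ^ N * l) + scale_sum x (2 ^ N * l) (2 ^ Suc N * l)"
    using Suc.prems by (intro scale_sum_add) auto
  also have "scale_sum x (2 ^ N * l) (2 ^ Suc N * l) \<le> G * dens x (2 ^ Suc N * l)"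
    using scale_sum_octave_le[of "2 ^ N * l" x] Suc.prems by (simp add: mult_ac)
  finally show ?case using Suc by (simp add: algebra_simps)
qed

lemma sum_le_scale_sum: "l > 0 \<Longrightarrow> (\<Sum>j=1..N. dens x (2 ^ j * l)) \<le> G * scale_sum x (2 * l) (2 ^ Suc N * l)"
proof (induction N)
  case 0 then show ?case using scale_sum_nonneg G by simp
next
  case (Suc N)
  have "scale_sum x (2 * l) (2 ^ Suc (Suc N) * l) = scale_sum x (2 * l) (2 ^ Suc N * l) + scale_sum x (2 ^ Suc N * l) (2 ^ Suc (Suc N) * l)"
    using Suc.prems by (intro scale_sum_add) auto
  moreover have "dens x (2 ^ Suc N * l) \<le> G * scale_sum x (2 ^ Suc N * l) (2 ^ Suc (Suc N) * l)"
    using dens_le_scale_sum[of "2 ^ Suc N * l" x] Suc.prems by (simp add: mult_ac)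
  ultimately show ?case using Suc by (simp add: algebra_simps)
qed

lemma scale_sum_const: "x \<in> supp \<mu> \<Longrightarrow> l > 0 \<Longrightarrow> scale_sum x l (2 ^ N * l) \<le> real N * (G * C0)"
proof -
  assume x: "x \<in> supp \<mu>" "l > 0"
  have "(\<Sum>j=1..N. dens x (2 ^ j * l)) \<le> (\<Sum>j=1..N. C0)" using x by (intro sum_mono dens_le) auto
  then have "G * (\<Sum>j=1..N. dens x (2 ^ j * l)) \<le> G * (real N * C0)" using G by (intro mult_left_mono) auto
  then show ?thesis using scale_sum_le_sum[OF x(2), of x N] by (simp add: mult_ac)
qed

lemma scale_sum_4: "x \<in> supp \<mu> \<Longrightarrow> l > 0 \<Longrightarrow> scale_sum x l (4 * l) \<le> 2 * (G * C0)"
  using scale_sum_const[of x l 2] by simp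

text \<open>
  Beyond the distance of the two centers, a cube is contained in the cube four times as large around
  the other center.
\<close>

lemma scale_sum_recenter:
  assumes "\<And>i. \<bar>x $ i - x' $ i\<bar> \<le> a" "a > 0" "b > 0"
  shows "scale_sum x a b \<le> G * G * scale_sum x' (4 * a) (4 * b)"
proof -
  have l4: "log 2 (4 * u) = log 2 u + 2" if "u > 0" for u :: real
  proof -
    have "log 2 4 = (2::real)" using log_pow_cancel[of 2 2] by simp
    then show ?thesis using that by (simp add: log_mult)
  qed
  have "scale_sum x a b \<le> (\<Sum>k\<in>{\<lceil>log 2 a\<rceil>..<\<lceil>log 2 b\<rceil>}. G * G * dens x' (2 powr real_of_int (k + 2)))"
    unfolding scale_sum_def
  proof (rule sum_mono)
    fix k assume k: "k \<in> {\<lceil>log 2 a\<rceil>..<\<lceil>log 2 b\<rceil>}"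
    have "a = 2 powr (log 2 a)" using assms by simp
    also have "\<dots> \<le> 2 powr real_of_int k" using k by (intro powr_mono) (auto, linarith)
    finally have a: "a \<le> 2 powr real_of_int k" .
    have e: "2 powr real_of_int (k + 2) = 4 * 2 powr real_of_int k" by (simp add: powr_add)
    have "\<bar>x $ i - x' $ i\<bar> \<le> 2 powr real_of_int k" for i using assms(1)[of i] a by linarith
    then have "cb x (2 powr real_of_int k) \<subseteq> cb x' (2 powr real_of_int (k + 2))"
      by (rule cb_subset_cb) (unfold e, simp)
    then show "dens x (2 powr real_of_int k) \<le> G * G * dens x' (2 powr real_of_int (k + 2))"
      unfolding G(2) by (intro dens_shift) (simp_all only: e, simp_all)
  qed
  also have "\<dots> = G * G * (\<Sum>k\<in>{\<lceil>log 2 a\<rceil>..<\<lceil>log 2 b\<rceil>}. dens x' (2 powr real_of_int (k + 2)))"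
    by (simp add: sum_distrib_left)
  also have "(\<Sum>k\<in>{\<lceil>log 2 a\<rceil>..<\<lceil>log 2 b\<rceil>}. dens x' (2 powr real_of_int (k + 2))) = scale_sum x' (4 * a) (4 * b)"
    unfolding scale_sum_def
    by (rule sum.reindex_bij_witness[where i="\<lambda>k. k - 2" and j="\<lambda>k. k + 2"]) (use assms l4 in auto)
  finally show ?thesis .
qed

definition "c_chain = 4 * G * G * C0"

lemma c_chain: "c_chain > 0" using G C0 by (simp add: c_chain_def)

lemma nondoubling_dens:
  assumes "x \<in> supp \<mu>" "s > 0" "\<not> doubling n \<mu> (x, s)"
  shows "dens x s \<le> dens x (4 * s) / 2"
proof -
  have "\<beta> * measure \<mu> (cb x s) \<le> measure \<mu> (cb x (4 * s))" using assms by (simp add: doubling_iff)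
  moreover have "2 * G * G * measure \<mu> (cb x s) \<le> \<beta> * measure \<mu> (cb x s)" using beta by (intro mult_right_mono) auto
  ultimately have "2 * (G * G * measure \<mu> (cb x s)) \<le> measure \<mu> (cb x (4 * s))" by simp
  moreover have "(4 * s) powr n = G * G * s powr n" using assms by (simp add: powr_mult G(2))
  ultimately show ?thesis using assms G by (simp add: dens_def field_simps)
qed

text \<open>
  Going down along non-doubling cubes each density is at most half the previous one, so the sum is
  a geometric series dominated by its largest term.
\<close>

lemma nondoubling_chain:
  assumes x: "x \<in> supp \<mu>" and l: "l > 0" and nd: "\<And>j. j < i \<Longrightarrow> \<not> doubling n \<mu> (x, 4 ^ j * l)"
  shows "scale_sum x l (4 ^ i * l) \<le> c_chain"
proof -
  \<comment> \<open>The factor \<open>4 * G * G\<close> reproduces itself: one half of it, plus the \<open>2 * G * G\<close> of two new octaves.\<close>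
  have "scale_sum x l (4 ^ i * l) \<le> 4 * G * G * dens x (4 ^ i * l)" using nd
  proof (induction i)
    case 0 then show ?case using G dens_nonneg by (simp add: scale_sum_empty l)
  next
    case (Suc i)
    define s where "s = 4 ^ i * l"
    have s: "s > 0" using l by (simp add: s_def)
    have 1: "scale_sum x l (4 * s) = scale_sum x l s + scale_sum x s (4 * s)" using l by (intro scale_sum_add) (auto simp: s_def)
    have 2: "scale_sum x l s \<le> 4 * G * G * dens x s" using Suc by (simp add: s_def)
    have 3: "4 * G * G * dens x s \<le> 4 * G * G * (dens x (4 * s) / 2)"
      using Suc.prems[of i] s x G by (intro mult_left_mono nondoubling_dens) (auto simp: s_def)
    have 4: "scale_sum x s (4 * s) = scale_sum x s (2 * s) + scale_sum x (2 * s) (4 * s)" using s by (intro scale_sum_add) auto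
    have 5: "scale_sum x s (2 * s) \<le> G * dens x (2 * s)" using scale_sum_octave_le s by simp
    have "dens x (2 * s) \<le> 2 powr n * dens x (4 * s)" using s by (intro dens_shift cb_mono) auto
    then have 6: "G * dens x (2 * s) \<le> G * (G * dens x (4 * s))" using G by (intro mult_left_mono) (auto simp: G_def)
    have 7: "scale_sum x (2 * s) (4 * s) \<le> G * dens x (4 * s)" using scale_sum_octave_le[of "2 * s" x] s by simp
    have "1 * (G * dens x (4 * s)) \<le> G * (G * dens x (4 * s))" using G dens_nonneg by (intro mult_right_mono) auto
    then have "scale_sum x l (4 * s) \<le> 4 * G * G * dens x (4 * s)" using 1 2 3 4 5 6 7 by (simp add: algebra_simps)
    then show ?case by (simp add: s_def mult.assoc)
  qed
  also have "\<dots> \<le> 4 * G * G * C0" using dens_le x l G by (intro mult_left_mono) auto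
  finally show ?thesis by (simp add: c_chain_def)
qed

lemma large_doubling: "x \<in> supp \<mu> \<Longrightarrow> s > 0 \<Longrightarrow> measure \<mu> (cb x s) > measure \<mu> UNIV / 2 \<Longrightarrow> doubling n \<mu> (x, s)"
proof -
  assume a: "x \<in> supp \<mu>" "s > 0" "measure \<mu> (cb x s) > measure \<mu> UNIV / 2"
  have "measure \<mu> (cb x (4 * s)) \<le> measure \<mu> UNIV" using finite_measure_mono[of "cb x (4 * s)" UNIV] by simp
  also have "\<dots> < 2 * measure \<mu> (cb x s)" using a(3) by simp
  also have "\<dots> \<le> \<beta> * measure \<mu> (cb x s)" using beta2 by (intro mult_right_mono) auto
  finally show ?thesis using a by (simp add: doubling_iff)
qed

lemma large_cubes_exist:
  "s > 0 \<Longrightarrow> \<exists>k0. \<forall>k\<ge>k0. measure \<mu> (cb x (2 ^ k * s)) > measure \<mu> UNIV / 2"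
  by (rule large_cubes[OF sets_mu fin_mu total_pos])

lemma doubling_exists: "x \<in> supp \<mu> \<Longrightarrow> l > 0 \<Longrightarrow> \<exists>k. doubling n \<mu> (x, 4 ^ k * l)"
proof -
  assume x: "x \<in> supp \<mu>" "l > 0"
  obtain k where "measure \<mu> (cb x (2 ^ (2 * k) * l)) > measure \<mu> UNIV / 2"
    using large_cubes_exist[OF x(2), of x] le_add1[of _ k] by (metis le_add2 mult_2)
  then have "doubling n \<mu> (x, 2 ^ (2 * k) * l)" using x by (intro large_doubling) auto
  then show ?thesis by (intro exI[of _ k]) (simp add: power_mult)
qed

text \<open>
  The doubling ancestor, given by its side.  The step is the factor four because this is the
  dilation in the definition of a doubling cube, so that each failure gives a decay of the density.
\<close>

definition "anc_side x l = 4 ^ (LEAST k. doubling n \<mu> (x, 4 ^ k * l)) * l"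

lemma anc_side:
  assumes "x \<in> supp \<mu>" "l > 0"
  shows "doubling n \<mu> (x, anc_side x l)" "l \<le> anc_side x l" "scale_sum x l (anc_side x l) \<le> c_chain" "\<exists>k. anc_side x l = 4 ^ k * l"
proof -
  define k where "k = (LEAST k. doubling n \<mu> (x, 4 ^ k * l))"
  have t: "anc_side x l = 4 ^ k * l" by (simp add: anc_side_def k_def)
  show "doubling n \<mu> (x, anc_side x l)" unfolding t k_def by (rule LeastI_ex[OF doubling_exists[OF assms]])
  show "l \<le> anc_side x l" using assms by (simp add: t)
  show "scale_sum x l (anc_side x l) \<le> c_chain" unfolding t
    by (rule nondoubling_chain[OF assms]) (auto simp: k_def dest: not_less_Least)
  show "\<exists>k. anc_side x l = 4 ^ k * l" using t by blast
qed

lemma anc_side_doubling: "doubling n \<mu> (x, l) \<Longrightarrow> anc_side x l = l"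
proof -
  assume "doubling n \<mu> (x, l)"
  then have "(LEAST k. doubling n \<mu> (x, 4 ^ k * l)) = 0" by (intro Least_eq_0) simp
  then show ?thesis by (simp add: anc_side_def)
qed

lemma K_pair_le_scale_sum:
  assumes "x \<in> supp \<mu>" "l > 0" "l \<le> snd R"
  shows "K_pair n \<mu> (x, l) R \<le> 1 + G * scale_sum x l (4 * snd R)"
proof -
  define N where "N = N_cubes (x, l) R"
  have K: "K_pair n \<mu> (x, l) R = 1 + (\<Sum>j=1..N. dens x (2 ^ j * l))"
    by (simp add: K_pair_def N_def dens_def dilate_def)
  show ?thesis
  proof (cases N)
    case 0 then show ?thesis using K G scale_sum_nonneg[of x l "4 * snd R"] by simp
  next
    case (Suc N')
    have "\<not> snd R \<le> 2 ^ N' * l"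
      using not_less_Least[of N' "\<lambda>k. snd (dilate (2 ^ k) (x, l)) \<ge> snd R"] Suc by (simp add: N_def N_cubes_def dilate_def)
    then have "2 ^ Suc N * l \<le> 4 * snd R" by (simp add: Suc)
    then have "scale_sum x (2 * l) (2 ^ Suc N * l) \<le> scale_sum x l (4 * snd R)" using assms by (intro scale_sum_mono) auto
    then have "G * scale_sum x (2 * l) (2 ^ Suc N * l) \<le> G * scale_sum x l (4 * snd R)" using G by (intro mult_left_mono) auto
    then show ?thesis using sum_le_scale_sum[OF assms(2), where N=N and x=x] K by simp
  qed
qed

lemma scale_sum_le_K_pair:
  assumes "l > 0" "0 < snd R"
  shows "scale_sum x l (snd R) \<le> G * K_pair n \<mu> (x, l) R"
proof -
  define N where "N = N_cubes (x, l) R"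
  have K: "K_pair n \<mu> (x, l) R = 1 + (\<Sum>j=1..N. dens x (2 ^ j * l))"
    by (simp add: K_pair_def N_def dens_def dilate_def)
  obtain k :: nat where "snd R / l < 2 ^ k" using real_arch_pow[of 2 "snd R / l"] by auto
  then have "snd R \<le> 2 ^ k * l" using assms by (simp add: field_simps)
  then have "\<exists>k. snd (dilate (2 ^ k) (x, l)) \<ge> snd R" by (auto simp: dilate_def)
  then have "snd (dilate (2 ^ N) (x, l)) \<ge> snd R" unfolding N_def N_cubes_def by (rule LeastI_ex)
  then have "snd R \<le> 2 ^ N * l" by (simp add: dilate_def)
  then have "scale_sum x l (snd R) \<le> scale_sum x l (2 ^ N * l)" using assms by (intro scale_sum_mono) auto
  also have "\<dots> \<le> G * (\<Sum>j=1..N. dens x (2 ^ j * l))" by (rule scale_sum_le_sum[OF assms(1)])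
  also have "\<dots> \<le> G * K_pair n \<mu> (x, l) R" using G K by (intro mult_left_mono) auto
  finally show ?thesis .
qed

lemma K_pair_ge_1: "K_pair n \<mu> Q R \<ge> 1"
  unfolding K_pair_def by (simp add: sum_nonneg dilate_def)

end

section \<open>Numbers attached to arbitrary cubes\<close>

context growth_measure begin

text \<open>
  Bounds, for an RBMO function of constant one: for concentric cubes, for shifted cubes of the same
  size, for the jump at a stopping cube, for the mean oscillation on a cube and on its
  enlargement; the stopping level, and the step between levels in the John-Nirenberg
  inequality.
\<close>

definition "c_conc = 1 + G * (1 + c_chain + 2 * (G * C0))"
definition "c_rec = (1 + G * (c_chain + 4 * (G * C0))) + (1 + G * G * G * (2 * c_chain + 6 * (G * C0)))"
definition "c_stop = c_conc * (1 + 2 * (G * C0)) + c_conc * (1 + c_chain + 2 * (G * C0)) + c_rec"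
definition "c_osc = 10 ^ CARD('m) * (1 + c_stop)"
definition "c_osc_big = c_osc + c_conc * (1 + 2 * (G * C0))"
definition "c_level = 1 + 2 * 10 ^ CARD('m) * \<beta> * c_osc_big"
definition "c_jn = c_level + c_stop + 2 * 10 ^ CARD('m)"

lemma GC0: "G * C0 > 0" using G C0 by simp

lemma constants_pos: "c_conc \<ge> 1" "c_rec > 0" "c_stop > 0" "c_osc > 0" "c_osc_big > 0" "c_level \<ge> 1" "c_jn > 0"
proof -
  have "G * (1 + c_chain + 2 * (G * C0)) > 0" using G c_chain GC0 by (intro mult_pos_pos) auto
  then show A: "c_conc \<ge> 1" by (simp add: c_conc_def)
  have "G * (c_chain + 4 * (G * C0)) > 0" using G c_chain GC0 by (intro mult_pos_pos) auto
  moreover have "G * G * G * (2 * c_chain + 6 * (G * C0)) > 0" using G c_chain GC0 by (intro mult_pos_pos) auto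
  ultimately show B: "c_rec > 0" by (simp add: c_rec_def)
  have "c_conc * (1 + 2 * (G * C0)) > 0" "c_conc * (1 + c_chain + 2 * (G * C0)) > 0" using A c_chain GC0 by (auto intro!: mult_pos_pos add_pos_pos)
  then show S: "c_stop > 0" and "c_osc > 0" and J': "c_osc_big > 0" using B by (auto simp: c_stop_def c_osc_def c_osc_big_def intro!: add_pos_pos)
  show L: "c_level \<ge> 1" using J' beta2 by (simp add: c_level_def)
  have "(0::real) < 2 * 10 ^ CARD('m)" by simp
  then show "c_jn > 0" using S L unfolding c_jn_def by linarith
qed

end

text \<open>
  A function \<open>f\<close> together with a choice of numbers \<open>fQ\<close> that shows that \<open>D\<close> is an RBMO constant of \<open>f\<close>.
\<close>

locale rbmo_function = growth_measure \<mu> n C0 x0 L0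
  for \<mu> :: "(real ^ 'm) measure" and n C0 :: real and x0 :: "real ^ 'm" and L0 :: real +
  fixes f :: "real ^ 'm \<Rightarrow> complex" and fQ :: "(real ^ 'm) cube \<Rightarrow> complex" and D :: real
  assumes f_L1_loc: "f \<in> L1_loc \<mu>" and D: "D > 0"
    and osc: "\<And>Q. doubling n \<mu> Q \<Longrightarrow> (LINT x:cube_set Q|\<mu>. cmod (f x - fQ Q)) / measure \<mu> (cube_set Q) \<le> D"
    and compare: "\<And>Q R. doubling n \<mu> Q \<Longrightarrow> doubling n \<mu> R \<Longrightarrow> cube_set Q \<subseteq> cube_set R \<Longrightarrow>
           cmod (fQ Q - fQ R) \<le> D * K_pair n \<mu> Q R"
begin

lemma f_meas[measurable]: "f \<in> borel_measurable borel"
  using f_L1_loc measurable_cong_sets[OF sets_mu refl] by (auto simp: L1_loc_def)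

text \<open>
  This attaches a number to every cube, doubling or not, with properties as good as for
  doubling cubes.
\<close>

definition "f_anc x l = fQ (x, anc_side x l)"

lemma f_anc_doubling: "doubling n \<mu> (x, l) \<Longrightarrow> f_anc x l = fQ (x, l)"
  by (simp add: f_anc_def anc_side_doubling)

lemma compare_scale_sum:
  assumes "doubling n \<mu> (x, p)" "doubling n \<mu> (y, q)" "cb x p \<subseteq> cb y q" "p \<le> q" "scale_sum x p (4 * q) \<le> t"
  shows "cmod (fQ (x, p) - fQ (y, q)) \<le> D * (1 + G * t)"
proof -
  have "x \<in> supp \<mu>" "p > 0" using assms(1) by (auto simp: doubling_iff)
  then have "K_pair n \<mu> (x, p) (y, q) \<le> 1 + G * scale_sum x p (4 * q)" using K_pair_le_scale_sum[of x p "(y, q)"] assms(4) by simp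
  also have "\<dots> \<le> 1 + G * t" using assms(5) G by simp
  finally have "D * K_pair n \<mu> (x, p) (y, q) \<le> D * (1 + G * t)" using D by simp
  then show ?thesis using compare[OF assms(1,2)] assms(3) by fastforce
qed

text \<open>
  Between the smaller cube and its doubling ancestor, and between the larger one and its ancestor,
  all cubes are non-doubling, so these scales contribute a bounded amount to K.
\<close>

lemma f_anc_concentric:
  assumes x: "x \<in> supp \<mu>" and l: "0 < l" "l \<le> l'"
  shows "cmod (f_anc x l - f_anc x l') \<le> c_conc * D * (1 + scale_sum x l l')"
proof -
  define p q where "p = anc_side x l" and "q = anc_side x l'"
  have p: "doubling n \<mu> (x, p)" "l \<le> p" "scale_sum x l p \<le> c_chain" using anc_side[OF x l(1)] by (auto simp: p_def)
  have q: "doubling n \<mu> (x, q)" "l' \<le> q" "scale_sum x l' q \<le> c_chain" using anc_side[of x l'] x l by (auto simp: q_def)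
  have pos: "p > 0" "q > 0" "l' > 0" using p q l by auto
  have t: "scale_sum x l l' + c_chain + 2 * (G * C0) \<ge> 0" using scale_sum_nonneg[of x l l'] c_chain GC0 by linarith
  have "cmod (fQ (x, p) - fQ (x, q)) \<le> D * (1 + G * (scale_sum x l l' + c_chain + 2 * (G * C0)))"
  proof (cases "p \<le> q")
    case True
    have "scale_sum x p (4 * q) \<le> scale_sum x l (4 * q)" using p q l pos by (intro scale_sum_mono) auto
    also have "\<dots> \<le> scale_sum x l l' + scale_sum x l' (4 * q)" using pos l by (intro scale_sum_subadd) auto
    also have "scale_sum x l' (4 * q) \<le> scale_sum x l' q + scale_sum x q (4 * q)" using pos l by (intro scale_sum_subadd) auto
    finally have "scale_sum x p (4 * q) \<le> scale_sum x l l' + c_chain + 2 * (G * C0)" using q scale_sum_4[OF x pos(2)] by linarith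
    then show ?thesis using True by (intro compare_scale_sum p q cb_mono) auto
  next
    case False
    have "scale_sum x q (4 * p) \<le> scale_sum x l (4 * p)" using p q l pos by (intro scale_sum_mono) auto
    also have "\<dots> \<le> scale_sum x l p + scale_sum x p (4 * p)" using pos l by (intro scale_sum_subadd) auto
    finally have "scale_sum x q (4 * p) \<le> scale_sum x l l' + c_chain + 2 * (G * C0)" using p scale_sum_4[OF x pos(1)] scale_sum_nonneg[of x l l'] by linarith
    then have "cmod (fQ (x, q) - fQ (x, p)) \<le> D * (1 + G * (scale_sum x l l' + c_chain + 2 * (G * C0)))"
      using False by (intro compare_scale_sum p q cb_mono) auto
    then show ?thesis by (simp add: norm_minus_commute)
  qed
  also have "\<dots> \<le> D * (c_conc * (1 + scale_sum x l l'))"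
  proof (intro mult_left_mono)
    have "0 \<le> G * (c_chain + 2 * (G * C0)) * scale_sum x l l'" using scale_sum_nonneg c_chain GC0 G by (intro mult_nonneg_nonneg) auto
    then show "1 + G * (scale_sum x l l' + c_chain + 2 * (G * C0)) \<le> c_conc * (1 + scale_sum x l l')"
      using scale_sum_nonneg[of x l l'] G by (simp add: c_conc_def algebra_simps)
  qed (use D in auto)
  finally show ?thesis by (simp add: f_anc_def p_def q_def mult_ac)
qed

text \<open>
  Both ancestors are contained in one doubling cube, and K from either of them to it is bounded:
  scales at the first center are moved to the second one, where they run through two chains of
  non-doubling cubes and a bounded number of further scales.
\<close>

lemma f_anc_recenter:
  assumes x: "x \<in> supp \<mu>" "x' \<in> supp \<mu>" and l: "0 < l" and d: "\<And>i. \<bar>x $ i - x' $ i\<bar> \<le> l"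
  shows "cmod (f_anc x l - f_anc x' l) \<le> c_rec * D"
proof -
  have wlog: "cmod (f_anc x l - f_anc x' l) \<le> c_rec * D"
    if x: "x \<in> supp \<mu>" "x' \<in> supp \<mu>" and d: "\<And>i. \<bar>x $ i - x' $ i\<bar> \<le> l" and le: "anc_side x l \<le> anc_side x' l" for x x'
  proof -
    define p q where "p = anc_side x l" and "q = anc_side x' l"
    have p: "doubling n \<mu> (x, p)" "l \<le> p" using anc_side[OF x(1) l(1)] by (auto simp: p_def)
    have q: "doubling n \<mu> (x', q)" "l \<le> q" "scale_sum x' l q \<le> c_chain" using anc_side[OF x(2) l(1)] by (auto simp: q_def)
    \<comment> \<open>Side at least \<open>4 * q\<close> is enough for this cube to contain both ancestors.\<close>
    define r where "r = anc_side x' (4 * q)"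
    have r: "doubling n \<mu> (x', r)" "4 * q \<le> r" "scale_sum x' (4 * q) r \<le> c_chain" using anc_side[OF x(2), of "4 * q"] q l by (auto simp: r_def)
    have pos: "p > 0" "q > 0" "r > 0" using p q r l by auto
    have pq: "p \<le> q" using le by (simp add: p_def q_def)
    have t1: "scale_sum x' q (4 * r) \<le> c_chain + 4 * (G * C0)"
    proof -
      have "scale_sum x' q (4 * r) \<le> scale_sum x' q (4 * q) + scale_sum x' (4 * q) (4 * r)" using pos by (intro scale_sum_subadd) auto
      moreover have "scale_sum x' (4 * q) (4 * r) \<le> scale_sum x' (4 * q) r + scale_sum x' r (4 * r)" using pos by (intro scale_sum_subadd) auto
      ultimately show ?thesis using r(3) scale_sum_4[OF x(2) pos(2)] scale_sum_4[OF x(2) pos(3)] by linarith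
    qed
    have t2: "scale_sum x' (4 * p) (4 * (4 * r)) \<le> 2 * c_chain + 6 * (G * C0)"
    proof -
      have "scale_sum x' (4 * p) (4 * (4 * r)) \<le> scale_sum x' l (4 * (4 * r))" using pos l p by (intro scale_sum_mono) auto
      also have "\<dots> \<le> scale_sum x' l q + scale_sum x' q (4 * (4 * r))" using pos l by (intro scale_sum_subadd) auto
      finally have "scale_sum x' (4 * p) (4 * (4 * r)) \<le> scale_sum x' l q + scale_sum x' q (4 * (4 * r))" .
      moreover have "scale_sum x' q (4 * (4 * r)) \<le> scale_sum x' q (4 * r) + scale_sum x' (4 * r) (4 * (4 * r))" using pos l by (intro scale_sum_subadd) auto
      moreover have "scale_sum x' (4 * r) (4 * (4 * r)) \<le> 2 * (G * C0)" using pos by (intro scale_sum_4 x) auto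
      ultimately show ?thesis using t1 q(3) by linarith
    qed
    have "scale_sum x p (4 * r) \<le> G * G * scale_sum x' (4 * p) (4 * (4 * r))"
    proof (rule scale_sum_recenter)
      show "\<bar>x $ i - x' $ i\<bar> \<le> p" for i using d[of i] p(2) by linarith
    qed (use pos in auto)
    also have "\<dots> \<le> G * G * (2 * c_chain + 6 * (G * C0))" using t2 G by (intro mult_left_mono) auto
    finally have t3: "scale_sum x p (4 * r) \<le> G * G * (2 * c_chain + 6 * (G * C0))" .
    have "cmod (fQ (x', q) - fQ (x', r)) \<le> D * (1 + G * (c_chain + 4 * (G * C0)))"
      using t1 r pos by (intro compare_scale_sum q cb_mono) auto
    moreover have "cmod (fQ (x, p) - fQ (x', r)) \<le> D * (1 + G * (G * G * (2 * c_chain + 6 * (G * C0))))"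
    proof (rule compare_scale_sum[OF p(1) r(1) _ _ t3])
      show "cb x p \<subseteq> cb x' r" using d by (rule cb_subset_cb) (use pq q r pos in linarith)
      show "p \<le> r" using pq r pos by linarith
    qed
    moreover have "cmod (fQ (x, p) - fQ (x', q)) \<le> cmod (fQ (x, p) - fQ (x', r)) + cmod (fQ (x', q) - fQ (x', r))"
      using norm_triangle_ineq4[of "fQ (x, p) - fQ (x', r)" "fQ (x', q) - fQ (x', r)"] by simp
    ultimately show ?thesis by (simp add: f_anc_def p_def q_def c_rec_def algebra_simps)
  qed
  show ?thesis
  proof (cases "anc_side x l \<le> anc_side x' l")
    case True then show ?thesis using wlog x d by blast
  next
    case False
    then have "cmod (f_anc x' l - f_anc x l) \<le> c_rec * D" using d by (intro wlog x) (auto simp: abs_minus_commute)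
    then show ?thesis by (simp add: norm_minus_commute)
  qed
qed

text \<open>
  A stopping cube exists, and at it the deviation exceeds the level by a bounded amount only.  The
  cube Q(x,r) is the largest one in the chain Q(x,4^j s) that is doubling, small and of deviation
  above the level.  The step to the next doubling cube of the chain is bounded.  Either that cube
  has deviation at most the level, or its side exceeds l/4, and then it is reached from scale l
  by a bounded step as well.
\<close>

lemma stopping_cube:
  assumes x: "x \<in> supp \<mu>" "y \<in> supp \<mu>" and l: "0 < l" and d: "\<And>i. \<bar>x $ i - y $ i\<bar> \<le> l"
    and s: "0 < s" "s \<le> l / 4" "doubling n \<mu> (x, s)" "cmod (fQ (x, s) - f_anc y l) > \<tau>"
  shows "\<exists>r. 0 < r \<and> r \<le> l / 4 \<and> doubling n \<mu> (x, r) \<and> cmod (fQ (x, r) - f_anc y l) > \<tau> \<and>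
           cmod (fQ (x, r) - f_anc y l) \<le> max \<tau> 0 + c_stop * D"
proof -
  define P where "P r \<longleftrightarrow> r \<le> l / 4 \<and> doubling n \<mu> (x, r) \<and> cmod (fQ (x, r) - f_anc y l) > \<tau>" for r
  define gens where "gens = {j. P (4 ^ j * s)}"
  have "finite gens"
  proof -
    obtain k :: nat where k: "l / (4 * s) < 4 ^ k" using real_arch_pow[of 4 "l / (4 * s)"] by auto
    have "j < k" if "j \<in> gens" for j
    proof (rule ccontr)
      assume "\<not> j < k"
      then have "(4::real) ^ k \<le> 4 ^ j" by (intro power_increasing) auto
      then have "l / (4 * s) < 4 ^ j" using k by linarith
      then have "l / 4 < 4 ^ j * s" using s(1) by (simp add: field_simps)
      then show False using that by (simp add: gens_def P_def)
    qed
    then show ?thesis by (meson finite_nat_iff_bounded lessThan_iff subsetI)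
  qed
  moreover have "0 \<in> gens" using s by (simp add: gens_def P_def)
  ultimately have mx: "Max gens \<in> gens" "\<And>j. j \<in> gens \<Longrightarrow> j \<le> Max gens" by (auto intro: Max_in)
  define r where "r = 4 ^ Max gens * s"
  have r: "P r" "0 < r" using mx(1) s by (auto simp: gens_def r_def)
  define p where "p = anc_side x (4 * r)"
  have p: "doubling n \<mu> (x, p)" "4 * r \<le> p" "scale_sum x (4 * r) p \<le> c_chain" "\<exists>k. p = 4 ^ k * (4 * r)"
    using anc_side[OF x(1), of "4 * r"] r(2) by (auto simp: p_def)
  have ppos: "p > 0" using p(2) r(2) by linarith
  obtain k where k: "p = 4 ^ k * (4 * r)" using p(4) by blast
  have nP: "\<not> P p"
  proof
    assume "P p"
    then have "k + 1 + Max gens \<in> gens" using k by (simp add: gens_def r_def power_add mult_ac)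
    then show False using mx(2) by fastforce
  qed
  have step: "cmod (fQ (x, r) - fQ (x, p)) \<le> c_conc * (1 + 2 * (G * C0)) * D"
  proof -
    have "cmod (f_anc x r - f_anc x (4 * r)) \<le> c_conc * D * (1 + scale_sum x r (4 * r))" using r by (intro f_anc_concentric x) auto
    also have "\<dots> \<le> c_conc * D * (1 + 2 * (G * C0))" using scale_sum_4[OF x(1) r(2)] constants_pos D by (intro mult_left_mono) auto
    finally show ?thesis using r(1) by (simp add: f_anc_doubling P_def) (simp add: f_anc_def p_def mult_ac)
  qed
  have c_stop2: "c_stop * D = c_conc * (1 + 2 * (G * C0)) * D + c_conc * (1 + c_chain + 2 * (G * C0)) * D + c_rec * D"
    by (simp add: c_stop_def algebra_simps)
  have nn: "0 \<le> c_conc * (1 + c_chain + 2 * (G * C0)) * D" "0 \<le> c_rec * D"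
    using constants_pos c_chain GC0 D by (auto intro!: mult_nonneg_nonneg)
  have "cmod (fQ (x, p) - f_anc y l) \<le> max \<tau> 0 + c_conc * (1 + c_chain + 2 * (G * C0)) * D + c_rec * D"
  proof (cases "p \<le> l / 4")
    case True
    then have "cmod (fQ (x, p) - f_anc y l) \<le> \<tau>" using nP p(1) by (simp add: P_def)
    then show ?thesis using nn by linarith
  next
    case False
    have "scale_sum x (4 * r) l \<le> scale_sum x (4 * r) p + scale_sum x p l" using r ppos l by (intro scale_sum_subadd) auto
    also have "scale_sum x p l \<le> scale_sum x p (4 * p)" using False ppos l by (intro scale_sum_mono) auto
    finally have "scale_sum x (4 * r) l \<le> c_chain + 2 * (G * C0)" using p(3) scale_sum_4[OF x(1) ppos] by linarith
    moreover have "cmod (f_anc x (4 * r) - f_anc x l) \<le> c_conc * D * (1 + scale_sum x (4 * r) l)"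
      using r by (intro f_anc_concentric x) (auto simp: P_def)
    moreover have "c_conc * D * (1 + scale_sum x (4 * r) l) \<le> c_conc * D * (1 + (c_chain + 2 * (G * C0)))"
      using calculation(1) constants_pos D by (intro mult_left_mono) auto
    moreover have "cmod (f_anc x l - f_anc y l) \<le> c_rec * D" by (intro f_anc_recenter x l d)
    moreover have "cmod (f_anc x (4 * r) - f_anc y l) \<le> cmod (f_anc x (4 * r) - f_anc x l) + cmod (f_anc x l - f_anc y l)"
      using norm_triangle_ineq[of "f_anc x (4 * r) - f_anc x l" "f_anc x l - f_anc y l"] by simp
    ultimately have "cmod (f_anc x (4 * r) - f_anc y l) \<le> c_conc * D * (1 + (c_chain + 2 * (G * C0))) + c_rec * D" by linarith
    then show ?thesis by (simp add: f_anc_def p_def mult_ac add_ac) 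
  qed
  moreover have "cmod (fQ (x, r) - f_anc y l) \<le> cmod (fQ (x, r) - fQ (x, p)) + cmod (fQ (x, p) - f_anc y l)"
    using norm_triangle_ineq[of "fQ (x, r) - fQ (x, p)" "fQ (x, p) - f_anc y l"] by simp
  ultimately have "cmod (fQ (x, r) - f_anc y l) \<le> max \<tau> 0 + c_stop * D" using step c_stop2 by linarith
  then show ?thesis using r by (intro exI[of _ r]) (auto simp: P_def)
qed

definition "dev x l a = (LINT y:cb x l|\<mu>. cmod (f y - a))"

lemma f_minus_integrable: "integrable \<mu> (\<lambda>y. indicator (cb x l) y *\<^sub>R (f y - a))"
proof -
  have "set_integrable \<mu> (cb x l) f" using f_L1_loc by (simp add: L1_loc_def cube_set_def)
  moreover have "set_integrable \<mu> (cb x l) (\<lambda>_. a)"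
    unfolding set_integrable_def by (intro integrable_real_mult_indicator finite_measure.integrable_const_bound[where B="norm a"] AE_I2) (auto simp: indicator_def fin_mu)
  ultimately have "set_integrable \<mu> (cb x l) (\<lambda>y. f y - a)" by (rule set_integral_diff(1))
  then show ?thesis by (simp add: set_integrable_def)
qed

lemma dev_integrable: "integrable \<mu> (\<lambda>y. indicator (cb x l) y * cmod (f y - a))"
proof -
  have "integrable \<mu> (\<lambda>y. norm (indicator (cb x l) y *\<^sub>R (f y - a)))" by (rule integrable_norm[OF f_minus_integrable])
  then show ?thesis by simp
qed

lemma dev_nn: "(\<integral>\<^sup>+y. ennreal (cmod (f y - a)) * indicator (cb x l) y \<partial>\<mu>) = ennreal (dev x l a)"
proof -
  have "(\<integral>\<^sup>+y. ennreal (cmod (f y - a)) * indicator (cb x l) y \<partial>\<mu>) = (\<integral>\<^sup>+y. ennreal (indicator (cb x l) y * cmod (f y - a)) \<partial>\<mu>)"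
    by (intro nn_integral_cong) (auto simp: indicator_def)
  also have "\<dots> = ennreal (\<integral>y. indicator (cb x l) y * cmod (f y - a) \<partial>\<mu>)"
    by (intro nn_integral_eq_integral dev_integrable) auto
  finally show ?thesis by (simp add: dev_def set_lebesgue_integral_def)
qed

lemma dev_nonneg: "0 \<le> dev x l a"
  unfolding dev_def set_lebesgue_integral_def by (intro integral_nonneg_AE AE_I2) (simp add: zero_le_mult_iff)

lemma indicator_cb_integrable: "integrable \<mu> (\<lambda>y. indicator (cb x l) y * (c::real))"
  by (intro integrable_mult_left integrable_real_indicator) (auto simp: emeasure_eq_measure)

lemma dev_change: "dev x l a \<le> dev x l b + cmod (b - a) * measure \<mu> (cb x l)"
proof -
  have "dev x l a \<le> (\<integral>y. indicator (cb x l) y * cmod (f y - b) + indicator (cb x l) y * cmod (b - a) \<partial>\<mu>)"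
    unfolding dev_def set_lebesgue_integral_def real_scaleR_def
  proof (intro integral_mono dev_integrable Bochner_Integration.integrable_add indicator_cb_integrable)
    fix y show "indicator (cb x l) y * cmod (f y - a) \<le> indicator (cb x l) y * cmod (f y - b) + indicator (cb x l) y * cmod (b - a)"
      using norm_triangle_ineq[of "f y - b" "b - a"] by (auto simp: indicator_def)
  qed
  also have "\<dots> = dev x l b + cmod (b - a) * measure \<mu> (cb x l)"
    by (subst Bochner_Integration.integral_add[OF dev_integrable indicator_cb_integrable]) (simp add: dev_def set_lebesgue_integral_def)
  finally show ?thesis .
qed

lemma dev_lower: "cmod (b - a) * measure \<mu> (cb x l) \<le> dev x l a + dev x l b"
proof -
  have "(\<integral>y. indicator (cb x l) y * cmod (b - a) \<partial>\<mu>) \<le> (\<integral>y. indicator (cb x l) y * cmod (f y - a) + indicator (cb x l) y * cmod (f y - b) \<partial>\<mu>)"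
  proof (intro integral_mono dev_integrable Bochner_Integration.integrable_add indicator_cb_integrable)
    fix y show "indicator (cb x l) y * cmod (b - a) \<le> indicator (cb x l) y * cmod (f y - a) + indicator (cb x l) y * cmod (f y - b)"
      using norm_triangle_ineq4[of "f y - a" "f y - b"] by (auto simp: indicator_def)
  qed
  also have "\<dots> = dev x l a + dev x l b"
    by (subst Bochner_Integration.integral_add[OF dev_integrable dev_integrable]) (simp add: dev_def set_lebesgue_integral_def)
  finally show ?thesis by (simp add: mult.commute)
qed

lemma dev_doubling: "doubling n \<mu> (x, l) \<Longrightarrow> dev x l (fQ (x, l)) \<le> D * measure \<mu> (cb x l)"
  using osc[of "(x, l)"] measure_pos[of x l] by (simp add: dev_def doubling_iff divide_le_eq)

definition "good = {x \<in> supp \<mu>. \<forall>s>0. \<exists>l. 0 < l \<and> l \<le> s \<and> doubling n \<mu> (x, l)}"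

lemma AE_good: "AE x in \<mu>. x \<in> good"
proof -
  have "AE x in \<mu>. x \<in> supp \<mu>" by (rule AE_I'[OF compl_supp_null[OF sets_mu]]) auto
  then show ?thesis using AE_small_doubling_cubes[OF sets_mu fin_mu, of n] by eventually_elim (simp add: good_def)
qed

text \<open>
  A cube that is not doubling is covered, up to a null set, by doubling cubes that are stopped at a
  negative level, so that every doubling cube is admitted.  Their numbers differ from that of the
  covered cube by a bounded amount.
\<close>

lemma oscillation_any_cube:
  assumes x: "x \<in> supp \<mu>" and l: "l > 0"
  shows "dev x l (f_anc x l) \<le> c_osc * D * measure \<mu> (cb x (5 / 4 * l))"
proof -
  define a where "a = f_anc x l"
  define A where "A = cb x l \<inter> good"
  have "\<exists>r. 0 < r \<and> r \<le> l / 4 \<and> doubling n \<mu> (y, r) \<and> cmod (fQ (y, r) - a) \<le> c_stop * D" if y: "y \<in> A" for y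
  proof -
    obtain s where s: "0 < s" "s \<le> l / 4" "doubling n \<mu> (y, s)"
      using y l by (auto simp: A_def good_def dest!: spec[of _ "l / 4"])
    have "\<bar>y $ i - x $ i\<bar> \<le> l" for i
    proof -
      have "\<bar>y $ i - x $ i\<bar> \<le> l / 2" using y by (simp add: A_def mem_cb)
      then show ?thesis using l by linarith
    qed
    from stopping_cube[OF _ x l this s, of "-1"] show ?thesis
      using y unfolding a_def[symmetric] by (auto simp: A_def good_def) (smt (verit) norm_ge_zero)
  qed
  then obtain r where r: "\<And>y. y \<in> A \<Longrightarrow> 0 < r y" "\<And>y. y \<in> A \<Longrightarrow> r y \<le> l / 4" "\<And>y. y \<in> A \<Longrightarrow> doubling n \<mu> (y, r y)"
     "\<And>y. y \<in> A \<Longrightarrow> cmod (fQ (y, r y) - a) \<le> c_stop * D" by metis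
  have "\<exists>U\<in>sets borel. A \<subseteq> U \<and> (\<integral>\<^sup>+y. ennreal (cmod (f y - a)) * indicator U y \<partial>\<mu>)
      \<le> 10 ^ CARD('m) * (\<integral>\<^sup>+y. ennreal ((1 + c_stop) * D) * indicator (cb x (5 / 4 * l)) y \<partial>\<mu>)"
  proof (rule besicovitch_integral[where r=r and L="l / 4"])
    fix y assume y: "y \<in> A"
    show "cb y (r y) \<subseteq> cb x (5 / 4 * l)"
    proof (rule cb_subset_cb)
      show "\<bar>y $ i - x $ i\<bar> \<le> l / 2" for i using y by (simp add: A_def mem_cb)
    qed (use r(2)[OF y] in linarith)
    have "dev y (r y) a \<le> dev y (r y) (fQ (y, r y)) + cmod (fQ (y, r y) - a) * measure \<mu> (cb y (r y))" by (rule dev_change)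
    also have "\<dots> \<le> D * measure \<mu> (cb y (r y)) + c_stop * D * measure \<mu> (cb y (r y))"
      using r(4)[OF y] by (intro add_mono dev_doubling r(3)[OF y] mult_right_mono) auto
    finally have "dev y (r y) a \<le> (1 + c_stop) * D * measure \<mu> (cb y (r y))" by (simp add: algebra_simps)
    then show "(\<integral>\<^sup>+z. ennreal (cmod (f z - a)) * indicator (cb y (r y)) z \<partial>\<mu>) \<le> (\<integral>\<^sup>+z. ennreal ((1 + c_stop) * D) * indicator (cb y (r y)) z \<partial>\<mu>)"
      unfolding dev_nn using constants_pos D
      by (subst nn_integral_cmult_indicator) (auto simp: emeasure_eq_measure ennreal_mult[symmetric] intro!: ennreal_leI)
  qed (use r l in auto)
  then obtain U where U: "U \<in> sets borel" "A \<subseteq> U" "(\<integral>\<^sup>+y. ennreal (cmod (f y - a)) * indicator U y \<partial>\<mu>)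
      \<le> 10 ^ CARD('m) * (\<integral>\<^sup>+y. ennreal ((1 + c_stop) * D) * indicator (cb x (5 / 4 * l)) y \<partial>\<mu>)" by blast
  have "ennreal (dev x l a) \<le> (\<integral>\<^sup>+y. ennreal (cmod (f y - a)) * indicator U y \<partial>\<mu>)"
    unfolding dev_nn[symmetric]
  proof (rule nn_integral_mono_AE)
    show "AE y in \<mu>. ennreal (cmod (f y - a)) * indicator (cb x l) y \<le> ennreal (cmod (f y - a)) * indicator U y"
      using AE_good by eventually_elim (use U(2) in \<open>auto simp: A_def indicator_def\<close>)
  qed
  also note U(3)
  also have "(\<integral>\<^sup>+y. ennreal ((1 + c_stop) * D) * indicator (cb x (5 / 4 * l)) y \<partial>\<mu>) = ennreal ((1 + c_stop) * D * measure \<mu> (cb x (5 / 4 * l)))"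
    using constants_pos D by (subst nn_integral_cmult_indicator) (auto simp: emeasure_eq_measure ennreal_mult)
  also have "10 ^ CARD('m) * ennreal ((1 + c_stop) * D * measure \<mu> (cb x (5 / 4 * l))) = ennreal (10 ^ CARD('m) * ((1 + c_stop) * D * measure \<mu> (cb x (5 / 4 * l))))"
    using constants_pos D by (subst ennreal_mult) (auto simp flip: ennreal_power)
  finally have "dev x l a \<le> 10 ^ CARD('m) * ((1 + c_stop) * D * measure \<mu> (cb x (5 / 4 * l)))"
    using constants_pos D by (subst (asm) ennreal_le_iff) auto
  then show ?thesis by (simp add: a_def c_osc_def mult_ac)
qed

end

section \<open>The John-Nirenberg inequality\<close>

lemma dist_le_cb:
  assumes "z \<in> cb (y :: real ^ 'm) r" shows "dist y z \<le> real CARD('m) * (r / 2)"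
proof -
  have "dist y z = norm (z - y)" by (simp add: dist_norm norm_minus_commute)
  also have "\<dots> \<le> (\<Sum>i\<in>UNIV. \<bar>(z - y) $ i\<bar>)" by (rule norm_le_l1_cart)
  also have "\<dots> \<le> (\<Sum>i\<in>(UNIV :: 'm set). r / 2)" using assms by (intro sum_mono) (simp add: mem_cb)
  finally show ?thesis by simp
qed

lemma open_contains_cb:
  assumes "open W" "y \<in> W" shows "\<exists>e>0. \<forall>r. 0 < r \<and> r \<le> e \<longrightarrow> cb (y :: real ^ 'm) r \<subseteq> W"
proof -
  obtain e where e: "e > 0" "ball y e \<subseteq> W" using assms open_contains_ball by blast
  have "cb y r \<subseteq> W" if "0 < r" "r \<le> e / real CARD('m)" for r
  proof
    fix z assume "z \<in> cb y r"
    then have "dist y z \<le> real CARD('m) * (r / 2)" by (rule dist_le_cb)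
    also have "\<dots> \<le> e / 2" using that by (simp add: field_simps)
    also have "\<dots> < e" using e by simp
    finally show "z \<in> W" using e by auto
  qed
  then show ?thesis using e by (intro exI[of _ "e / real CARD('m)"]) auto
qed

context rbmo_function begin

text \<open>
  A weak form of Lebesgue's differentiation theorem: a large deviation of \<open>f\<close> at a point is seen, up
  to a constant, by the number of a small doubling cube there.  Let \<open>N'\<close> be the set of points of \<open>N\<close>
  where it is not seen.  On a small cube around such a point \<open>f\<close> deviates strongly on \<open>N\<close> from the number
  of the cube, so that \<open>N\<close> fills only a small part of the cube.  Summing over a covering
  inside an open set \<open>W\<close> around \<open>N'\<close> gives that the outer measure of \<open>N'\<close> is at most half of the measure
  of \<open>W\<close>, and \<open>W\<close> can be chosen of measure close to that of \<open>N'\<close>.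
\<close>

lemma doubling_means_detect_deviation:
  assumes [measurable]: "N \<in> sets borel" and N: "\<And>y. y \<in> N \<Longrightarrow> cmod (f y - a) \<ge> \<Lambda>"
    and \<Lambda>: "\<Lambda> \<ge> \<tau> + 2 * 10 ^ CARD('m) * D" and s0: "s0 > 0"
  shows "\<exists>Z\<in>null_sets \<mu>. \<forall>y\<in>N - Z. \<exists>s. 0 < s \<and> s \<le> s0 \<and> doubling n \<mu> (y, s) \<and> cmod (fQ (y, s) - a) > \<tau>"
proof -
  define N' where "N' = {y\<in>N. \<forall>s. 0 < s \<and> s \<le> s0 \<and> doubling n \<mu> (y, s) \<longrightarrow> cmod (fQ (y, s) - a) \<le> \<tau>}"
  \<comment> \<open>Since the choice of \<open>fQ\<close> is arbitrary, \<open>N'\<close> need not be measurable.\<close>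
  obtain B where B: "B \<in> sets \<mu>" "N' \<subseteq> B" "outer_measure_of \<mu> N' = emeasure \<mu> B"
    using outer_measure_of_attain[of N' \<mu>] by auto
  have key: "2 * measure \<mu> B \<le> measure \<mu> W" if W: "open W" "B \<subseteq> W" for W
  proof -
    have Wb[measurable]: "W \<in> sets borel" using W by simp
    define A where "A = N' \<inter> good"
    have "\<exists>r. 0 < r \<and> r \<le> s0 \<and> doubling n \<mu> (y, r) \<and> cb y r \<subseteq> W" if y: "y \<in> A" for y
    proof -
      obtain e where e: "e > 0" "\<And>r. 0 < r \<Longrightarrow> r \<le> e \<Longrightarrow> cb y r \<subseteq> W"
      proof -
        have "y \<in> W" using y W(2) B(2) by (auto simp: A_def)
        then show ?thesis using open_contains_cb[OF W(1), of y] that by blast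
      qed
      have "min e s0 > 0" using e(1) s0 by simp
      then obtain r where "0 < r" "r \<le> min e s0" "doubling n \<mu> (y, r)"
        using y unfolding A_def good_def by blast
      then show ?thesis using e(2)[of r] by (intro exI[of _ r]) auto
    qed
    then obtain r where r: "\<And>y. y \<in> A \<Longrightarrow> 0 < r y" "\<And>y. y \<in> A \<Longrightarrow> r y \<le> s0" "\<And>y. y \<in> A \<Longrightarrow> doubling n \<mu> (y, r y)"
       "\<And>y. y \<in> A \<Longrightarrow> cb y (r y) \<subseteq> W" by metis
    define e where "e = 2 * 10 ^ CARD('m) * D"
    have e: "e > 0" using D by (simp add: e_def)
    have "\<exists>U\<in>sets borel. A \<subseteq> U \<and> (\<integral>\<^sup>+y. (ennreal e * indicator N y) * indicator U y \<partial>\<mu>)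
      \<le> 10 ^ CARD('m) * (\<integral>\<^sup>+y. ennreal D * indicator W y \<partial>\<mu>)"
    proof (rule besicovitch_integral[where r=r and L=s0])
      fix y assume y: "y \<in> A"
      then have yN: "cmod (fQ (y, r y) - a) \<le> \<tau>" using r[OF y] by (auto simp: A_def N'_def)
      have "(\<integral>\<^sup>+z. (ennreal e * indicator N z) * indicator (cb y (r y)) z \<partial>\<mu>)
        \<le> (\<integral>\<^sup>+z. ennreal (cmod (f z - fQ (y, r y))) * indicator (cb y (r y)) z \<partial>\<mu>)"
      proof (rule nn_integral_mono)
        fix z
        have "e \<le> cmod (f z - fQ (y, r y))" if "z \<in> N"
          using N[OF that] \<Lambda> yN norm_triangle_ineq[of "f z - fQ (y, r y)" "fQ (y, r y) - a"] by (simp add: e_def)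
        then show "(ennreal e * indicator N z) * indicator (cb y (r y)) z \<le> ennreal (cmod (f z - fQ (y, r y))) * indicator (cb y (r y)) z"
          by (auto simp: indicator_def ennreal_leI)
      qed
      also have "\<dots> = ennreal (dev y (r y) (fQ (y, r y)))" by (rule dev_nn)
      also have "\<dots> \<le> ennreal (D * measure \<mu> (cb y (r y)))" by (intro ennreal_leI dev_doubling r y)
      also have "\<dots> = (\<integral>\<^sup>+z. ennreal D * indicator (cb y (r y)) z \<partial>\<mu>)"
        using D by (subst nn_integral_cmult_indicator) (auto simp: emeasure_eq_measure ennreal_mult)
      finally show "(\<integral>\<^sup>+z. (ennreal e * indicator N z) * indicator (cb y (r y)) z \<partial>\<mu>) \<le> (\<integral>\<^sup>+z. ennreal D * indicator (cb y (r y)) z \<partial>\<mu>)" .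
    qed (use r s0 in auto)
    then obtain U where U[measurable]: "U \<in> sets borel" and AU: "A \<subseteq> U"
      and le: "(\<integral>\<^sup>+y. (ennreal e * indicator N y) * indicator U y \<partial>\<mu>) \<le> 10 ^ CARD('m) * (\<integral>\<^sup>+y. ennreal D * indicator W y \<partial>\<mu>)" by blast
    have "(\<integral>\<^sup>+y. (ennreal e * indicator N y) * indicator U y \<partial>\<mu>) = (\<integral>\<^sup>+y. ennreal e * indicator (N \<inter> U) y \<partial>\<mu>)"
      by (intro nn_integral_cong) (auto simp: indicator_def)
    also have "\<dots> = ennreal (e * measure \<mu> (N \<inter> U))"
      using e by (subst nn_integral_cmult_indicator) (auto simp: emeasure_eq_measure ennreal_mult)
    finally have "ennreal (e * measure \<mu> (N \<inter> U)) \<le> 10 ^ CARD('m) * (\<integral>\<^sup>+y. ennreal D * indicator W y \<partial>\<mu>)" using le by simp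
    also have "(\<integral>\<^sup>+y. ennreal D * indicator W y \<partial>\<mu>) = ennreal (D * measure \<mu> W)"
      using D by (subst nn_integral_cmult_indicator) (auto simp: emeasure_eq_measure ennreal_mult)
    also have "10 ^ CARD('m) * ennreal (D * measure \<mu> W) = ennreal (10 ^ CARD('m) * (D * measure \<mu> W))"
      using D by (subst ennreal_mult) (auto simp flip: ennreal_power)
    finally have "e * measure \<mu> (N \<inter> U) \<le> 10 ^ CARD('m) * (D * measure \<mu> W)"
      using D by (subst (asm) ennreal_le_iff) auto
    then have "10 ^ CARD('m) * D * (2 * measure \<mu> (N \<inter> U)) \<le> 10 ^ CARD('m) * D * measure \<mu> W" by (simp add: e_def mult_ac)
    then have 1: "2 * measure \<mu> (N \<inter> U) \<le> measure \<mu> W" using D by (subst (asm) mult_le_cancel_left_pos) auto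
    obtain Z0 where Z0: "Z0 \<in> null_sets \<mu>" "- good \<subseteq> Z0" using AE_E2[OF AE_good] AE_good by (auto simp: eventually_ae_filter)
    have "emeasure \<mu> B \<le> outer_measure_of \<mu> (N \<inter> U \<union> Z0)"
      unfolding B(3)[symmetric] using AU Z0(2) by (intro outer_measure_of_mono) (auto simp: A_def N'_def)
    also have "\<dots> = emeasure \<mu> (N \<inter> U \<union> Z0)" using Z0 by (intro outer_measure_of_eq) auto
    also have "\<dots> \<le> emeasure \<mu> (N \<inter> U) + emeasure \<mu> Z0" using Z0 by (intro emeasure_subadditive) auto
    also have "\<dots> = emeasure \<mu> (N \<inter> U)" using Z0 by auto
    finally have "measure \<mu> B \<le> measure \<mu> (N \<inter> U)" by (simp add: emeasure_eq_measure)
    then show ?thesis using 1 by simp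
  qed
  have "2 * emeasure \<mu> B \<le> (INF U \<in> {U. B \<subseteq> U \<and> open U}. emeasure \<mu> U)"
  proof (rule INF_greatest)
    fix W assume "W \<in> {U. B \<subseteq> U \<and> open U}"
    then have "ennreal (2 * measure \<mu> B) \<le> ennreal (measure \<mu> W)" using key by (intro ennreal_leI) auto
    then show "2 * emeasure \<mu> B \<le> emeasure \<mu> W" by (simp add: emeasure_eq_measure ennreal_mult)
  qed
  also have "\<dots> = emeasure \<mu> B" using B(1) emeasure_finite[of UNIV] by (intro outer_regular[symmetric]) auto
  finally have "ennreal (2 * measure \<mu> B) \<le> ennreal (measure \<mu> B)" by (simp add: emeasure_eq_measure ennreal_mult)
  then have "2 * measure \<mu> B \<le> measure \<mu> B" by simp
  then have "measure \<mu> B = 0" using measure_nonneg[of \<mu> B] by linarith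
  then have "B \<in> null_sets \<mu>" using B(1) by (simp add: null_sets_def emeasure_eq_measure)
  moreover have "\<exists>s. 0 < s \<and> s \<le> s0 \<and> doubling n \<mu> (y, s) \<and> cmod (fQ (y, s) - a) > \<tau>" if "y \<in> N - B" for y
  proof -
    have "y \<notin> N'" using that B(2) by blast
    then show ?thesis using that unfolding N'_def by (simp add: not_le)
  qed
  ultimately show ?thesis by blast
qed

lemma oscillation_enlarged:
  assumes x: "x \<in> supp \<mu>" and l: "l > 0"
  shows "dev x (5 / 4 * l) (f_anc x l) \<le> c_osc_big * D * measure \<mu> (cb x (2 * l))"
proof -
  have m1: "measure \<mu> (cb x (5 / 4 * (5 / 4 * l))) \<le> measure \<mu> (cb x (2 * l))"
    using l by (intro measure_mono_cb cb_mono) auto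
  have m2: "measure \<mu> (cb x (5 / 4 * l)) \<le> measure \<mu> (cb x (2 * l))"
    using l by (intro measure_mono_cb cb_mono) auto
  have "scale_sum x l (5 / 4 * l) \<le> scale_sum x l (4 * l)" using l by (intro scale_sum_mono) auto
  then have "c_conc * D * (1 + scale_sum x l (5 / 4 * l)) \<le> c_conc * D * (1 + 2 * (G * C0))"
    using scale_sum_4[OF x l] constants_pos D by (intro mult_left_mono) auto
  moreover have "cmod (f_anc x l - f_anc x (5 / 4 * l)) \<le> c_conc * D * (1 + scale_sum x l (5 / 4 * l))" using l by (intro f_anc_concentric x) auto
  ultimately have c: "cmod (f_anc x (5 / 4 * l) - f_anc x l) \<le> c_conc * D * (1 + 2 * (G * C0))" by (simp add: norm_minus_commute)
  have "dev x (5 / 4 * l) (f_anc x l) \<le> dev x (5 / 4 * l) (f_anc x (5 / 4 * l)) + cmod (f_anc x (5 / 4 * l) - f_anc x l) * measure \<mu> (cb x (5 / 4 * l))"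
    by (rule dev_change)
  also have "\<dots> \<le> c_osc * D * measure \<mu> (cb x (5 / 4 * (5 / 4 * l))) + c_conc * D * (1 + 2 * (G * C0)) * measure \<mu> (cb x (5 / 4 * l))"
    using l by (intro add_mono oscillation_any_cube x mult_right_mono c) auto
  also have "\<dots> \<le> c_osc * D * measure \<mu> (cb x (2 * l)) + c_conc * D * (1 + 2 * (G * C0)) * measure \<mu> (cb x (2 * l))"
    using constants_pos D GC0 by (intro add_mono mult_left_mono m1 m2) auto
  finally show ?thesis by (simp add: c_osc_big_def algebra_simps)
qed

text \<open>
  Induction on the level.  Almost every point of the set for \<open>k + 1\<close> lies in a stopping cube, whose
  number differs from that of the given cube by at most one step; so on the stopping cube the
  deviation from its own number exceeds the level \<open>k\<close>, and the induction hypothesis applies.  The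
  stopping cubes have small total measure, because \<open>f\<close> has a large mean deviation on each of them.
\<close>

lemma john_nirenberg:
  assumes "x \<in> supp \<mu>" "l > 0"
  shows "measure \<mu> {y \<in> cb x l. cmod (f y - f_anc x l) > real k * (c_jn * D)} \<le> (1/2) ^ k * measure \<mu> (cb x (2 * l))"
  using assms
proof (induction k arbitrary: x l)
  case 0
  then have "measure \<mu> (cb x l) \<le> measure \<mu> (cb x (2 * l))" by (intro measure_mono_cb cb_mono) auto
  moreover have "measure \<mu> {y \<in> cb x l. cmod (f y - f_anc x l) > real 0 * (c_jn * D)} \<le> measure \<mu> (cb x l)"
    by (intro finite_measure_mono) auto
  ultimately show ?case by simp
next
  case (Suc k)
  note x = Suc.prems(1) and l = Suc.prems(2)
  define a where "a = f_anc x l"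
  define lam where "lam = c_jn * D"
  define \<tau> where "\<tau> = c_level * D"
  have lam: "lam = \<tau> + c_stop * D + 2 * 10 ^ CARD('m) * D" by (simp add: lam_def \<tau>_def c_jn_def algebra_simps)
  have \<tau>D: "\<tau> - D = 2 * 10 ^ CARD('m) * \<beta> * c_osc_big * D" by (simp add: \<tau>_def c_level_def algebra_simps)
  have pos: "c_stop * D > 0" "\<tau> > 0" "\<tau> - D > 0" "lam > 0"
    using constants_pos D beta2 unfolding \<tau>D by (auto simp: \<tau>_def lam_def)
  define N where "N = {y \<in> cb x l. cmod (f y - a) > real (Suc k) * lam}"
  have N[measurable]: "N \<in> sets borel" unfolding N_def by measurable
  have "\<exists>Z\<in>null_sets \<mu>. \<forall>y\<in>N - Z. \<exists>s. 0 < s \<and> s \<le> l / 4 \<and> doubling n \<mu> (y, s) \<and> cmod (fQ (y, s) - a) > \<tau>"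
  proof (rule doubling_means_detect_deviation[where \<Lambda>=lam])
    fix y assume "y \<in> N"
    then have "real (Suc k) * lam < cmod (f y - a)" by (simp add: N_def)
    moreover have "1 * lam \<le> real (Suc k) * lam" using pos by (intro mult_right_mono) auto
    ultimately show "cmod (f y - a) \<ge> lam" by simp
  qed (use l pos lam in auto)
  then obtain Z where Z: "Z \<in> null_sets \<mu>"
    "\<And>y. y \<in> N - Z \<Longrightarrow> \<exists>s. 0 < s \<and> s \<le> l / 4 \<and> doubling n \<mu> (y, s) \<and> cmod (fQ (y, s) - a) > \<tau>" by blast
  define A where "A = N - Z"
  have yx: "\<bar>y $ i - x $ i\<bar> \<le> l / 2" if "y \<in> A" for y i using that by (simp add: A_def N_def mem_cb)
  have "\<exists>r. 0 < r \<and> r \<le> l / 4 \<and> doubling n \<mu> (y, r) \<and> cmod (fQ (y, r) - a) > \<tau> \<and> cmod (fQ (y, r) - a) \<le> \<tau> + c_stop * D"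
    if y: "y \<in> A" for y
  proof -
    obtain s where s: "0 < s" "s \<le> l / 4" "doubling n \<mu> (y, s)" "cmod (fQ (y, s) - f_anc x l) > \<tau>"
      using Z(2) y unfolding A_def a_def by blast
    have ysupp: "y \<in> supp \<mu>" using s(3) by (simp add: doubling_iff)
    have "\<bar>y $ i - x $ i\<bar> \<le> l" for i using yx[OF y, of i] l by linarith
    from stopping_cube[OF ysupp x l this s] show ?thesis using pos(2) by (simp add: a_def max_def)
  qed
  then obtain r where r: "\<And>y. y \<in> A \<Longrightarrow> 0 < r y" "\<And>y. y \<in> A \<Longrightarrow> r y \<le> l / 4" "\<And>y. y \<in> A \<Longrightarrow> doubling n \<mu> (y, r y)"
     "\<And>y. y \<in> A \<Longrightarrow> cmod (fQ (y, r y) - a) > \<tau>" "\<And>y. y \<in> A \<Longrightarrow> cmod (fQ (y, r y) - a) \<le> \<tau> + c_stop * D" by metis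
  \<comment> \<open>A stopping cube has measure at most \<open>1 / (\<tau> - D)\<close> times the deviation on it.\<close>
  define w where "w = (1/2) ^ k * \<beta> / (\<tau> - D)"
  have w: "w > 0" using beta2 pos by (simp add: w_def)
  have "\<exists>U\<in>sets borel. A \<subseteq> U \<and> (\<integral>\<^sup>+y. indicator N y * indicator U y \<partial>\<mu>)
      \<le> 10 ^ CARD('m) * (\<integral>\<^sup>+y. (ennreal w * ennreal (cmod (f y - a))) * indicator (cb x (5 / 4 * l)) y \<partial>\<mu>)"
  proof (rule besicovitch_integral[where r=r and L="l / 4"])
    fix y assume y: "y \<in> A"
    show "cb y (r y) \<subseteq> cb x (5 / 4 * l)" by (rule cb_subset_cb[OF yx[OF y]]) (use r(2)[OF y] in linarith)
    have d: "doubling n \<mu> (y, r y)" by (rule r(3)[OF y])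
    then have ys: "y \<in> supp \<mu>" "measure \<mu> (cb y (4 * r y)) < \<beta> * measure \<mu> (cb y (r y))" by (auto simp: doubling_iff)
    have m: "measure \<mu> (N \<inter> cb y (r y)) \<le> measure \<mu> {z \<in> cb y (r y). cmod (f z - f_anc y (r y)) > real k * lam}"
    proof (rule finite_measure_mono)
      show "N \<inter> cb y (r y) \<subseteq> {z \<in> cb y (r y). cmod (f z - f_anc y (r y)) > real k * lam}"
      proof
        fix z assume z: "z \<in> N \<inter> cb y (r y)"
        have "real (Suc k) * lam < cmod (f z - a)" using z by (simp add: N_def)
        also have "\<dots> \<le> cmod (f z - fQ (y, r y)) + cmod (fQ (y, r y) - a)"
          using norm_triangle_ineq[of "f z - fQ (y, r y)" "fQ (y, r y) - a"] by simp
        finally have "real k * lam + lam < cmod (f z - fQ (y, r y)) + cmod (fQ (y, r y) - a)" by (simp add: algebra_simps)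
        then have "real k * lam < cmod (f z - fQ (y, r y))" using r(5)[OF y] lam D zero_le_power[of "10::real" "CARD('m)"]
          by (smt (verit) mult_nonneg_nonneg)
        then show "z \<in> {z \<in> cb y (r y). cmod (f z - f_anc y (r y)) > real k * lam}" using z d by (simp add: f_anc_doubling)
      qed
    qed auto
    also have "\<dots> \<le> (1/2) ^ k * measure \<mu> (cb y (2 * r y))" unfolding lam_def by (intro Suc.IH ys r(1)[OF y])
    also have "\<dots> \<le> (1/2) ^ k * (\<beta> * measure \<mu> (cb y (r y)))"
    proof (intro mult_left_mono)
      have "measure \<mu> (cb y (2 * r y)) \<le> measure \<mu> (cb y (4 * r y))" using r(1)[OF y] by (intro measure_mono_cb cb_mono) auto
      then show "measure \<mu> (cb y (2 * r y)) \<le> \<beta> * measure \<mu> (cb y (r y))" using ys(2) by simp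
    qed auto
    also have "\<dots> = w * ((\<tau> - D) * measure \<mu> (cb y (r y)))" using pos by (simp add: w_def)
    also have "\<dots> \<le> w * dev y (r y) a"
    proof (rule mult_left_mono)
      have "\<tau> * measure \<mu> (cb y (r y)) \<le> cmod (fQ (y, r y) - a) * measure \<mu> (cb y (r y))" using r(4)[OF y] by (intro mult_right_mono) auto
      also have "\<dots> \<le> dev y (r y) a + dev y (r y) (fQ (y, r y))" by (rule dev_lower)
      also have "\<dots> \<le> dev y (r y) a + D * measure \<mu> (cb y (r y))" using dev_doubling[OF d] by simp
      finally show "(\<tau> - D) * measure \<mu> (cb y (r y)) \<le> dev y (r y) a" by (simp add: algebra_simps)
    qed (use w in simp)
    finally have fin: "measure \<mu> (N \<inter> cb y (r y)) \<le> w * dev y (r y) a" .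
    have "(\<integral>\<^sup>+z. indicator N z * indicator (cb y (r y)) z \<partial>\<mu>) = (\<integral>\<^sup>+z. indicator (N \<inter> cb y (r y)) z \<partial>\<mu>)"
      by (intro nn_integral_cong) (auto simp: indicator_def)
    also have "\<dots> = ennreal (measure \<mu> (N \<inter> cb y (r y)))" by (simp add: emeasure_eq_measure)
    also have "\<dots> \<le> ennreal (w * dev y (r y) a)" by (intro ennreal_leI fin)
    also have "\<dots> = ennreal w * (\<integral>\<^sup>+z. ennreal (cmod (f z - a)) * indicator (cb y (r y)) z \<partial>\<mu>)"
      using w dev_nonneg by (simp add: dev_nn ennreal_mult)
    also have "\<dots> = (\<integral>\<^sup>+z. (ennreal w * ennreal (cmod (f z - a))) * indicator (cb y (r y)) z \<partial>\<mu>)"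
      by (simp add: nn_integral_cmult mult.assoc)
    finally show "(\<integral>\<^sup>+z. indicator N z * indicator (cb y (r y)) z \<partial>\<mu>)
       \<le> (\<integral>\<^sup>+z. (ennreal w * ennreal (cmod (f z - a))) * indicator (cb y (r y)) z \<partial>\<mu>)" .
  qed (use r l in auto)
  then obtain U where U[measurable]: "U \<in> sets borel" and AU: "A \<subseteq> U" and le: "(\<integral>\<^sup>+y. indicator N y * indicator U y \<partial>\<mu>)
      \<le> 10 ^ CARD('m) * (\<integral>\<^sup>+y. (ennreal w * ennreal (cmod (f y - a))) * indicator (cb x (5 / 4 * l)) y \<partial>\<mu>)" by blast
  have "ennreal (measure \<mu> N) = (\<integral>\<^sup>+y. indicator N y \<partial>\<mu>)" by (simp add: emeasure_eq_measure)
  also have "\<dots> \<le> (\<integral>\<^sup>+y. indicator N y * indicator U y \<partial>\<mu>)"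
  proof (rule nn_integral_mono_AE)
    show "AE y in \<mu>. (indicator N y :: ennreal) \<le> indicator N y * indicator U y"
      using AE_not_in[OF Z(1)] by eventually_elim (use AU in \<open>auto simp: A_def indicator_def\<close>)
  qed
  also note le
  also have "(\<integral>\<^sup>+y. (ennreal w * ennreal (cmod (f y - a))) * indicator (cb x (5 / 4 * l)) y \<partial>\<mu>) = ennreal w * ennreal (dev x (5 / 4 * l) a)"
    by (simp add: nn_integral_cmult mult.assoc dev_nn)
  also have "10 ^ CARD('m) * (ennreal w * ennreal (dev x (5 / 4 * l) a)) = ennreal (10 ^ CARD('m) * (w * dev x (5 / 4 * l) a))"
    using w dev_nonneg by (simp add: ennreal_mult flip: ennreal_power)
  finally have "measure \<mu> N \<le> 10 ^ CARD('m) * (w * dev x (5 / 4 * l) a)"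
    using w dev_nonneg by (subst (asm) ennreal_le_iff) auto
  also have "\<dots> \<le> 10 ^ CARD('m) * (w * (c_osc_big * D * measure \<mu> (cb x (2 * l))))"
    using w oscillation_enlarged[OF x l] by (intro mult_left_mono) (auto simp: a_def)
  also have "\<dots> = (1/2) ^ Suc k * measure \<mu> (cb x (2 * l))"
    unfolding w_def \<tau>D using constants_pos D beta2 by (simp add: field_simps)
  finally show ?case by (simp add: N_def a_def lam_def)
qed

text \<open>
  The layers of the John-Nirenberg inequality are summed; the constant is
  \<Sum>k. (2k+1) 2^(-k) = 6.
\<close>

lemma L2_oscillation:
  assumes x: "x \<in> supp \<mu>" and l: "l > 0"
  shows "(\<integral>\<^sup>+y. ennreal ((cmod (f y - f_anc x l))\<^sup>2) * indicator (cb x l) y \<partial>\<mu>) \<le> ennreal (6 * (c_jn * D)\<^sup>2 * measure \<mu> (cb x (2 * l)))"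
proof -
  define lam where "lam = c_jn * D"
  have lam: "lam > 0" using constants_pos D by (simp add: lam_def)
  define E where "E k = {y \<in> cb x l. cmod (f y - f_anc x l) > real k * lam}" for k
  have E[measurable]: "E k \<in> sets borel" for k unfolding E_def by measurable
  \<comment> \<open>The first \<open>K\<close> odd numbers have sum \<open>K\<^sup>2\<close>.\<close>
  define c where "c k = lam\<^sup>2 * (2 * real k + 1)" for k
  have c: "c k \<ge> 0" for k by (simp add: c_def)
  define m where "m = measure \<mu> (cb x (2 * l))"
  have "(\<integral>\<^sup>+y. ennreal ((cmod (f y - f_anc x l))\<^sup>2) * indicator (cb x l) y \<partial>\<mu>) \<le> (\<integral>\<^sup>+y. (\<Sum>k. ennreal (c k) * indicator (E k) y) \<partial>\<mu>)"
  proof (rule nn_integral_mono)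
    fix y
    define u where "u = cmod (f y - f_anc x l)"
    show "ennreal (u\<^sup>2) * indicator (cb x l) y \<le> (\<Sum>k. ennreal (c k) * indicator (E k) y)"
    proof (cases "y \<in> cb x l \<and> u > 0")
      case False then show ?thesis by (auto simp: u_def indicator_def)
    next
      case True
      define K where "K = nat \<lceil>u / lam\<rceil>"
      have K: "u / lam \<le> real K" "\<And>k. k < K \<Longrightarrow> real k < u / lam"
        using True lam unfolding K_def by (auto simp: zless_nat_eq_int_zless less_ceiling_iff)
      have sum: "(\<Sum>k<K. c k) = lam\<^sup>2 * (real K)\<^sup>2"
        by (induction K) (simp_all add: c_def algebra_simps power2_eq_square)
      have "u \<le> lam * real K" using K(1) lam by (simp add: field_simps)
      then have "u\<^sup>2 \<le> (lam * real K)\<^sup>2" using True by (intro power_mono) auto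
      then have "ennreal (u\<^sup>2) * indicator (cb x l) y \<le> ennreal (\<Sum>k<K. c k)" using True by (simp add: sum power_mult_distrib ennreal_leI)
      also have "\<dots> = (\<Sum>k<K. ennreal (c k))" using c by (simp add: sum_ennreal)
      also have "\<dots> = (\<Sum>k<K. ennreal (c k) * indicator (E k) y)"
      proof (rule sum.cong)
        fix k assume "k \<in> {..<K}"
        then have "real k * lam < u" using K(2)[of k] lam by (simp add: field_simps)
        then have "y \<in> E k" using True by (simp add: E_def u_def)
        then show "ennreal (c k) = ennreal (c k) * indicator (E k) y" by simp
      qed simp
      also have "\<dots> \<le> (\<Sum>k. ennreal (c k) * indicator (E k) y)" by (rule sum_le_suminf) auto
      finally show ?thesis .
    qed
  qed
  also have "\<dots> = (\<Sum>k. (\<integral>\<^sup>+y. ennreal (c k) * indicator (E k) y \<partial>\<mu>))" by (rule nn_integral_suminf) measurable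
  also have "\<dots> \<le> (\<Sum>k. ennreal (c k * ((1/2) ^ k * m)))"
  proof (intro suminf_le)
    fix k
    have "(\<integral>\<^sup>+y. ennreal (c k) * indicator (E k) y \<partial>\<mu>) = ennreal (c k * measure \<mu> (E k))"
      using c by (subst nn_integral_cmult_indicator) (auto simp: emeasure_eq_measure ennreal_mult)
    also have "\<dots> \<le> ennreal (c k * ((1/2) ^ k * m))"
      using john_nirenberg[OF x l, of k] c unfolding E_def lam_def m_def by (intro ennreal_leI mult_left_mono)
    finally show "(\<integral>\<^sup>+y. ennreal (c k) * indicator (E k) y \<partial>\<mu>) \<le> ennreal (c k * ((1/2) ^ k * m))" .
  qed auto
  also have "\<dots> = ennreal (6 * lam\<^sup>2 * m)"
  proof (rule suminf_ennreal_eq)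
    show "0 \<le> c k * ((1/2) ^ k * m)" for k using c by (simp add: m_def)
    have "(\<lambda>k. real (Suc k) * (1/2) ^ k) sums (1 / (1 - 1/2)\<^sup>2)" using geometric_deriv_sums[of "1/2::real"] by simp
    moreover have "(\<lambda>k. (1/2) ^ k) sums (1 / (1 - 1/2::real))" by (rule geometric_sums) simp
    ultimately have "(\<lambda>k. lam\<^sup>2 * m * (2 * (real (Suc k) * (1/2) ^ k) - (1/2) ^ k)) sums (lam\<^sup>2 * m * (2 * (1 / (1 - 1/2)\<^sup>2) - 1 / (1 - 1/2)))"
      by (intro sums_mult sums_diff)
    moreover have "(\<lambda>k. lam\<^sup>2 * m * (2 * (real (Suc k) * (1/2) ^ k) - (1/2) ^ k)) = (\<lambda>k. c k * ((1/2) ^ k * m))"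
      by (rule ext) (simp add: c_def algebra_simps)
    moreover have "lam\<^sup>2 * m * (2 * (1 / (1 - 1/2)\<^sup>2) - 1 / (1 - 1/2)) = 6 * lam\<^sup>2 * m" by (simp add: power2_eq_square)
    ultimately show "(\<lambda>k. c k * ((1/2) ^ k * m)) sums (6 * lam\<^sup>2 * m)" by (simp only:)
  qed
  finally show ?thesis by (simp add: lam_def m_def)
qed

end

section \<open>Integrability over the whole space\<close>

text \<open>
  This replaces the Cauchy-Schwarz inequality when an L^1 norm is bounded by an L^2 norm.
\<close>

lemma amgm:
  fixes t d :: real
  assumes "d > 0" shows "t \<le> (t\<^sup>2 / d + d) / 2"
proof -
  have "0 \<le> (t - d)\<^sup>2 / d" using assms by simp
  then show ?thesis using assms by (simp add: power2_diff field_simps power2_eq_square)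
qed

context growth_measure begin

definition "mass = measure \<mu> UNIV"
text \<open>
  Bounds at the largest scale: for K from the reference cube to any larger one, for the square
  integral about its mean, for that mean, for the square integral and the integral of the absolute
  value, for the mean over a cube with more than half of the mass, and for |f_x(\<rho>)|/K(Q).
\<close>

definition "c_base_K = 1 + mass / L0 powr n / (G - 1)"
definition "c_base_sq = (12 * c_jn\<^sup>2 + 2 * c_base_K\<^sup>2) * mass"
definition "c_base = (1 + (c_base_sq + mass) / 2) / mass"
definition "c_sq = 2 * c_base_sq + 2 * c_base\<^sup>2 * mass"
definition "c_abs = (c_base_sq + mass) / 2 + c_base * mass"
definition "c_large = 1 + 2 * c_abs / mass"
definition "c_top = c_large + (1 + G * G + G * (2 * (G * C0)))"

lemma mass: "mass > 0" "measure \<mu> X \<le> mass"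
  using total_pos finite_measure_mono[of X UNIV] bounded_measure[of X] by (auto simp: mass_def)

lemma global_constants_pos: "c_base_K \<ge> 1" "c_base_sq \<ge> 0" "c_base > 0" "c_sq > 0" "c_abs > 0" "c_large \<ge> 1" "c_top \<ge> 1"
proof -
  show "c_base_K \<ge> 1" using mass G by (simp add: c_base_K_def)
  show I: "c_base_sq \<ge> 0" using mass by (simp add: c_base_sq_def)
  then show E: "c_base > 0" using mass by (simp add: c_base_def add_pos_nonneg)
  then show "c_sq > 0" using mass I by (simp add: c_sq_def add_nonneg_pos)
  show F: "c_abs > 0" using mass I E by (simp add: c_abs_def add_nonneg_pos)
  then show T: "c_large \<ge> 1" using mass by (simp add: c_large_def)
  show "c_top \<ge> 1" using T G GC0 by (simp add: c_top_def)
qed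

lemma G_power: "(2 ^ j) powr n = G ^ j"
proof -
  have "(2 ^ j) powr n = (2 powr real j) powr n" by (simp add: powr_realpow)
  also have "\<dots> = (2 powr n) powr real j" by (simp add: powr_powr mult.commute)
  also have "\<dots> = G ^ j" by (simp add: powr_realpow G_def)
  finally show ?thesis .
qed

text \<open>
  The total mass being finite, the terms of K decay geometrically from a fixed scale on.
\<close>

lemma K_pair_from_base: "K_pair n \<mu> (x0, L0) R \<le> c_base_K"
proof -
  have geo: "(\<Sum>j=1..N. (1 / G) ^ j) = (1 - (1 / G) ^ N) / (G - 1)" for N
  proof -
    define q where "q = 1 / G"
    have q: "q * G = 1" using G(1) by (simp add: q_def)
    have "(\<Sum>j=1..N. q ^ j) * (G - 1) = 1 - q ^ N"
    proof (induction N)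
      case (Suc N)
      have "q ^ Suc N * G = (q * G) * q ^ N" by (simp add: mult_ac)
      then have e: "q ^ Suc N * G = q ^ N" by (simp only: q mult_1)
      have "(\<Sum>j=1..Suc N. q ^ j) * (G - 1) = (\<Sum>j=1..N. q ^ j) * (G - 1) + (q ^ Suc N * G - q ^ Suc N)"
        by (simp add: algebra_simps del: power_Suc)
      then show ?case by (simp only: e Suc)
    qed simp
    then show ?thesis using G(1) by (simp add: q_def field_simps)
  qed
  have "K_pair n \<mu> (x0, L0) R = 1 + (\<Sum>j=1..N_cubes (x0, L0) R. dens x0 (2 ^ j * L0))"
    by (simp add: K_pair_def dens_def dilate_def)
  also have "(\<Sum>j=1..N_cubes (x0, L0) R. dens x0 (2 ^ j * L0)) \<le> (\<Sum>j=1..N_cubes (x0, L0) R. mass / L0 powr n * (1 / G) ^ j)"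
  proof (rule sum_mono)
    fix j
    have "dens x0 (2 ^ j * L0) \<le> mass / (2 ^ j * L0) powr n"
      unfolding dens_def by (intro divide_right_mono mass) auto
    also have "(2 ^ j * L0) powr n = G ^ j * L0 powr n" using L0 by (simp add: powr_mult G_power)
    finally show "dens x0 (2 ^ j * L0) \<le> mass / L0 powr n * (1 / G) ^ j" by (simp add: field_simps)
  qed
  also have "\<dots> = mass / L0 powr n * ((1 - (1 / G) ^ N_cubes (x0, L0) R) / (G - 1))"
    by (simp only: sum_distrib_left[symmetric] geo)
  also have "\<dots> \<le> mass / L0 powr n * (1 / (G - 1))"
    using mass(1) G by (intro mult_left_mono divide_right_mono) auto
  finally show ?thesis by (simp add: c_base_K_def)
qed

end

context rbmo_function begin

text \<open>
  RBMO constants do not see additive constants, the integral of \<open>f\<close> does.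
\<close>

definition "D_full = D + cmod (LINT x|\<mu>. f x)"

lemma D_full: "D_full > 0" "D \<le> D_full" using D by (auto simp: D_full_def add_pos_nonneg)

definition "base_mean = fQ (x0, L0)"

text \<open>
  On the cubes Q(x0, 2^k L0), which exhaust the space, the constant of the L^2 oscillation is
  independent of k since the mass is finite, and the attached numbers stay bounded.
\<close>

lemma L2_about_base_mean: "(\<integral>\<^sup>+y. ennreal ((cmod (f y - base_mean))\<^sup>2) \<partial>\<mu>) \<le> ennreal (c_base_sq * D\<^sup>2)"
proof -
  define A where "A k = cb x0 (2 ^ k * L0)" for k :: nat
  have un: "(\<Union>k. A k) = UNIV" unfolding A_def by (rule UN_cb[OF L0(1)])
  have d0: "doubling n \<mu> (x0, L0)" by (rule large_doubling[OF x0 L0])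
  have bd: "(\<integral>\<^sup>+y. ennreal ((cmod (f y - base_mean))\<^sup>2) * indicator (A k) y \<partial>\<mu>) \<le> ennreal (c_base_sq * D\<^sup>2)" for k
  proof -
    define s where "s = 2 ^ k * L0"
    have s: "s > 0" "L0 \<le> s" using L0 by (auto simp: s_def)
    have "measure \<mu> (cb x0 L0) \<le> measure \<mu> (cb x0 s)" by (intro measure_mono_cb cb_mono s)
    then have ds: "doubling n \<mu> (x0, s)" using L0(2) by (intro large_doubling x0 s) auto
    define b where "b = f_anc x0 s"
    have b: "b = fQ (x0, s)" using ds by (simp add: b_def f_anc_doubling)
    have "cmod (base_mean - b) \<le> D * K_pair n \<mu> (x0, L0) (x0, s)" unfolding base_mean_def b by (intro compare d0 ds cb_mono s)
    also have "\<dots> \<le> D * c_base_K" using K_pair_from_base D by (intro mult_left_mono) auto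
    finally have ab: "(cmod (b - base_mean))\<^sup>2 \<le> (D * c_base_K)\<^sup>2" by (intro power_mono) (auto simp: norm_minus_commute)
    have "(\<integral>\<^sup>+y. ennreal ((cmod (f y - base_mean))\<^sup>2) * indicator (A k) y \<partial>\<mu>)
      \<le> (\<integral>\<^sup>+y. 2 * (ennreal ((cmod (f y - b))\<^sup>2) * indicator (cb x0 s) y) + ennreal (2 * (D * c_base_K)\<^sup>2) \<partial>\<mu>)"
    proof (rule nn_integral_mono)
      fix y
      have "(cmod (f y - base_mean))\<^sup>2 \<le> (cmod (f y - b) + cmod (b - base_mean))\<^sup>2"
        using norm_triangle_ineq[of "f y - b" "b - base_mean"] by (intro power_mono) auto
      also have "\<dots> \<le> 2 * (cmod (f y - b))\<^sup>2 + 2 * (cmod (b - base_mean))\<^sup>2"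
        using sum_squares_bound[of "cmod (f y - b)" "cmod (b - base_mean)"] by (simp add: power2_sum)
      finally have "(cmod (f y - base_mean))\<^sup>2 \<le> 2 * (cmod (f y - b))\<^sup>2 + 2 * (D * c_base_K)\<^sup>2" using ab by linarith
      then have "ennreal ((cmod (f y - base_mean))\<^sup>2) \<le> ennreal (2 * (cmod (f y - b))\<^sup>2 + 2 * (D * c_base_K)\<^sup>2)" by (rule ennreal_leI)
      also have "\<dots> = ennreal (2 * (cmod (f y - b))\<^sup>2) + ennreal (2 * (D * c_base_K)\<^sup>2)" by (rule ennreal_plus) auto
      also have "ennreal (2 * (cmod (f y - b))\<^sup>2) = 2 * ennreal ((cmod (f y - b))\<^sup>2)" by (simp add: ennreal_mult)
      finally show "ennreal ((cmod (f y - base_mean))\<^sup>2) * indicator (A k) y \<le> 2 * (ennreal ((cmod (f y - b))\<^sup>2) * indicator (cb x0 s) y) + ennreal (2 * (D * c_base_K)\<^sup>2)"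
        by (auto simp: A_def s_def indicator_def)
    qed
    also have "\<dots> = 2 * (\<integral>\<^sup>+y. ennreal ((cmod (f y - b))\<^sup>2) * indicator (cb x0 s) y \<partial>\<mu>) + ennreal (2 * (D * c_base_K)\<^sup>2) * emeasure \<mu> UNIV"
      by (subst nn_integral_add) (auto simp: nn_integral_cmult)
    also have "\<dots> \<le> 2 * ennreal (6 * (c_jn * D)\<^sup>2 * measure \<mu> (cb x0 (2 * s))) + ennreal (2 * (D * c_base_K)\<^sup>2) * ennreal mass"
      unfolding b_def mass_def using L2_oscillation[OF x0 s(1)] by (intro add_mono mult_left_mono) (auto simp: emeasure_eq_measure)
    also have "\<dots> = ennreal (12 * (c_jn * D)\<^sup>2 * measure \<mu> (cb x0 (2 * s)) + 2 * (D * c_base_K)\<^sup>2 * mass)"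
    proof -
      have "2 * ennreal (6 * (c_jn * D)\<^sup>2 * measure \<mu> (cb x0 (2 * s))) = ennreal (12 * (c_jn * D)\<^sup>2 * measure \<mu> (cb x0 (2 * s)))"
        using ennreal_mult[of 2 "6 * (c_jn * D)\<^sup>2 * measure \<mu> (cb x0 (2 * s))"] by (simp add: mult.assoc)
      then show ?thesis using mass by (simp add: ennreal_mult ennreal_plus)
    qed
    also have "\<dots> \<le> ennreal (c_base_sq * D\<^sup>2)"
    proof (rule ennreal_leI)
      have "12 * (c_jn * D)\<^sup>2 * measure \<mu> (cb x0 (2 * s)) \<le> 12 * (c_jn * D)\<^sup>2 * mass" by (intro mult_left_mono mass) auto
      then show "12 * (c_jn * D)\<^sup>2 * measure \<mu> (cb x0 (2 * s)) + 2 * (D * c_base_K)\<^sup>2 * mass \<le> c_base_sq * D\<^sup>2"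
        by (simp add: c_base_sq_def algebra_simps power_mult_distrib)
    qed
    finally show ?thesis .
  qed
  define g where "g = (\<lambda>y. ennreal ((cmod (f y - base_mean))\<^sup>2))"
  have gm[measurable]: "g \<in> borel_measurable \<mu>" unfolding g_def by measurable
  have em: "emeasure (density \<mu> g) X = (\<integral>\<^sup>+y. g y * indicator X y \<partial>\<mu>)" if "X \<in> sets borel" for X
    using that by (subst emeasure_density) auto
  have "(\<integral>\<^sup>+y. g y \<partial>\<mu>) = emeasure (density \<mu> g) (\<Union>k. A k)" by (simp add: un em)
  also have "\<dots> = (SUP k. emeasure (density \<mu> g) (A k))"
  proof (rule SUP_emeasure_incseq[symmetric])
    show "incseq A" unfolding A_def by (rule incseq_cb[OF L0(1)])
  qed (auto simp: A_def)
  also have "\<dots> \<le> ennreal (c_base_sq * D\<^sup>2)"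
  proof (rule SUP_least)
    fix k
    have "emeasure (density \<mu> g) (A k) = (\<integral>\<^sup>+y. g y * indicator (A k) y \<partial>\<mu>)" by (rule em) (simp add: A_def)
    then show "emeasure (density \<mu> g) (A k) \<le> ennreal (c_base_sq * D\<^sup>2)" using bd[of k] by (simp add: g_def)
  qed
  finally show ?thesis by (simp add: g_def)
qed

lemma square_integrable_about_base: "integrable \<mu> (\<lambda>y. (cmod (f y - base_mean))\<^sup>2)"
proof (rule integrableI_bounded)
  have "(\<integral>\<^sup>+y. ennreal (norm ((cmod (f y - base_mean))\<^sup>2)) \<partial>\<mu>) \<le> ennreal (c_base_sq * D\<^sup>2)" using L2_about_base_mean by simp
  then show "(\<integral>\<^sup>+y. ennreal (norm ((cmod (f y - base_mean))\<^sup>2)) \<partial>\<mu>) < \<infinity>" using le_less_trans by fastforce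
qed measurable

lemma integral_square_about_base: "(LINT y|\<mu>. (cmod (f y - base_mean))\<^sup>2) \<le> c_base_sq * D\<^sup>2"
proof -
  have "ennreal (LINT y|\<mu>. (cmod (f y - base_mean))\<^sup>2) = (\<integral>\<^sup>+y. ennreal ((cmod (f y - base_mean))\<^sup>2) \<partial>\<mu>)"
    by (rule nn_integral_eq_integral[symmetric]) (auto intro: square_integrable_about_base)
  then have "ennreal (LINT y|\<mu>. (cmod (f y - base_mean))\<^sup>2) \<le> ennreal (c_base_sq * D\<^sup>2)" using L2_about_base_mean by simp
  then show ?thesis using global_constants_pos(2) by (subst (asm) ennreal_le_iff) auto
qed

lemma integrable_const[simp]: "integrable \<mu> (\<lambda>_. c :: 'z :: {banach, second_countable_topology})"
  by (rule finite_measure.integrable_const) (rule fin_mu)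

lemma abs_integrable_about_base: "integrable \<mu> (\<lambda>y. cmod (f y - base_mean))"
proof (rule Bochner_Integration.integrable_bound)
  show "integrable \<mu> (\<lambda>y. ((cmod (f y - base_mean))\<^sup>2 / D + D) / 2)"
    using square_integrable_about_base by simp
  show "AE y in \<mu>. norm (cmod (f y - base_mean)) \<le> norm (((cmod (f y - base_mean))\<^sup>2 / D + D) / 2)"
    unfolding real_norm_def abs_norm_cancel by (intro AE_I2 order_trans[OF amgm[OF D] abs_ge_self])
qed measurable

lemma integral_abs_about_base: "(LINT y|\<mu>. cmod (f y - base_mean)) \<le> (c_base_sq + mass) / 2 * D"
proof -
  have "(LINT y|\<mu>. cmod (f y - base_mean)) \<le> (LINT y|\<mu>. ((cmod (f y - base_mean))\<^sup>2 / D + D) / 2)"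
    using square_integrable_about_base by (intro integral_mono abs_integrable_about_base amgm D) simp
  also have "\<dots> = ((LINT y|\<mu>. (cmod (f y - base_mean))\<^sup>2) / D + D * mass) / 2"
    using square_integrable_about_base by (simp add: mass_def mult.commute)
  also have "\<dots> \<le> (c_base_sq * D\<^sup>2 / D + D * mass) / 2" using integral_square_about_base D by (simp add: divide_right_mono)
  finally show ?thesis using D by (simp add: power2_eq_square field_simps)
qed

lemma integral_abs_about_base': "(LINT y|\<mu>. cmod (f y - base_mean)) \<le> (c_base_sq + mass) / 2 * D_full"
  by (rule order_trans[OF integral_abs_about_base mult_left_mono[OF D_full(2)]])
    (use global_constants_pos(2) mass(1) in auto)

lemma f_integrable: "integrable \<mu> f"
proof -
  have "integrable \<mu> (\<lambda>y. f y - base_mean)" by (rule integrable_norm_cancel[OF abs_integrable_about_base]) measurable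
  then have "integrable \<mu> (\<lambda>y. (f y - base_mean) + base_mean)" by (intro Bochner_Integration.integrable_add) auto
  then show ?thesis by simp
qed

text \<open>
  The oscillation about the number of the reference cube is controlled, so this number is
  controlled by the integral of \<open>f\<close>.
\<close>

lemma base_mean_bound: "cmod base_mean \<le> c_base * D_full"
proof -
  have "base_mean * of_real mass = (LINT y|\<mu>. f y) - (LINT y|\<mu>. f y - base_mean)"
    using f_integrable by (simp add: mass_def scaleR_conv_of_real mult.commute)
  then have "cmod base_mean * mass = cmod ((LINT y|\<mu>. f y) - (LINT y|\<mu>. f y - base_mean))"
    using mass(1) by (metis abs_of_pos norm_mult norm_of_real)
  also have "\<dots> \<le> cmod (LINT y|\<mu>. f y) + cmod (LINT y|\<mu>. f y - base_mean)" by (rule norm_triangle_ineq4)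
  also have "cmod (LINT y|\<mu>. f y - base_mean) \<le> (LINT y|\<mu>. cmod (f y - base_mean))" by (rule integral_norm_bound)
  also have "\<dots> \<le> (c_base_sq + mass) / 2 * D_full" by (rule integral_abs_about_base')
  also have "cmod (LINT y|\<mu>. f y) \<le> D_full" using D by (simp add: D_full_def)
  finally have "cmod base_mean * mass \<le> (1 + (c_base_sq + mass) / 2) * D_full" by (simp add: algebra_simps)
  then show ?thesis using mass(1) by (simp add: c_base_def field_simps)
qed

lemma f_square_integrable: "integrable \<mu> (\<lambda>y. (cmod (f y))\<^sup>2)"
  and f_L2_bound: "(LINT y|\<mu>. (cmod (f y))\<^sup>2) \<le> c_sq * D_full\<^sup>2"
proof -
  have pt: "(cmod (f y))\<^sup>2 \<le> 2 * (cmod (f y - base_mean))\<^sup>2 + 2 * (cmod base_mean)\<^sup>2" for y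
  proof -
    have "(cmod (f y))\<^sup>2 \<le> (cmod (f y - base_mean) + cmod base_mean)\<^sup>2"
      using norm_triangle_ineq[of "f y - base_mean" base_mean] by (intro power_mono) auto
    also have "\<dots> \<le> 2 * (cmod (f y - base_mean))\<^sup>2 + 2 * (cmod base_mean)\<^sup>2"
      using sum_squares_bound[of "cmod (f y - base_mean)" "cmod base_mean"] by (simp add: power2_sum)
    finally show ?thesis .
  qed
  have int: "integrable \<mu> (\<lambda>y. 2 * (cmod (f y - base_mean))\<^sup>2 + 2 * (cmod base_mean)\<^sup>2)" using square_integrable_about_base by simp
  show sq: "integrable \<mu> (\<lambda>y. (cmod (f y))\<^sup>2)"
    by (rule Bochner_Integration.integrable_bound[OF int]) (use pt in \<open>auto intro!: AE_I2\<close>)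
  have "(LINT y|\<mu>. (cmod (f y))\<^sup>2) \<le> (LINT y|\<mu>. 2 * (cmod (f y - base_mean))\<^sup>2 + 2 * (cmod base_mean)\<^sup>2)"
    by (intro integral_mono sq int pt)
  also have "\<dots> = 2 * (LINT y|\<mu>. (cmod (f y - base_mean))\<^sup>2) + 2 * (cmod base_mean)\<^sup>2 * mass"
    using square_integrable_about_base by (simp add: mass_def)
  also have "\<dots> \<le> 2 * (c_base_sq * D_full\<^sup>2) + 2 * (c_base * D_full)\<^sup>2 * mass"
  proof (intro add_mono mult_left_mono mult_right_mono power_mono base_mean_bound)
    have "c_base_sq * D\<^sup>2 \<le> c_base_sq * D_full\<^sup>2" using D_full D global_constants_pos by (intro mult_left_mono power_mono) auto
    then show "(LINT y|\<mu>. (cmod (f y - base_mean))\<^sup>2) \<le> c_base_sq * D_full\<^sup>2" using integral_square_about_base by linarith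
  qed (use mass in auto)
  finally show "(LINT y|\<mu>. (cmod (f y))\<^sup>2) \<le> c_sq * D_full\<^sup>2" by (simp add: c_sq_def algebra_simps power_mult_distrib)
qed

lemma f_L1_bound: "(LINT y|\<mu>. cmod (f y)) \<le> c_abs * D_full"
proof -
  have "(LINT y|\<mu>. cmod (f y)) \<le> (LINT y|\<mu>. cmod (f y - base_mean) + cmod base_mean)"
  proof (intro integral_mono)
    show "cmod (f y) \<le> cmod (f y - base_mean) + cmod base_mean" for y using norm_triangle_ineq[of "f y - base_mean" base_mean] by simp
  qed (use f_integrable abs_integrable_about_base in auto)
  also have "\<dots> = (LINT y|\<mu>. cmod (f y - base_mean)) + cmod base_mean * mass" using abs_integrable_about_base by (simp add: mass_def)
  also have "\<dots> \<le> (c_base_sq + mass) / 2 * D_full + c_base * D_full * mass"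
  proof (intro add_mono mult_right_mono base_mean_bound)
    show "(LINT y|\<mu>. cmod (f y - base_mean)) \<le> (c_base_sq + mass) / 2 * D_full" by (rule integral_abs_about_base')
  qed (use mass in auto)
  finally show ?thesis by (simp add: c_abs_def algebra_simps)
qed

lemma dev_0_le: "dev x s 0 \<le> c_abs * D_full"
proof -
  have "dev x s 0 \<le> (LINT y|\<mu>. cmod (f y))"
    unfolding dev_def set_lebesgue_integral_def
    using dev_integrable[of x s 0] f_integrable by (intro integral_mono) (auto simp: indicator_def)
  then show ?thesis using f_L1_bound by linarith
qed

lemma large_cube_mean_bound:
  assumes "x \<in> supp \<mu>" "s > 0" "measure \<mu> (cb x s) > measure \<mu> UNIV / 2"
  shows "cmod (fQ (x, s)) \<le> c_large * D_full"
proof -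
  define m where "m = measure \<mu> (cb x s)"
  have m: "m > mass / 2" using assms(3) by (simp add: m_def mass_def)
  have "cmod (fQ (x, s)) * m \<le> dev x s 0 + dev x s (fQ (x, s))" using dev_lower[of "fQ (x, s)" 0 x s] by (simp add: m_def)
  also have "\<dots> \<le> c_abs * D_full + D * m" using dev_0_le dev_doubling[OF large_doubling[OF assms]] by (intro add_mono) (auto simp: m_def)
  also have "\<dots> \<le> 2 * c_abs / mass * D_full * m + D_full * m"
  proof (intro add_mono mult_right_mono D_full)
    have "c_abs * D_full * 1 \<le> c_abs * D_full * (m / (mass / 2))" using m mass global_constants_pos D_full by (intro mult_left_mono) (auto simp: field_simps)
    then show "c_abs * D_full \<le> 2 * c_abs / mass * D_full * m" by (simp add: field_simps)
  qed (use m mass in auto)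
  finally have "cmod (fQ (x, s)) * m \<le> (c_large * D_full) * m" by (simp add: c_large_def algebra_simps)
  then show ?thesis using m mass by (simp add: mult_le_cancel_right)
qed

text \<open>
  The cube that defines K(Q) carries more than half of the mass, so its number is bounded, and
  from Q to it the number changes by at most a multiple of K(Q).
\<close>

lemma f_anc_le_K_single:
  assumes d: "doubling n \<mu> (x, l)" and r: "l \<le> \<rho>"
  shows "cmod (f_anc x \<rho>) \<le> c_top * D_full * K_single n \<mu> (x, l)"
proof -
  have x: "x \<in> supp \<mu>" and l: "l > 0" using d by (auto simp: doubling_iff)
  define k where "k = (LEAST k. k > 0 \<and> measure \<mu> (cube_set (dilate (2 ^ k) (x, l))) > measure \<mu> UNIV / 2)"
  define s where "s = 2 ^ k * l"
  define KK where "KK = K_single n \<mu> (x, l)"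
  have KK: "KK = K_pair n \<mu> (x, l) (x, s)" by (simp add: KK_def K_single_def k_def s_def dilate_def)
  have KK1: "KK \<ge> 1" unfolding KK by (rule K_pair_ge_1)
  obtain k0 where k0: "\<And>k. k \<ge> k0 \<Longrightarrow> measure \<mu> (cb x (2 ^ k * l)) > measure \<mu> UNIV / 2" using large_cubes_exist[OF l, of x] by blast
  have "\<exists>k. k > 0 \<and> measure \<mu> (cube_set (dilate (2 ^ k) (x, l))) > measure \<mu> UNIV / 2"
    using k0[of "Suc k0"] by (intro exI[of _ "Suc k0"]) (simp add: dilate_def)
  from LeastI_ex[OF this] have big: "measure \<mu> (cb x s) > measure \<mu> UNIV / 2" by (simp add: k_def s_def dilate_def)
  have s: "s > 0" "l \<le> s" using l by (auto simp: s_def)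
  define p where "p = anc_side x \<rho>"
  have p: "doubling n \<mu> (x, p)" "\<rho> \<le> p" using anc_side[OF x, of \<rho>] l r by (auto simp: p_def)
  have pos: "D_full \<ge> 0" "p > 0" "l \<le> p" using D_full p r l by auto
  have TT: "c_large * D_full * 1 \<le> c_large * D_full * KK" using KK1 global_constants_pos pos by (intro mult_left_mono) auto
  have GG: "1 + G * G + G * (2 * (G * C0)) \<ge> 0" using G GC0 by simp
  show ?thesis
  proof (cases "p \<le> s")
    case True
    have "scale_sum x p (4 * s) \<le> scale_sum x l (4 * s)" using pos l s by (intro scale_sum_mono) auto
    also have "\<dots> \<le> scale_sum x l s + scale_sum x s (4 * s)" using pos l s by (intro scale_sum_subadd) auto
    also have "\<dots> \<le> G * KK + 2 * (G * C0)" using scale_sum_le_K_pair[of l "(x, s)" x] scale_sum_4[OF x s(1)] l s KK by simp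
    finally have "cmod (fQ (x, p) - fQ (x, s)) \<le> D * (1 + G * (G * KK + 2 * (G * C0)))"
      using True by (intro compare_scale_sum p large_doubling x s big cb_mono)
    also have "\<dots> \<le> D_full * ((1 + G * G + G * (2 * (G * C0))) * KK)"
    proof (intro mult_mono D_full)
      have "(1 + G * (2 * (G * C0))) * 1 \<le> (1 + G * (2 * (G * C0))) * KK" using KK1 G GC0 by (intro mult_left_mono) auto
      then show "1 + G * (G * KK + 2 * (G * C0)) \<le> (1 + G * G + G * (2 * (G * C0))) * KK" by (simp add: algebra_simps)
      have "0 \<le> G * KK + 2 * (G * C0)" using G KK1 GC0 by simp
      then show "0 \<le> 1 + G * (G * KK + 2 * (G * C0))" using G by simp
    qed (use D_full in auto)
    finally have 1: "cmod (fQ (x, p) - fQ (x, s)) \<le> D_full * ((1 + G * G + G * (2 * (G * C0))) * KK)" .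
    have "cmod (fQ (x, p)) \<le> cmod (fQ (x, p) - fQ (x, s)) + cmod (fQ (x, s))"
      using norm_triangle_ineq[of "fQ (x, p) - fQ (x, s)" "fQ (x, s)"] by simp
    also have "\<dots> \<le> D_full * ((1 + G * G + G * (2 * (G * C0))) * KK) + c_large * D_full * KK"
      using 1 large_cube_mean_bound[OF x s(1) big] TT by simp
    finally show ?thesis by (simp add: f_anc_def p_def[symmetric] KK_def[symmetric] c_top_def algebra_simps)
  next
    case False
    have "measure \<mu> (cb x s) \<le> measure \<mu> (cb x p)" using False by (intro measure_mono_cb cb_mono) auto
    then have "cmod (fQ (x, p)) \<le> c_large * D_full" using big by (intro large_cube_mean_bound x pos) auto
    also have "\<dots> \<le> c_large * D_full * KK" using TT by simp
    also have "\<dots> \<le> c_top * D_full * KK" using GG pos KK1 by (intro mult_right_mono) (auto simp: c_top_def)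
    finally show ?thesis by (simp add: f_anc_def p_def[symmetric] KK_def[symmetric])
  qed
qed

end

section \<open>Kernels and truncations\<close>

locale cz_growth = growth_measure \<mu> n C0 x0 L0
  for \<mu> :: "(real ^ 'm) measure" and n C0 :: real and x0 :: "real ^ 'm" and L0 :: real +
  fixes K :: "real ^ 'm \<Rightarrow> real ^ 'm \<Rightarrow> complex" and CK \<delta> :: real
  assumes K_meas: "(\<lambda>(x, y). K x y) \<in> borel_measurable (restrict_space borel {(x, y). x \<noteq> y})"
    and CK: "CK > 0" and \<delta>: "0 < \<delta>"
    and size: "\<And>x y. x \<noteq> y \<Longrightarrow> cmod (K x y) \<le> CK * dist x y powr (- n)"
    and regular: "\<And>x1 x2 y. x1 \<noteq> y \<Longrightarrow> 2 * dist x1 x2 \<le> dist x1 y \<Longrightarrow>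
           cmod (K x1 y - K x2 y) \<le> CK * (dist x1 x2 powr \<delta> / dist x1 y powr (n + \<delta>))"
    and cancel: "\<And>x r R. x \<in> supp \<mu> \<Longrightarrow> 0 < r \<Longrightarrow> r < R \<Longrightarrow>
           cmod (LINT y:cb x R - cb x r|\<mu>. K x y) \<le> CK"
begin

definition "K_trunc \<rho> x y = indicator (- cb x \<rho>) y *\<^sub>R K x y"

lemma K_trunc_measurable_pair:
  assumes "\<rho> > 0" shows "(\<lambda>p. K_trunc \<rho> (fst p) (snd p)) \<in> borel_measurable borel"
proof -
  have op: "{(x, y). x \<noteq> y} \<in> sets (borel :: ((real ^ 'm) \<times> (real ^ 'm)) measure)"
    using open_diagonal_complement[where 'a="real ^ 'm"] by (intro borel_open) (simp add: case_prod_unfold)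
  have 1: "(\<lambda>p. indicator {(x, y). x \<noteq> y} p *\<^sub>R K (fst p) (snd p)) \<in> borel_measurable borel"
    using K_meas op by (subst (asm) borel_measurable_restrict_space_iff) (auto simp: case_prod_unfold)
  have "closed {p :: (real ^ 'm) \<times> (real ^ 'm). \<forall>i. \<bar>snd p $ i - fst p $ i\<bar> \<le> \<rho> / 2}"
    by (intro closed_Collect_all closed_Collect_le continuous_intros)
  then have "open (- {p :: (real ^ 'm) \<times> (real ^ 'm). snd p \<in> cb (fst p) \<rho>})" by (simp add: mem_cb open_Compl)
  then have c: "- {p :: (real ^ 'm) \<times> (real ^ 'm). snd p \<in> cb (fst p) \<rho>} \<in> sets borel" by (rule borel_open)
  have 2: "(\<lambda>p. indicator (- {p. snd p \<in> cb (fst p) \<rho>}) p *\<^sub>R (indicator {(x, y). x \<noteq> y} p *\<^sub>R K (fst p) (snd p))) \<in> borel_measurable borel"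
    by (rule borel_measurable_scaleR[OF borel_measurable_indicator[OF c] 1])
  have "K_trunc \<rho> (fst p) (snd p) = indicator (- {p. snd p \<in> cb (fst p) \<rho>}) p *\<^sub>R (indicator {(x, y). x \<noteq> y} p *\<^sub>R K (fst p) (snd p))" for p
    using assms by (cases p) (auto simp: K_trunc_def indicator_def)
  then show ?thesis using 2 by simp
qed

lemma K_trunc_measurable: "\<rho> > 0 \<Longrightarrow> K_trunc \<rho> x \<in> borel_measurable borel"
proof -
  assume r: "\<rho> > 0"
  have "(\<lambda>y. (x, y)) \<in> borel \<rightarrow>\<^sub>M borel" by (intro borel_measurable_continuous_onI continuous_intros)
  from measurable_compose[OF this K_trunc_measurable_pair[OF r]] show ?thesis by simp
qed

lemma K_off_cube:
  assumes "y \<notin> cb x \<rho>" "\<rho> > 0" shows "cmod (K x y) \<le> CK * (\<rho> / 2) powr (- n)"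
proof -
  have d: "\<rho> / 2 < dist x y" by (rule not_in_cb_dist[OF assms(1)])
  then have "x \<noteq> y" using assms(2) by auto
  then have "cmod (K x y) \<le> CK * dist x y powr (- n)" by (rule size)
  also have "\<dots> \<le> CK * (\<rho> / 2) powr (- n)"
    using d assms(2) n_pos CK by (intro mult_left_mono powr_mono2') auto
  finally show ?thesis .
qed

lemma K_trunc_bound: "\<rho> > 0 \<Longrightarrow> cmod (K_trunc \<rho> x y) \<le> CK * (\<rho> / 2) powr (- n)"
  using K_off_cube[of y x \<rho>] CK by (auto simp: K_trunc_def indicator_def)

lemma truncation_eq_integral_K_trunc: "truncation \<mu> K \<rho> g x = (LINT y|\<mu>. K_trunc \<rho> x y * g y)"
  by (simp add: truncation_def set_lebesgue_integral_def K_trunc_def)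

lemma truncation_measurable:
  assumes "\<rho> > 0" and [measurable]: "g \<in> borel_measurable borel"
  shows "truncation \<mu> K \<rho> g \<in> borel_measurable borel"
proof -
  have eq: "sets (borel \<Otimes>\<^sub>M \<mu>) = sets (borel :: ((real ^ 'm) \<times> (real ^ 'm)) measure)"
  proof -
    have "sets (borel \<Otimes>\<^sub>M \<mu>) = sets ((borel :: (real ^ 'm) measure) \<Otimes>\<^sub>M (borel :: (real ^ 'm) measure))"
      by (rule sets_pair_measure_cong[OF refl sets_mu])
    also have "\<dots> = sets (borel :: ((real ^ 'm) \<times> (real ^ 'm)) measure)" by (rule arg_cong[OF borel_prod])
    finally show ?thesis .
  qed
  have "(\<lambda>p. K_trunc \<rho> (fst p) (snd p) * g (snd p)) \<in> borel_measurable (borel :: ((real ^ 'm) \<times> (real ^ 'm)) measure)"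
  proof (intro borel_measurable_times K_trunc_measurable_pair assms)
    have "(snd :: (real ^ 'm) \<times> (real ^ 'm) \<Rightarrow> real ^ 'm) \<in> borel \<rightarrow>\<^sub>M borel" by (intro borel_measurable_continuous_onI continuous_intros)
    from measurable_compose[OF this assms(2)] show "(\<lambda>p. g (snd p)) \<in> borel_measurable (borel :: ((real ^ 'm) \<times> (real ^ 'm)) measure)" .
  qed
  then have "case_prod (\<lambda>x y. K_trunc \<rho> x y * g y) \<in> borel_measurable (borel \<Otimes>\<^sub>M \<mu>)"
    by (simp add: case_prod_unfold measurable_cong_sets[OF eq refl])
  then have "(\<lambda>x. LINT y|\<mu>. K_trunc \<rho> x y * g y) \<in> borel_measurable borel" by (rule borel_measurable_lebesgue_integral)
  then show ?thesis by (simp add: truncation_eq_integral_K_trunc[abs_def])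
qed

lemma bounded_mult_integrable:
  fixes g \<kappa> :: "real ^ 'm \<Rightarrow> complex"
  assumes "integrable \<mu> g" "\<kappa> \<in> borel_measurable borel" "\<And>y. cmod (\<kappa> y) \<le> B"
  shows "integrable \<mu> (\<lambda>y. \<kappa> y * g y)"
proof (rule Bochner_Integration.integrable_bound)
  show "integrable \<mu> (\<lambda>y. B * cmod (g y))" using assms(1) by simp
  have "g \<in> borel_measurable \<mu>" using assms(1) by simp
  then show "(\<lambda>y. \<kappa> y * g y) \<in> borel_measurable \<mu>" using assms(2) by simp
  have "cmod (\<kappa> y) * cmod (g y) \<le> B * cmod (g y)" for y using assms(3) by (intro mult_right_mono) auto
  then show "AE y in \<mu>. norm (\<kappa> y * g y) \<le> norm (B * cmod (g y))"
    by (intro AE_I2) (simp add: norm_mult, metis abs_ge_self abs_mult abs_norm_cancel order_trans)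
qed

text \<open>
  The cancellation condition passes to the limit of infinite outer radius, since the truncated
  kernel is bounded and the measure is finite.
\<close>

lemma truncation_one_bound:
  assumes x: "x \<in> supp \<mu>" and r: "\<rho> > 0"
  shows "cmod (truncation \<mu> K \<rho> (\<lambda>_. 1) x) \<le> CK"
proof -
  define s where "s k y = indicator (cb x (\<rho> + 1 + real k) - cb x \<rho>) y *\<^sub>R K x y" for k y
  have s: "s k y = indicator (cb x (\<rho> + 1 + real k)) y *\<^sub>R K_trunc \<rho> x y" for k y by (auto simp: s_def K_trunc_def indicator_def)
  have "(\<lambda>k. LINT y|\<mu>. s k y) \<longlonglongrightarrow> (LINT y|\<mu>. K_trunc \<rho> x y)"
  proof (rule integral_dominated_convergence)
    show "K_trunc \<rho> x \<in> borel_measurable \<mu>" using K_trunc_measurable[OF r] by simp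
    show "s k \<in> borel_measurable \<mu>" for k unfolding s[abs_def] using K_trunc_measurable[OF r] by simp
    show "integrable \<mu> (\<lambda>_. CK * (\<rho> / 2) powr (- n))" by (rule finite_measure.integrable_const[OF fin_mu])
    show "AE y in \<mu>. norm (s k y) \<le> CK * (\<rho> / 2) powr (- n)" for k
      using K_trunc_bound[OF r] CK unfolding s by (intro AE_I2) (auto simp: indicator_def)
    show "AE y in \<mu>. (\<lambda>k. s k y) \<longlonglongrightarrow> K_trunc \<rho> x y"
    proof (rule AE_I2)
      fix y
      obtain k0 :: nat where k0: "2 * dist x y < real k0" using reals_Archimedean2 by blast
      have "y \<in> cb x (\<rho> + 1 + real k)" if "k \<ge> k0" for k
        unfolding mem_cb
      proof
        fix i
        have "\<bar>y $ i - x $ i\<bar> \<le> dist x y" using component_le_norm_cart[of "y - x" i] by (simp add: dist_norm norm_minus_commute)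
        also have "\<dots> \<le> (\<rho> + 1 + real k) / 2" using k0 that r by simp
        finally show "\<bar>y $ i - x $ i\<bar> \<le> (\<rho> + 1 + real k) / 2" .
      qed
      then have "\<forall>\<^sub>F k in sequentially. s k y = K_trunc \<rho> x y" unfolding eventually_sequentially s by (intro exI[of _ k0]) simp
      then show "(\<lambda>k. s k y) \<longlonglongrightarrow> K_trunc \<rho> x y" by (rule tendsto_eventually)
    qed
  qed
  then have "(\<lambda>k. cmod (LINT y|\<mu>. s k y)) \<longlonglongrightarrow> cmod (LINT y|\<mu>. K_trunc \<rho> x y)" by (rule tendsto_norm)
  moreover have "cmod (LINT y|\<mu>. s k y) \<le> CK" for k
    using cancel[OF x r, of "\<rho> + 1 + real k"] by (simp add: s_def set_lebesgue_integral_def)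
  ultimately have "cmod (LINT y|\<mu>. K_trunc \<rho> x y) \<le> CK" by (intro LIMSEQ_le_const2) auto
  then show ?thesis by (simp add: truncation_eq_integral_K_trunc)
qed

text \<open>
  Bounds for the oscillation on dilated cubes and for the perturbation of the kernel.  The exponent
  \<open>CARD('m)\<close> of two marks where the smoothness of the kernel starts to apply: a cube of side
  s has diameter at most m s, and m < 2^m.
\<close>

definition "c_dil = C0 * (c_osc * G + c_conc * (1 + G * C0))"
definition "c_pert = 2 * CK * (4 powr n) * (c_dil * (1 + real CARD('m)) * (2 ^ CARD('m)) powr n) +
   CK * c_dil * (real CARD('m) / 4) powr \<delta> * 2 powr (n + \<delta>) * G * (2 / (1 - 2 powr (- \<delta>))\<^sup>2)"

lemma c_dil: "c_dil > 0" using C0 constants_pos G GC0 by (simp add: c_dil_def add_pos_pos)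

lemma c_pert: "c_pert \<ge> 0" using c_dil CK G by (simp add: c_pert_def)

end

locale cz_rbmo = cz_growth \<mu> n C0 x0 L0 K CK \<delta> + rbmo_function \<mu> n C0 x0 L0 f fQ D
  for \<mu> :: "(real ^ 'm) measure" and n C0 :: real and x0 :: "real ^ 'm" and L0 :: real
    and K :: "real ^ 'm \<Rightarrow> real ^ 'm \<Rightarrow> complex" and CK \<delta> :: real
    and f :: "real ^ 'm \<Rightarrow> complex" and fQ :: "(real ^ 'm) cube \<Rightarrow> complex" and D :: real
begin

text \<open>
  Each doubling of the side changes the number of the cube by a bounded amount, hence the factor
  \<open>1 + real k\<close>.
\<close>

lemma oscillation_dilated:
  assumes x: "x \<in> supp \<mu>" and r: "\<rho> > 0"
  shows "dev x (2 ^ k * \<rho>) (f_anc x \<rho>) \<le> c_dil * D * (1 + real k) * (2 ^ k * \<rho>) powr n"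
proof -
  define s where "s = 2 ^ k * \<rho>"
  have s: "s > 0" using r by (simp add: s_def)
  have rs: "\<rho> \<le> s" using r by (simp add: s_def)
  have "measure \<mu> (cb x (5 / 4 * s)) \<le> measure \<mu> (cb x (2 * s))" using s by (intro measure_mono_cb cb_mono) auto
  also have "\<dots> \<le> C0 * (2 * s) powr n" using s by (intro growth x) auto
  also have "(2 * s) powr n = G * s powr n" using s by (simp add: powr_mult G_def)
  finally have m1: "measure \<mu> (cb x (5 / 4 * s)) \<le> C0 * (G * s powr n)" .
  have m2: "measure \<mu> (cb x s) \<le> C0 * s powr n" using s by (intro growth x) auto
  have t: "1 + scale_sum x \<rho> s \<le> (1 + G * C0) * (1 + real k)"
    using scale_sum_const[OF x r, of k] GC0 by (simp add: s_def algebra_simps)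
  have "cmod (f_anc x s - f_anc x \<rho>) \<le> c_conc * D * (1 + scale_sum x \<rho> s)" using f_anc_concentric[OF x r rs] by (simp add: norm_minus_commute)
  also have "\<dots> \<le> c_conc * D * ((1 + G * C0) * (1 + real k))" using t constants_pos D by (intro mult_left_mono) auto
  finally have d: "cmod (f_anc x s - f_anc x \<rho>) \<le> c_conc * D * ((1 + G * C0) * (1 + real k))" .
  have "dev x s (f_anc x \<rho>) \<le> dev x s (f_anc x s) + cmod (f_anc x s - f_anc x \<rho>) * measure \<mu> (cb x s)" by (rule dev_change)
  also have "\<dots> \<le> c_osc * D * (C0 * (G * s powr n)) + c_conc * D * ((1 + G * C0) * (1 + real k)) * (C0 * s powr n)"
  proof (intro add_mono mult_mono d m2)
    have "dev x s (f_anc x s) \<le> c_osc * D * measure \<mu> (cb x (5 / 4 * s))" by (rule oscillation_any_cube[OF x s])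
    also have "\<dots> \<le> c_osc * D * (C0 * (G * s powr n))" using constants_pos D m1 by (intro mult_left_mono) auto
    finally show "dev x s (f_anc x s) \<le> c_osc * D * (C0 * (G * s powr n))" .
  qed (use constants_pos D GC0 in auto)
  also have "\<dots> \<le> c_osc * D * (C0 * (G * s powr n)) * (1 + real k) + c_conc * D * ((1 + G * C0) * (1 + real k)) * (C0 * s powr n)"
  proof -
    have "c_osc * D * (C0 * (G * s powr n)) * 1 \<le> c_osc * D * (C0 * (G * s powr n)) * (1 + real k)"
      using constants_pos D C0 G by (intro mult_left_mono) auto
    then show ?thesis by simp
  qed
  also have "\<dots> = c_dil * D * (1 + real k) * s powr n" by (simp add: c_dil_def algebra_simps)
  finally show ?thesis by (simp add: s_def)
qed

lemma f_minus_integrable_global: "integrable \<mu> (\<lambda>y. f y - a)"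
  using f_integrable by simp

lemma regular_far:
  assumes d: "\<And>i. \<bar>x $ i - x' $ i\<bar> \<le> \<rho> / 4" and r: "\<rho> > 0" and k: "CARD('m) \<le> k"
    and y: "y \<notin> cb x (2 ^ k * \<rho>)"
  shows "cmod (K x y - K x' y) \<le> CK * ((real CARD('m) / 4) powr \<delta> * \<rho> powr \<delta> * (2 powr (n + \<delta>) * (2 ^ k * \<rho>) powr (- (n + \<delta>))))"
proof -
  define m where "m = real CARD('m)"
  have m: "m \<ge> 1" by (simp add: m_def Suc_leI)
  define u where "u = 2 ^ k * \<rho> / 2"
  have u: "u > 0" using r by (simp add: u_def)
  have dy: "u < dist x y" using not_in_cb_dist[OF y] by (simp add: u_def)
  have "x' \<in> cb x (\<rho> / 2)" using d by (simp add: mem_cb abs_minus_commute)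
  then have "dist x x' \<le> m * (\<rho> / 2 / 2)" unfolding m_def by (rule dist_le_cb)
  then have dx: "dist x x' \<le> m / 4 * \<rho>" by simp
  have "m < 2 ^ CARD('m)" unfolding m_def by (rule of_nat_less_two_power)
  also have "(2::real) ^ CARD('m) \<le> 2 ^ k" using k by (intro power_increasing) auto
  finally have "m / 4 * \<rho> * 2 \<le> u" using r by (simp add: u_def)
  then have 2: "2 * dist x x' \<le> dist x y" using dx dy by linarith
  have "x \<noteq> y" using dy u by auto
  then have "cmod (K x y - K x' y) \<le> CK * (dist x x' powr \<delta> / dist x y powr (n + \<delta>))" using 2 by (rule regular)
  also have "\<dots> \<le> CK * ((m / 4 * \<rho>) powr \<delta> / u powr (n + \<delta>))"
    using dx dy u \<delta> n_pos CK by (intro mult_left_mono frac_le powr_mono2) auto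
  also have "(m / 4 * \<rho>) powr \<delta> = (m / 4) powr \<delta> * \<rho> powr \<delta>" using m r by (simp only: powr_mult)
  also have "u powr (n + \<delta>) = (2 ^ k * \<rho>) powr (n + \<delta>) / 2 powr (n + \<delta>)" using r by (simp add: u_def powr_divide)
  finally show ?thesis unfolding powr_minus_divide m_def by simp
qed

text \<open>
  Two bounded kernels that agree far away with the given one, at nearby points, act almost equally
  on f - a.  The near part is bounded by size alone.  In the far part the smoothness gains
  2^(-k\<delta>) on the k-th shell, which dominates the linear growth in \<open>k\<close> of the oscillation.
  The kernels are arbitrary near x, since the lemma is applied to truncations at different
  scales and to kernels with 2Q removed.
\<close>

lemma kernel_perturbation:
  assumes x: "x \<in> supp \<mu>" and r: "\<rho> > 0" and d: "\<And>i. \<bar>x $ i - x' $ i\<bar> \<le> \<rho> / 4"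
    and m: "\<kappa> \<in> borel_measurable borel" "\<kappa>' \<in> borel_measurable borel"
    and b: "\<And>y. cmod (\<kappa> y) \<le> CK * (\<rho> / 4) powr (- n)" "\<And>y. cmod (\<kappa>' y) \<le> CK * (\<rho> / 4) powr (- n)"
    and far: "\<And>y. y \<notin> cb x (2 ^ CARD('m) * \<rho>) \<Longrightarrow> \<kappa> y = K x y \<and> \<kappa>' y = K x' y"
  shows "cmod ((LINT y|\<mu>. \<kappa> y * (f y - f_anc x \<rho>)) - (LINT y|\<mu>. \<kappa>' y * (f y - f_anc x \<rho>))) \<le> c_pert * D"
proof -
  note m[measurable]
  define p where "p = CARD('m)"
  define a where "a = f_anc x \<rho>"
  define B where "B = 2 * CK * (\<rho> / 4) powr (- n)"
  have B: "B \<ge> 0" using CK by (simp add: B_def)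
  \<comment> \<open>The smoothness bound on the shell between \<open>2 ^ k * \<rho>\<close> and \<open>2 ^ Suc k * \<rho>\<close>.\<close>
  define q where "q k = CK * ((real CARD('m) / 4) powr \<delta> * \<rho> powr \<delta> * (2 powr (n + \<delta>) * (2 ^ k * \<rho>) powr (- (n + \<delta>))))" for k
  have q: "q k \<ge> 0" for k using CK by (simp add: q_def)
  define z where "z = 2 powr (- \<delta>)"
  have z: "0 < z" "z < 1" using \<delta> by (auto simp: z_def powr_less_one)
  have pt: "ennreal (cmod ((\<kappa> y - \<kappa>' y) * (f y - a))) \<le> ennreal B * (ennreal (cmod (f y - a)) * indicator (cb x (2 ^ p * \<rho>)) y)
     + (\<Sum>k. ennreal (q k) * (ennreal (cmod (f y - a)) * indicator (cb x (2 ^ Suc k * \<rho>)) y))" for y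
  proof (cases "y \<in> cb x (2 ^ p * \<rho>)")
    case True
    have "cmod (\<kappa> y - \<kappa>' y) \<le> B" using b[of y] norm_triangle_ineq4[of "\<kappa> y" "\<kappa>' y"] by (simp add: B_def)
    then have "cmod ((\<kappa> y - \<kappa>' y) * (f y - a)) \<le> B * cmod (f y - a)" by (simp add: norm_mult mult_right_mono)
    then have "ennreal (cmod ((\<kappa> y - \<kappa>' y) * (f y - a))) \<le> ennreal B * ennreal (cmod (f y - a))"
      using B by (simp add: ennreal_mult[symmetric] ennreal_leI)
    then show ?thesis using True by (simp add: add_increasing2)
  next
    case False
    define j where "j = (LEAST j. y \<in> cb x (2 ^ j * \<rho>))"
    have "\<exists>j. y \<in> cb x (2 ^ j * \<rho>)" by (rule in_large_cube[OF r])
    then have j: "y \<in> cb x (2 ^ j * \<rho>)" unfolding j_def by (rule LeastI_ex)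
    have "p < j"
    proof (rule ccontr)
      assume "\<not> p < j"
      then have "2 ^ j * \<rho> \<le> 2 ^ p * \<rho>" using r by (intro mult_right_mono power_increasing) auto
      then show False using j False cb_mono by blast
    qed
    then obtain k where k: "j = Suc k" "p \<le> k" by (cases j) auto
    then have nk: "y \<notin> cb x (2 ^ k * \<rho>)" using not_less_Least[of k "\<lambda>j. y \<in> cb x (2 ^ j * \<rho>)"] by (simp add: j_def)
    have "cmod (\<kappa> y - \<kappa>' y) \<le> q k" using far[of y] False regular_far[OF d r _ nk] k(2) by (simp add: q_def p_def)
    then have "cmod ((\<kappa> y - \<kappa>' y) * (f y - a)) \<le> q k * cmod (f y - a)" by (simp add: norm_mult mult_right_mono)
    then have "ennreal (cmod ((\<kappa> y - \<kappa>' y) * (f y - a))) \<le> ennreal (q k) * ennreal (cmod (f y - a))"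
      using q by (simp add: ennreal_mult[symmetric] ennreal_leI)
    also have "\<dots> = (\<Sum>i\<in>{k}. ennreal (q i) * (ennreal (cmod (f y - a)) * indicator (cb x (2 ^ Suc i * \<rho>)) y))"
      using j k by simp
    also have "\<dots> \<le> (\<Sum>k. ennreal (q k) * (ennreal (cmod (f y - a)) * indicator (cb x (2 ^ Suc k * \<rho>)) y))"
      by (rule sum_le_suminf) auto
    finally show ?thesis using False by simp
  qed
  have near: "B * dev x (2 ^ p * \<rho>) a \<le> 2 * CK * (4 powr n) * (c_dil * (1 + real CARD('m)) * (2 ^ CARD('m)) powr n) * D"
  proof -
    have "B * dev x (2 ^ p * \<rho>) a \<le> B * (c_dil * D * (1 + real p) * (2 ^ p * \<rho>) powr n)"
      unfolding a_def by (intro mult_left_mono oscillation_dilated x r B)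
    also have "(2 ^ p * \<rho>) powr n = (2 ^ p) powr n * \<rho> powr n" using r by (simp add: powr_mult)
    also have "(\<rho> / 4) powr (- n) = 4 powr n / \<rho> powr n" using r by (simp add: powr_minus powr_divide)
    then have "B * (c_dil * D * (1 + real p) * ((2 ^ p) powr n * \<rho> powr n)) = 2 * CK * (4 powr n) * (c_dil * (1 + real p) * (2 ^ p) powr n) * D"
      using r by (simp add: B_def)
    finally show ?thesis by (simp add: p_def)
  qed
  define w where "w = CK * c_dil * (real CARD('m) / 4) powr \<delta> * 2 powr (n + \<delta>) * G * D"
  have w: "w \<ge> 0" using CK c_dil D G by (simp add: w_def)
  have shell: "q k * dev x (2 ^ Suc k * \<rho>) a \<le> w * (2 * (real (Suc k) * z ^ k))" for k
  proof -
    have "q k * dev x (2 ^ Suc k * \<rho>) a \<le> q k * (c_dil * D * (1 + real (Suc k)) * (2 ^ Suc k * \<rho>) powr n)"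
      unfolding a_def by (intro mult_left_mono oscillation_dilated x r q)
    also have "(2 ^ Suc k * \<rho>) powr n = G * (2 ^ k * \<rho>) powr n" using r by (simp add: G_def powr_mult mult.assoc)
    also have "q k * (c_dil * D * (1 + real (Suc k)) * (G * (2 ^ k * \<rho>) powr n))
        = w * (1 + real (Suc k)) * (\<rho> powr \<delta> * ((2 ^ k * \<rho>) powr (- (n + \<delta>)) * (2 ^ k * \<rho>) powr n))"
      by (simp add: q_def w_def mult_ac)
    also have "(2 ^ k * \<rho>) powr (- (n + \<delta>)) * (2 ^ k * \<rho>) powr n = (2 ^ k * \<rho>) powr (- \<delta>)"
      by (simp add: powr_add[symmetric])
    also have "(2 ^ k * \<rho>) powr (- \<delta>) = (2 ^ k) powr (- \<delta>) * \<rho> powr (- \<delta>)" using r by (simp add: powr_mult)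
    also have "(2 ^ k) powr (- \<delta>) = z ^ k"
    proof -
      have "(2 ^ k) powr (- \<delta>) = (2 powr real k) powr (- \<delta>)" by (simp add: powr_realpow)
      also have "\<dots> = (2 powr (- \<delta>)) powr real k" by (simp add: powr_powr mult.commute)
      also have "\<dots> = z ^ k" by (simp add: powr_realpow z_def)
      finally show ?thesis .
    qed
    also have "\<rho> powr \<delta> * (z ^ k * \<rho> powr (- \<delta>)) = z ^ k" using r by (simp add: powr_minus)
    also have "w * (1 + real (Suc k)) * z ^ k \<le> w * (2 * real (Suc k)) * z ^ k"
      using w z by (intro mult_right_mono mult_left_mono) auto
    finally show ?thesis by (simp only: mult.assoc)
  qed
  have sums: "(\<lambda>k. w * (2 * (real (Suc k) * z ^ k))) sums (w * (2 * (1 / (1 - z)\<^sup>2)))"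
    using geometric_deriv_sums[of z] z by (intro sums_mult) auto
  have "(\<integral>\<^sup>+y. ennreal (cmod ((\<kappa> y - \<kappa>' y) * (f y - a))) \<partial>\<mu>)
    \<le> (\<integral>\<^sup>+y. ennreal B * (ennreal (cmod (f y - a)) * indicator (cb x (2 ^ p * \<rho>)) y)
     + (\<Sum>k. ennreal (q k) * (ennreal (cmod (f y - a)) * indicator (cb x (2 ^ Suc k * \<rho>)) y)) \<partial>\<mu>)"
    by (intro nn_integral_mono pt)
  also have "\<dots> = ennreal B * (\<integral>\<^sup>+y. ennreal (cmod (f y - a)) * indicator (cb x (2 ^ p * \<rho>)) y \<partial>\<mu>)
     + (\<Sum>k. ennreal (q k) * (\<integral>\<^sup>+y. ennreal (cmod (f y - a)) * indicator (cb x (2 ^ Suc k * \<rho>)) y \<partial>\<mu>))"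
    by (subst nn_integral_add) (auto simp: nn_integral_cmult nn_integral_suminf)
  also have "\<dots> = ennreal (B * dev x (2 ^ p * \<rho>) a) + (\<Sum>k. ennreal (q k * dev x (2 ^ Suc k * \<rho>) a))"
    using B q dev_nonneg by (simp add: dev_nn ennreal_mult del: power_Suc)
  also have "\<dots> \<le> ennreal (2 * CK * (4 powr n) * (c_dil * (1 + real CARD('m)) * (2 ^ CARD('m)) powr n) * D) + (\<Sum>k. ennreal (w * (2 * (real (Suc k) * z ^ k))))"
    by (intro add_mono suminf_le ennreal_leI near shell) auto
  also have "(\<Sum>k. ennreal (w * (2 * (real (Suc k) * z ^ k)))) = ennreal (w * (2 * (1 / (1 - z)\<^sup>2)))"
    by (rule suminf_ennreal_eq[OF _ sums]) (use w z in auto)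
  also have "ennreal (2 * CK * (4 powr n) * (c_dil * (1 + real CARD('m)) * (2 ^ CARD('m)) powr n) * D) + ennreal (w * (2 * (1 / (1 - z)\<^sup>2)))
      = ennreal (2 * CK * (4 powr n) * (c_dil * (1 + real CARD('m)) * (2 ^ CARD('m)) powr n) * D + w * (2 * (1 / (1 - z)\<^sup>2)))"
    using w CK c_dil D by (intro ennreal_plus[symmetric]) auto
  also have "2 * CK * (4 powr n) * (c_dil * (1 + real CARD('m)) * (2 ^ CARD('m)) powr n) * D + w * (2 * (1 / (1 - z)\<^sup>2)) = c_pert * D"
    by (simp add: c_pert_def w_def z_def algebra_simps)
  finally have fin: "(\<integral>\<^sup>+y. ennreal (cmod ((\<kappa> y - \<kappa>' y) * (f y - a))) \<partial>\<mu>) \<le> ennreal (c_pert * D)" .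
  have i: "integrable \<mu> (\<lambda>y. \<kappa> y * (f y - a))" "integrable \<mu> (\<lambda>y. \<kappa>' y * (f y - a))"
    by (rule bounded_mult_integrable[OF f_minus_integrable_global m(1) b(1)], rule bounded_mult_integrable[OF f_minus_integrable_global m(2) b(2)])
  have "(LINT y|\<mu>. \<kappa> y * (f y - a)) - (LINT y|\<mu>. \<kappa>' y * (f y - a)) = (LINT y|\<mu>. (\<kappa> y - \<kappa>' y) * (f y - a))"
    using i by (subst Bochner_Integration.integral_diff[symmetric]) (auto simp: algebra_simps)
  moreover have "integrable \<mu> (\<lambda>y. (\<kappa> y - \<kappa>' y) * (f y - a))"
    using Bochner_Integration.integrable_diff[OF i] by (simp add: algebra_simps)
  ultimately have "ennreal (cmod ((LINT y|\<mu>. \<kappa> y * (f y - a)) - (LINT y|\<mu>. \<kappa>' y * (f y - a)))) \<le> ennreal (c_pert * D)"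
    using integral_norm_bound_ennreal[of \<mu> "\<lambda>y. (\<kappa> y - \<kappa>' y) * (f y - a)"] fin by simp
  then show ?thesis using c_pert D unfolding a_def by (subst (asm) ennreal_le_iff) auto
qed

end

section \<open>Central values\<close>

text \<open>
  A chain of scales with a quadratic bound in the additive quantity \<open>\<theta>\<close> is cut into blocks with \<open>\<theta>\<close>
  between \<open>1\<close> and \<open>1 + W\<close>.  On each block the bound is a constant, and the number of blocks is at most
  the value of \<open>\<theta>\<close> on the whole chain.
\<close>

lemma chain_linear:
  fixes u :: "nat \<Rightarrow> 'a :: real_normed_vector" and \<theta> :: "nat \<Rightarrow> nat \<Rightarrow> real"
  assumes add: "\<And>i j k. i \<le> j \<Longrightarrow> j \<le> k \<Longrightarrow> \<theta> i k = \<theta> i j + \<theta> j k" and nn: "\<And>i j. 0 \<le> \<theta> i j"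
    and step: "\<And>i. \<theta> i (Suc i) \<le> W" and B: "B \<ge> 0"
    and quad: "\<And>i j. i \<le> j \<Longrightarrow> norm (u i - u j) \<le> B * (1 + \<theta> i j)\<^sup>2"
  shows "i \<le> j \<Longrightarrow> norm (u i - u j) \<le> B * (2 + W)\<^sup>2 * (1 + \<theta> i j)"
proof (induction "j - i" arbitrary: i rule: less_induct)
  case less
  have W: "W \<ge> 0" using nn[of 0 1] step[of 0] by simp
  define E where "E = B * (2 + W)\<^sup>2"
  have E: "E \<ge> 0" using B by (simp add: E_def)
  have short: "norm (u i - u k) \<le> E" if "i \<le> k" "\<theta> i k \<le> 1 + W" for k
  proof -
    have "norm (u i - u k) \<le> B * (1 + \<theta> i k)\<^sup>2" by (rule quad[OF that(1)])
    also have "\<dots> \<le> E" unfolding E_def using that(2) nn[of i k] B by (intro mult_left_mono power_mono) auto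
    finally show ?thesis .
  qed
  show ?case
  proof (cases "\<theta> i j \<le> 1 + W")
    case True
    have "E * 1 \<le> E * (1 + \<theta> i j)" using E nn by (intro mult_left_mono) auto
    then show ?thesis using short[OF less.prems True] unfolding E_def by simp
  next
    case False
    \<comment> \<open>The first block: its weight exceeds one, which pays for the constant bound on it.\<close>
    define k where "k = (LEAST k. i \<le> k \<and> \<theta> i k > 1)"
    have ex: "i \<le> j \<and> \<theta> i j > 1" using False W less.prems by auto
    have k: "i \<le> k" "\<theta> i k > 1" using LeastI[where P="\<lambda>k. i \<le> k \<and> \<theta> i k > 1", OF ex] by (auto simp: k_def)
    have kj: "k \<le> j" unfolding k_def using ex by (rule Least_le)
    have "\<theta> i i = 0" using add[of i i i] by simp
    then have "i < k" using k by (cases "i = k") auto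
    then obtain k' where k': "k = Suc k'" "i \<le> k'" by (cases k) auto
    then have "\<not> (i \<le> k' \<and> \<theta> i k' > 1)" using not_less_Least[of k' "\<lambda>k. i \<le> k \<and> \<theta> i k > 1"] by (simp add: k_def)
    then have "\<theta> i k \<le> 1 + W" using add[of i k' k] k' step[of k'] by simp
    then have "norm (u i - u k) \<le> E" using k by (intro short) auto
    moreover have "norm (u k - u j) \<le> E * (1 + \<theta> k j)" unfolding E_def using \<open>i < k\<close> kj by (intro less.hyps) auto
    moreover have "norm (u i - u j) \<le> norm (u i - u k) + norm (u k - u j)" using norm_triangle_ineq[of "u i - u k" "u k - u j"] by simp
    ultimately have "norm (u i - u j) \<le> E * (2 + \<theta> k j)" by (simp add: algebra_simps)
    also have "\<dots> \<le> E * (1 + \<theta> i j)" using add[of i k j] k kj E by (intro mult_left_mono) auto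
    finally show ?thesis by (simp add: E_def)
  qed
qed

lemma norm_add_le_of_eq:
  fixes u :: "'a :: real_normed_vector"
  assumes "z = u + v" "norm u \<le> S" shows "norm z \<le> S + norm v"
  using norm_triangle_ineq[of u v] assms by simp

lemma dyadic_above:
  assumes "0 < \<rho>" "\<rho> \<le> \<rho>'"
  shows "\<exists>N::nat. \<rho>' \<le> 2 ^ N * \<rho> \<and> 2 ^ N * \<rho> \<le> 2 * (\<rho>' :: real)"
proof -
  obtain k :: nat where "\<rho>' / \<rho> < 2 ^ k" using real_arch_pow[of 2 "\<rho>' / \<rho>"] by auto
  then have ex: "\<rho>' \<le> 2 ^ k * \<rho>" using assms by (simp add: field_simps)
  define N where "N = (LEAST N. \<rho>' \<le> 2 ^ N * \<rho>)"
  have N: "\<rho>' \<le> 2 ^ N * \<rho>" unfolding N_def using ex by (rule LeastI)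
  have "2 ^ N * \<rho> \<le> 2 * \<rho>'"
  proof (cases N)
    case 0 then show ?thesis using assms by simp
  next
    case (Suc N')
    then have "\<not> \<rho>' \<le> 2 ^ N' * \<rho>" using not_less_Least[of N' "\<lambda>N. \<rho>' \<le> 2 ^ N * \<rho>"] by (simp add: N_def)
    then show ?thesis by (simp add: Suc)
  qed
  then show ?thesis using N by blast
qed

context cz_growth begin

text \<open>
  Bounds for the change of the central values: quadratic and linear for concentric cubes, and
  for shifted cubes.
\<close>

definition "c_quad = CK * (G * G * G) * (c_osc + c_conc) * (1 + G * C0) * (G * (1 + 3 * (G * C0))) + CK * c_conc"
definition "c_cen = c_quad * (2 + G * C0)\<^sup>2 * (1 + G * C0) + c_quad * (1 + G * C0)\<^sup>2"
definition "c_cen_rec = c_pert + c_rec * CK"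

lemma c_quad: "c_quad \<ge> 0"
proof -
  have "CK * (G * G * G) * (c_osc + c_conc) * (1 + G * C0) * (G * (1 + 3 * (G * C0))) \<ge> 0"
    using CK G constants_pos GC0 by (intro mult_nonneg_nonneg) auto
  then show ?thesis using CK constants_pos by (simp add: c_quad_def)
qed

lemma c_cen: "c_cen \<ge> 0" using c_quad GC0 by (simp add: c_cen_def)

lemma c_cen_rec: "c_cen_rec \<ge> 0" using c_pert constants_pos CK by (simp add: c_cen_rec_def)

end

context cz_rbmo begin

text \<open>
  The contribution of f - f_x(\<rho>) away from Q(x,\<rho>), at the center.
\<close>

definition "center_value x \<rho> = truncation \<mu> K \<rho> (\<lambda>y. f y - f_anc x \<rho>) x"

lemma K_trunc_integrable: "\<rho> > 0 \<Longrightarrow> integrable \<mu> g \<Longrightarrow> integrable \<mu> (\<lambda>y. K_trunc \<rho> x y * g y)"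
  by (rule bounded_mult_integrable[OF _ K_trunc_measurable K_trunc_bound])

lemma truncation_change_constant:
  assumes "\<rho> > 0"
  shows "truncation \<mu> K \<rho> (\<lambda>y. f y - b) x = truncation \<mu> K \<rho> (\<lambda>y. f y - a) x + (a - b) * truncation \<mu> K \<rho> (\<lambda>_. 1) x"
proof -
  have "truncation \<mu> K \<rho> (\<lambda>y. f y - b) x = (LINT y|\<mu>. K_trunc \<rho> x y * (f y - a) + (a - b) * (K_trunc \<rho> x y * 1))"
    unfolding truncation_eq_integral_K_trunc by (rule arg_cong[where f="lebesgue_integral \<mu>"]) (simp add: algebra_simps fun_eq_iff)
  also have "\<dots> = (LINT y|\<mu>. K_trunc \<rho> x y * (f y - a)) + (LINT y|\<mu>. (a - b) * (K_trunc \<rho> x y * 1))"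
    using assms by (intro Bochner_Integration.integral_add integrable_mult_right K_trunc_integrable f_minus_integrable_global integrable_const)
  finally show ?thesis by (simp add: truncation_eq_integral_K_trunc)
qed

text \<open>
  On the shell of side s the mean of |f - f_x(\<rho>)| is of order 1 + K, and the shells have total
  weight of order K.  The change of the number from scale \<rho> to \<rho>' acts on the truncation of
  the constant one, which is bounded.
\<close>

lemma center_value_quadratic:
  assumes x: "x \<in> supp \<mu>" and r: "0 < \<rho>" "\<rho> \<le> \<rho>'"
  shows "cmod (center_value x \<rho> - center_value x \<rho>') \<le> c_quad * D * (1 + scale_sum x \<rho> \<rho>')\<^sup>2"
proof -
  define a where "a = f_anc x \<rho>"
  define t where "t = scale_sum x \<rho> \<rho>'"
  have t0: "t \<ge> 0" by (simp add: t_def scale_sum_nonneg)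
  have r': "\<rho>' > 0" using r by simp
  obtain N :: nat where N: "\<rho>' \<le> 2 ^ N * \<rho>" "2 ^ N * \<rho> \<le> 2 * \<rho>'" using dyadic_above[OF r] by blast
  define q where "q k = CK * (2 ^ k * \<rho> / 2) powr (- n)" for k :: nat
  have q: "q k \<ge> 0" for k using CK by (simp add: q_def)
  have pt: "ennreal (cmod ((K_trunc \<rho> x y - K_trunc \<rho>' x y) * (f y - a))) \<le> (\<Sum>k<N. ennreal (q k) * (ennreal (cmod (f y - a)) * indicator (cb x (2 ^ Suc k * \<rho>)) y))" for y
  proof (cases "y \<in> cb x \<rho>' \<and> y \<notin> cb x \<rho>")
    case False
    then have "K_trunc \<rho> x y - K_trunc \<rho>' x y = 0" using cb_mono[OF r(2), of x] by (auto simp: K_trunc_def indicator_def)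
    then show ?thesis by simp
  next
    case True
    define j where "j = (LEAST j. y \<in> cb x (2 ^ j * \<rho>))"
    have yN: "y \<in> cb x (2 ^ N * \<rho>)" using True cb_mono[OF N(1), of x] by blast
    then have j: "y \<in> cb x (2 ^ j * \<rho>)" "j \<le> N" unfolding j_def by (rule LeastI, rule Least_le)
    have "j \<noteq> 0" using j True by (intro notI) simp
    then obtain k where k: "j = Suc k" by (cases j) auto
    then have nk: "y \<notin> cb x (2 ^ k * \<rho>)" using not_less_Least[of k "\<lambda>j. y \<in> cb x (2 ^ j * \<rho>)"] by (simp add: j_def)
    have "cmod (K_trunc \<rho> x y - K_trunc \<rho>' x y) \<le> q k" using True K_off_cube[OF nk] r by (simp add: K_trunc_def q_def)
    then have "cmod ((K_trunc \<rho> x y - K_trunc \<rho>' x y) * (f y - a)) \<le> q k * cmod (f y - a)" by (simp add: norm_mult mult_right_mono)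
    then have "ennreal (cmod ((K_trunc \<rho> x y - K_trunc \<rho>' x y) * (f y - a))) \<le> ennreal (q k) * ennreal (cmod (f y - a))"
      using q by (simp add: ennreal_mult[symmetric] ennreal_leI)
    also have "\<dots> = ennreal (q k) * (ennreal (cmod (f y - a)) * indicator (cb x (2 ^ Suc k * \<rho>)) y)" using j k by simp
    also have "\<dots> \<le> (\<Sum>k<N. ennreal (q k) * (ennreal (cmod (f y - a)) * indicator (cb x (2 ^ Suc k * \<rho>)) y))"
      using j k by (intro member_le_sum) auto
    finally show ?thesis .
  qed
  have th2: "scale_sum x \<rho> (2 * \<rho>') \<le> t + G * C0"
    using scale_sum_subadd[of \<rho> \<rho>' "2 * \<rho>'" x] scale_sum_const[OF x r', of 1] r by (simp add: t_def)
  have th8: "scale_sum x \<rho> (8 * \<rho>') \<le> t + 3 * (G * C0)"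
    using scale_sum_subadd[of \<rho> \<rho>' "8 * \<rho>'" x] scale_sum_const[OF x r', of 3] r by (simp add: t_def)
  define E where "E = (c_osc + c_conc) * D * (1 + t + G * C0)"
  have E: "E \<ge> 0" using constants_pos D t0 GC0 by (simp add: E_def)
  have shell: "q k * dev x (2 ^ Suc k * \<rho>) a \<le> CK * (G * G * G) * E * dens x (2 ^ Suc k * (2 * \<rho>))" if "k < N" for k
  proof -
    define s where "s = 2 ^ Suc k * \<rho>"
    have "1 * \<rho> \<le> 2 ^ Suc k * \<rho>" using r by (intro mult_right_mono one_le_power) auto
    then have s: "s > 0" "\<rho> \<le> s" using r by (auto simp: s_def)
    have "s \<le> 2 ^ N * \<rho>" unfolding s_def using that r by (intro mult_right_mono power_increasing) auto
    then have s2: "s \<le> 2 * \<rho>'" using N by linarith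
    have "scale_sum x \<rho> s \<le> scale_sum x \<rho> (2 * \<rho>')" using s s2 r by (intro scale_sum_mono) auto
    then have ths: "1 + scale_sum x \<rho> s \<le> 1 + t + G * C0" using th2 by linarith
    define m where "m = measure \<mu> (cb x (2 * s))"
    have m: "measure \<mu> (cb x (5 / 4 * s)) \<le> m" "measure \<mu> (cb x s) \<le> m" "m \<ge> 0"
      unfolding m_def using s by (auto intro!: measure_mono_cb cb_mono)
    have "cmod (f_anc x s - a) \<le> c_conc * D * (1 + scale_sum x \<rho> s)" using f_anc_concentric[OF x r(1) s(2)] by (simp add: a_def norm_minus_commute)
    also have "\<dots> \<le> c_conc * D * (1 + t + G * C0)" using ths constants_pos D by (intro mult_left_mono) auto
    finally have d: "cmod (f_anc x s - a) \<le> c_conc * D * (1 + t + G * C0)" .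
    have "dev x s a \<le> dev x s (f_anc x s) + cmod (f_anc x s - a) * measure \<mu> (cb x s)" by (rule dev_change)
    also have "\<dots> \<le> c_osc * D * m + c_conc * D * (1 + t + G * C0) * m"
    proof (intro add_mono mult_mono d m)
      have "dev x s (f_anc x s) \<le> c_osc * D * measure \<mu> (cb x (5 / 4 * s))" by (rule oscillation_any_cube[OF x s(1)])
      also have "\<dots> \<le> c_osc * D * m" using constants_pos D m by (intro mult_left_mono) auto
      finally show "dev x s (f_anc x s) \<le> c_osc * D * m" .
    qed (use constants_pos D t0 GC0 in auto)
    also have "c_osc * D * m \<le> c_osc * D * m * (1 + t + G * C0)"
      using mult_left_mono[of 1 "1 + t + G * C0" "c_osc * D * m"] constants_pos D m t0 GC0 by simp
    finally have Jm: "dev x s a \<le> E * m" by (simp add: E_def algebra_simps)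
    have "m = dens x (2 * s) * (2 * s) powr n" using s by (simp add: dens_def m_def)
    also have "(2 * s) powr n = (8 * (2 ^ k * \<rho> / 2)) powr n" by (simp add: s_def mult_ac)
    also have "\<dots> = 8 powr n * (2 ^ k * \<rho> / 2) powr n" by (rule powr_mult)
    also have "(8::real) powr n = G * G * G"
    proof -
      have "(8::real) powr n = (2 * 4) powr n" by simp
      also have "\<dots> = 2 powr n * 4 powr n" by (rule powr_mult)
      finally show ?thesis by (simp add: G(2)[symmetric] G_def[symmetric] mult_ac)
    qed
    finally have "q k * (E * m) = CK * (G * G * G) * E * dens x (2 * s) * ((2 ^ k * \<rho> / 2) powr (- n) * (2 ^ k * \<rho> / 2) powr n)"
      by (simp add: q_def mult_ac)
    also have "(2 ^ k * \<rho> / 2) powr (- n) * (2 ^ k * \<rho> / 2) powr n = 1" using r by (simp add: powr_minus)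
    finally have "q k * (E * m) = CK * (G * G * G) * E * dens x (2 * s)" by simp
    moreover have "q k * dev x s a \<le> q k * (E * m)" using Jm q by (intro mult_left_mono)
    ultimately have "q k * dev x s a \<le> CK * (G * G * G) * E * dens x (2 * s)" by (simp only:)
    moreover have "2 * s = 2 ^ Suc k * (2 * \<rho>)" by (simp add: s_def)
    ultimately show ?thesis by (simp only: s_def)
  qed
  have sum: "(\<Sum>k<N. dens x (2 ^ Suc k * (2 * \<rho>))) \<le> G * (t + 3 * (G * C0))"
  proof -
    have "(\<Sum>k<N. dens x (2 ^ Suc k * (2 * \<rho>))) = (\<Sum>j=1..N. dens x (2 ^ j * (2 * \<rho>)))"
      by (rule sum.reindex_bij_witness[where i="\<lambda>j. j - 1" and j=Suc]) auto
    also have "\<dots> \<le> G * scale_sum x (2 * (2 * \<rho>)) (2 ^ Suc N * (2 * \<rho>))" using r by (intro sum_le_scale_sum) auto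
    also have "\<dots> \<le> G * scale_sum x \<rho> (8 * \<rho>')" using r N G by (intro mult_left_mono scale_sum_mono) (auto simp: mult.commute)
    also have "\<dots> \<le> G * (t + 3 * (G * C0))" using th8 G by (intro mult_left_mono) auto
    finally show ?thesis .
  qed
  define S where "S = CK * (G * G * G) * E * (G * (t + 3 * (G * C0)))"
  have "(\<integral>\<^sup>+y. ennreal (cmod ((K_trunc \<rho> x y - K_trunc \<rho>' x y) * (f y - a))) \<partial>\<mu>)
    \<le> (\<integral>\<^sup>+y. (\<Sum>k<N. ennreal (q k) * (ennreal (cmod (f y - a)) * indicator (cb x (2 ^ Suc k * \<rho>)) y)) \<partial>\<mu>)"
    by (intro nn_integral_mono pt)
  also have "\<dots> = (\<Sum>k<N. ennreal (q k) * (\<integral>\<^sup>+y. ennreal (cmod (f y - a)) * indicator (cb x (2 ^ Suc k * \<rho>)) y \<partial>\<mu>))"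
    by (subst nn_integral_sum) (auto simp: nn_integral_cmult)
  also have "\<dots> = ennreal (\<Sum>k<N. q k * dev x (2 ^ Suc k * \<rho>) a)"
    using q dev_nonneg by (simp add: dev_nn ennreal_mult sum_ennreal del: power_Suc flip: sum_ennreal)
  also have "\<dots> \<le> ennreal S"
  proof (rule ennreal_leI)
    have "(\<Sum>k<N. q k * dev x (2 ^ Suc k * \<rho>) a) \<le> (\<Sum>k<N. CK * (G * G * G) * E * dens x (2 ^ Suc k * (2 * \<rho>)))"
      by (intro sum_mono shell) auto
    also have "\<dots> = CK * (G * G * G) * E * (\<Sum>k<N. dens x (2 ^ Suc k * (2 * \<rho>)))" by (simp add: sum_distrib_left)
    also have "\<dots> \<le> S" unfolding S_def using sum CK G E by (intro mult_left_mono) auto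
    finally show "(\<Sum>k<N. q k * dev x (2 ^ Suc k * \<rho>) a) \<le> S" .
  qed
  finally have fin: "(\<integral>\<^sup>+y. ennreal (cmod ((K_trunc \<rho> x y - K_trunc \<rho>' x y) * (f y - a))) \<partial>\<mu>) \<le> ennreal S" .
  have i: "integrable \<mu> (\<lambda>y. K_trunc \<rho> x y * (f y - a))" "integrable \<mu> (\<lambda>y. K_trunc \<rho>' x y * (f y - a))"
    by (intro K_trunc_integrable r r' f_minus_integrable_global)+
  have "(LINT y|\<mu>. K_trunc \<rho> x y * (f y - a)) - (LINT y|\<mu>. K_trunc \<rho>' x y * (f y - a)) = (LINT y|\<mu>. (K_trunc \<rho> x y - K_trunc \<rho>' x y) * (f y - a))"
    using i by (subst Bochner_Integration.integral_diff[symmetric]) (auto simp: algebra_simps)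
  moreover have "integrable \<mu> (\<lambda>y. (K_trunc \<rho> x y - K_trunc \<rho>' x y) * (f y - a))"
    using Bochner_Integration.integrable_diff[OF i] by (simp add: algebra_simps)
  ultimately have "ennreal (cmod (center_value x \<rho> - truncation \<mu> K \<rho>' (\<lambda>y. f y - a) x)) \<le> ennreal S"
    using integral_norm_bound_ennreal[of \<mu> "\<lambda>y. (K_trunc \<rho> x y - K_trunc \<rho>' x y) * (f y - a)"] fin by (simp add: center_value_def truncation_eq_integral_K_trunc a_def)
  moreover have S0: "S \<ge> 0" using CK G E t0 GC0 by (simp add: S_def)
  ultimately have 1: "cmod (center_value x \<rho> - truncation \<mu> K \<rho>' (\<lambda>y. f y - a) x) \<le> S" by (simp add: ennreal_le_iff)
  have "truncation \<mu> K \<rho>' (\<lambda>y. f y - a) x = center_value x \<rho>' + (f_anc x \<rho>' - a) * truncation \<mu> K \<rho>' (\<lambda>_. 1) x"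
    unfolding center_value_def by (rule truncation_change_constant[OF r'])
  then have "center_value x \<rho> - center_value x \<rho>' = (center_value x \<rho> - truncation \<mu> K \<rho>' (\<lambda>y. f y - a) x) + (f_anc x \<rho>' - a) * truncation \<mu> K \<rho>' (\<lambda>_. 1) x" by simp
  then have "cmod (center_value x \<rho> - center_value x \<rho>') \<le> S + cmod ((f_anc x \<rho>' - a) * truncation \<mu> K \<rho>' (\<lambda>_. 1) x)" using 1 by (rule norm_add_le_of_eq)
  also have "cmod ((f_anc x \<rho>' - a) * truncation \<mu> K \<rho>' (\<lambda>_. 1) x) \<le> c_conc * D * (1 + t) * CK"
    unfolding norm_mult
  proof (intro mult_mono truncation_one_bound x r')
    show "cmod (f_anc x \<rho>' - a) \<le> c_conc * D * (1 + t)" using f_anc_concentric[OF x r] by (simp add: a_def t_def norm_minus_commute)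
  qed (use constants_pos D t0 in auto)
  also have "\<dots> \<le> c_conc * D * (1 + t)\<^sup>2 * CK"
  proof -
    have "(1 + t) * 1 \<le> (1 + t) * (1 + t)" using t0 by (intro mult_left_mono) auto
    then show ?thesis using constants_pos D CK by (intro mult_right_mono mult_left_mono) (auto simp: power2_eq_square)
  qed
  also have "S \<le> CK * (G * G * G) * ((c_osc + c_conc) * D * ((1 + G * C0) * (1 + t))) * (G * ((1 + 3 * (G * C0)) * (1 + t)))"
  proof -
    have "1 + t + G * C0 \<le> (1 + G * C0) * (1 + t)" "t + 3 * (G * C0) \<le> (1 + 3 * (G * C0)) * (1 + t)"
      using t0 GC0 mult_nonneg_nonneg[of "G * C0" t] by (auto simp: algebra_simps)
    then show ?thesis unfolding S_def E_def
      using CK G constants_pos D t0 GC0 by (intro mult_mono mult_left_mono) (auto intro!: mult_nonneg_nonneg)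
  qed
  also have "CK * (G * G * G) * ((c_osc + c_conc) * D * ((1 + G * C0) * (1 + t))) * (G * ((1 + 3 * (G * C0)) * (1 + t))) + c_conc * D * (1 + t)\<^sup>2 * CK
     = c_quad * D * (1 + t)\<^sup>2"
    by (simp add: c_quad_def power2_eq_square distrib_left distrib_right mult_ac)
  finally show ?thesis by (simp add: t_def)
qed

text \<open>
  The quadratic bound is made linear along the scales 2^i \<rho>.
\<close>

lemma center_value_concentric:
  assumes x: "x \<in> supp \<mu>" and r: "0 < \<rho>" "\<rho> \<le> \<rho>'"
  shows "cmod (center_value x \<rho> - center_value x \<rho>') \<le> c_cen * D * (1 + scale_sum x \<rho> \<rho>')"
proof -
  have r': "\<rho>' > 0" using r by simp
  obtain N :: nat where N: "\<rho>' \<le> 2 ^ N * \<rho>" "2 ^ N * \<rho> \<le> 2 * \<rho>'" using dyadic_above[OF r] by blast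
  define t where "t = scale_sum x \<rho> \<rho>'"
  have t0: "t \<ge> 0" by (simp add: t_def scale_sum_nonneg)
  have T2: "scale_sum x \<rho>' (2 * \<rho>') \<le> G * C0" using scale_sum_const[OF x r', of 1] by simp
  have "cmod (center_value x (2 ^ 0 * \<rho>) - center_value x (2 ^ N * \<rho>)) \<le> c_quad * D * (2 + G * C0)\<^sup>2 * (1 + scale_sum x (2 ^ 0 * \<rho>) (2 ^ N * \<rho>))"
  proof (rule chain_linear[where u="\<lambda>i. center_value x (2 ^ i * \<rho>)" and \<theta>="\<lambda>i j. scale_sum x (2 ^ i * \<rho>) (2 ^ j * \<rho>)"])
    show "scale_sum x (2 ^ i * \<rho>) (2 ^ k * \<rho>) = scale_sum x (2 ^ i * \<rho>) (2 ^ j * \<rho>) + scale_sum x (2 ^ j * \<rho>) (2 ^ k * \<rho>)" if "i \<le> j" "j \<le> k" for i j k :: nat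
      using that r by (intro scale_sum_add mult_right_mono power_increasing) auto
    show "scale_sum x (2 ^ i * \<rho>) (2 ^ Suc i * \<rho>) \<le> G * C0" for i using scale_sum_const[OF x, of "2 ^ i * \<rho>" 1] r by (simp add: mult_ac)
    show "cmod (center_value x (2 ^ i * \<rho>) - center_value x (2 ^ j * \<rho>)) \<le> c_quad * D * (1 + scale_sum x (2 ^ i * \<rho>) (2 ^ j * \<rho>))\<^sup>2" if "i \<le> j" for i j :: nat
      using that r by (intro center_value_quadratic x mult_right_mono power_increasing) auto
  qed (use c_quad D scale_sum_nonneg in auto)
  then have "cmod (center_value x \<rho> - center_value x (2 ^ N * \<rho>)) \<le> c_quad * D * (2 + G * C0)\<^sup>2 * (1 + scale_sum x \<rho> (2 ^ N * \<rho>))" by simp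
  also have "\<dots> \<le> c_quad * D * (2 + G * C0)\<^sup>2 * ((1 + G * C0) * (1 + t))"
  proof (intro mult_left_mono)
    have "scale_sum x \<rho> (2 ^ N * \<rho>) \<le> scale_sum x \<rho> (2 * \<rho>')" using r N by (intro scale_sum_mono) auto
    also have "\<dots> \<le> t + G * C0" using scale_sum_subadd[of \<rho> \<rho>' "2 * \<rho>'" x] r T2 by (simp add: t_def)
    finally show "1 + scale_sum x \<rho> (2 ^ N * \<rho>) \<le> (1 + G * C0) * (1 + t)"
      using mult_nonneg_nonneg[of "G * C0" t] GC0 t0 by (simp add: algebra_simps)
  qed (use c_quad D in auto)
  finally have 1: "cmod (center_value x \<rho> - center_value x (2 ^ N * \<rho>)) \<le> c_quad * D * (2 + G * C0)\<^sup>2 * ((1 + G * C0) * (1 + t))" .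
  have "cmod (center_value x \<rho>' - center_value x (2 ^ N * \<rho>)) \<le> c_quad * D * (1 + scale_sum x \<rho>' (2 ^ N * \<rho>))\<^sup>2" by (intro center_value_quadratic x r' N)
  also have "\<dots> \<le> c_quad * D * (1 + G * C0)\<^sup>2"
  proof (intro mult_left_mono power_mono)
    have "scale_sum x \<rho>' (2 ^ N * \<rho>) \<le> scale_sum x \<rho>' (2 * \<rho>')" using r N by (intro scale_sum_mono) auto
    then show "1 + scale_sum x \<rho>' (2 ^ N * \<rho>) \<le> 1 + G * C0" using T2 by simp
  qed (use c_quad D scale_sum_nonneg in auto)
  also have "\<dots> \<le> c_quad * D * (1 + G * C0)\<^sup>2 * (1 + t)"
    using mult_left_mono[of 1 "1 + t" "c_quad * D * (1 + G * C0)\<^sup>2"] c_quad D t0 by simp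
  finally have 2: "cmod (center_value x \<rho>' - center_value x (2 ^ N * \<rho>)) \<le> c_quad * D * (1 + G * C0)\<^sup>2 * (1 + t)" .
  have "cmod (center_value x \<rho> - center_value x \<rho>') \<le> cmod (center_value x \<rho> - center_value x (2 ^ N * \<rho>)) + cmod (center_value x \<rho>' - center_value x (2 ^ N * \<rho>))"
    using norm_triangle_ineq4[of "center_value x \<rho> - center_value x (2 ^ N * \<rho>)" "center_value x \<rho>' - center_value x (2 ^ N * \<rho>)"] by simp
  also have "\<dots> \<le> c_cen * D * (1 + t)" using 1 2 by (simp add: c_cen_def distrib_left distrib_right mult_ac)
  finally show ?thesis by (simp add: t_def)
qed

lemma center_value_recenter:
  assumes x: "x \<in> supp \<mu>" "x' \<in> supp \<mu>" and r: "0 < \<rho>" and d: "\<And>i. \<bar>x $ i - x' $ i\<bar> \<le> \<rho> / 4"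
  shows "cmod (center_value x \<rho> - center_value x' \<rho>) \<le> c_cen_rec * D"
proof -
  have bd: "cmod (K_trunc \<rho> z y) \<le> CK * (\<rho> / 4) powr (- n)" for z y
  proof -
    have "CK * (\<rho> / 2) powr (- n) \<le> CK * (\<rho> / 4) powr (- n)" using r n_pos CK by (intro mult_left_mono powr_mono2') auto
    then show ?thesis using K_trunc_bound[OF r, of z y] by linarith
  qed
  have "cmod ((LINT y|\<mu>. K_trunc \<rho> x y * (f y - f_anc x \<rho>)) - (LINT y|\<mu>. K_trunc \<rho> x' y * (f y - f_anc x \<rho>))) \<le> c_pert * D"
  proof (rule kernel_perturbation[OF x(1) r d K_trunc_measurable[OF r] K_trunc_measurable[OF r] bd bd])
    fix y assume y: "y \<notin> cb x (2 ^ CARD('m) * \<rho>)"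
    have "(2::real) ^ 1 \<le> 2 ^ CARD('m)" by (intro power_increasing) (auto simp: Suc_leI)
    then have 2: "2 * \<rho> \<le> 2 ^ CARD('m) * \<rho>" using r by simp
    have "cb x \<rho> \<subseteq> cb x (2 ^ CARD('m) * \<rho>)" using 2 r by (intro cb_mono) auto
    moreover have "cb x' \<rho> \<subseteq> cb x (2 ^ CARD('m) * \<rho>)"
    proof (rule cb_subset_cb)
      show "\<bar>x' $ i - x $ i\<bar> \<le> \<rho> / 4" for i using d[of i] by (simp add: abs_minus_commute)
      show "\<rho> / 2 + \<rho> / 4 \<le> 2 ^ CARD('m) * \<rho> / 2" using 2 r by linarith
    qed
    ultimately have "y \<notin> cb x \<rho>" "y \<notin> cb x' \<rho>" using y by blast+
    then show "K_trunc \<rho> x y = K x y \<and> K_trunc \<rho> x' y = K x' y" by (simp add: K_trunc_def)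
  qed
  then have 1: "cmod (center_value x \<rho> - truncation \<mu> K \<rho> (\<lambda>y. f y - f_anc x \<rho>) x') \<le> c_pert * D" by (simp add: center_value_def truncation_eq_integral_K_trunc)
  have "truncation \<mu> K \<rho> (\<lambda>y. f y - f_anc x \<rho>) x' = center_value x' \<rho> + (f_anc x' \<rho> - f_anc x \<rho>) * truncation \<mu> K \<rho> (\<lambda>_. 1) x'"
    unfolding center_value_def by (rule truncation_change_constant[OF r])
  then have "center_value x \<rho> - center_value x' \<rho> = (center_value x \<rho> - truncation \<mu> K \<rho> (\<lambda>y. f y - f_anc x \<rho>) x') + (f_anc x' \<rho> - f_anc x \<rho>) * truncation \<mu> K \<rho> (\<lambda>_. 1) x'" by simp
  then have "cmod (center_value x \<rho> - center_value x' \<rho>) \<le> c_pert * D + cmod ((f_anc x' \<rho> - f_anc x \<rho>) * truncation \<mu> K \<rho> (\<lambda>_. 1) x')" using 1 by (rule norm_add_le_of_eq)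
  also have "cmod ((f_anc x' \<rho> - f_anc x \<rho>) * truncation \<mu> K \<rho> (\<lambda>_. 1) x') \<le> c_rec * D * CK"
    unfolding norm_mult
  proof (intro mult_mono truncation_one_bound x r f_anc_recenter)
    show "\<bar>x' $ i - x $ i\<bar> \<le> \<rho>" for i using d[of i] r by linarith
  qed (use constants_pos D in auto)
  finally show ?thesis by (simp add: c_cen_rec_def algebra_simps)
qed

end

section \<open>Truncated operators on RBMO\<close>

lemma cube_set_subset_imp:
  assumes "cb (x :: real ^ 'm) l \<subseteq> cb x' l'" "0 < l"
  shows "l \<le> l'" "\<And>i. \<bar>x $ i - x' $ i\<bar> \<le> l' / 2"
proof -
  have p: "x + vec (l / 2) \<in> cb x' l'" "x - vec (l / 2) \<in> cb x' l'" "x \<in> cb x' l'"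
    by (rule subsetD[OF assms(1)], use assms(2) in \<open>simp add: mem_cb\<close>)+
  have "\<bar>x $ i + l / 2 - x' $ i\<bar> \<le> l' / 2" "\<bar>x $ i - l / 2 - x' $ i\<bar> \<le> l' / 2" for i
    using p(1,2) by (auto simp: mem_cb)
  from this[of undefined] show "l \<le> l'" by linarith
  show "\<bar>x $ i - x' $ i\<bar> \<le> l' / 2" for i using p(3) by (simp add: mem_cb)
qed

context growth_measure begin

lemma K_single_ge_1: "K_single n \<mu> Q \<ge> 1"
  unfolding K_single_def by (rule K_pair_ge_1)

lemma bounded_integrable:
  fixes g :: "real ^ 'm \<Rightarrow> 'z :: {banach, second_countable_topology}"
  assumes "g \<in> borel_measurable borel" "\<And>y. norm (g y) \<le> B"
  shows "integrable \<mu> g"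
  by (rule finite_measure.integrable_const_bound[OF fin_mu, of _ B]) (use assms in auto)

end

context cz_growth begin

lemma truncation_bounded: "\<epsilon> > 0 \<Longrightarrow> integrable \<mu> g \<Longrightarrow> \<exists>B. \<forall>x. cmod (truncation \<mu> K \<epsilon> g x) \<le> B"
proof -
  assume e: "\<epsilon> > 0" and g: "integrable \<mu> g"
  have "cmod (truncation \<mu> K \<epsilon> g x) \<le> CK * (\<epsilon> / 2) powr (- n) * (LINT y|\<mu>. cmod (g y))" for x
  proof -
    have i: "integrable \<mu> (\<lambda>y. K_trunc \<epsilon> x y * g y)" by (rule bounded_mult_integrable[OF g K_trunc_measurable[OF e] K_trunc_bound[OF e]])
    have "cmod (truncation \<mu> K \<epsilon> g x) \<le> (LINT y|\<mu>. cmod (K_trunc \<epsilon> x y * g y))"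
      unfolding truncation_eq_integral_K_trunc by (rule integral_norm_bound)
    also have "\<dots> \<le> (LINT y|\<mu>. CK * (\<epsilon> / 2) powr (- n) * cmod (g y))"
      using integrable_norm[OF i] g K_trunc_bound[OF e] by (intro integral_mono) (auto simp: norm_mult intro!: mult_right_mono)
    finally show ?thesis by simp
  qed
  then show ?thesis by blast
qed

lemma truncation_minus_integrable:
  assumes "\<epsilon> > 0" "integrable \<mu> g"
  shows "integrable \<mu> (\<lambda>y. truncation \<mu> K \<epsilon> g y - b)"
proof -
  obtain B where B: "\<And>x. cmod (truncation \<mu> K \<epsilon> g x) \<le> B" using truncation_bounded[OF assms] by blast
  have "g \<in> borel_measurable borel" using borel_measurable_integrable[OF assms(2)] by simp
  then have "integrable \<mu> (truncation \<mu> K \<epsilon> g)" by (intro bounded_integrable[OF _ B] truncation_measurable assms(1))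
  then show ?thesis using finite_measure.integrable_const[OF fin_mu] by (intro Bochner_Integration.integrable_diff) auto
qed

lemma set_integrable_cmod:
  assumes "integrable \<mu> g" shows "integrable \<mu> (\<lambda>y. indicator (cb x l) y * cmod (g y))"
  using integrable_mult_indicator[of "cb x l" \<mu> "\<lambda>y. cmod (g y)"] assms by simp

text \<open>
  The truncations of the constant one are bounded on the support, hence so are the numbers b_Q.
\<close>

lemma mean_of_truncated_one_bounded:
  assumes e: "\<epsilon> > 0" and d: "doubling n \<mu> (x, l)" and C: "C > 0"
    and b: "(LINT y:cb x l|\<mu>. cmod (truncation \<mu> K \<epsilon> (\<lambda>_. 1) y - b)) / measure \<mu> (cb x l) \<le> C / K_single n \<mu> (x, l)"
  shows "cmod b \<le> CK + C"
proof -
  define m where "m = measure \<mu> (cb x l)"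
  have m: "m > 0" using d measure_pos by (auto simp: doubling_iff m_def)
  define T where "T = truncation \<mu> K \<epsilon> (\<lambda>_. 1)"
  have one: "integrable \<mu> (\<lambda>_. 1 :: complex)" by (rule finite_measure.integrable_const[OF fin_mu])
  have i1: "integrable \<mu> (\<lambda>y. indicator (cb x l) y * cmod (T y - b))"
    unfolding T_def by (intro set_integrable_cmod truncation_minus_integrable e one)
  have i2: "integrable \<mu> (\<lambda>y. indicator (cb x l) y * CK)"
    by (intro integrable_mult_left integrable_real_indicator) (auto simp: emeasure_eq_measure)
  have i3: "integrable \<mu> (\<lambda>y. indicator (cb x l) y * cmod b)"
    by (intro integrable_mult_left integrable_real_indicator) (auto simp: emeasure_eq_measure)
  have "cmod b * m = (LINT y|\<mu>. indicator (cb x l) y * cmod b)" by (simp add: m_def mult.commute)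
  also have "\<dots> \<le> (LINT y|\<mu>. indicator (cb x l) y * cmod (T y - b) + indicator (cb x l) y * CK)"
  proof (rule integral_mono_AE)
    show "AE y in \<mu>. indicator (cb x l) y * cmod b \<le> indicator (cb x l) y * cmod (T y - b) + indicator (cb x l) y * CK"
    proof (rule AE_mp[OF AE_not_in[OF compl_supp_null[OF sets_mu]]], intro AE_I2 impI)
      fix y assume "y \<notin> - supp \<mu>"
      then have "cmod (T y) \<le> CK" unfolding T_def by (intro truncation_one_bound e) auto
      then have "cmod b \<le> cmod (T y - b) + CK" using norm_triangle_ineq4[of "T y" "T y - b"] by simp
      then show "indicator (cb x l) y * cmod b \<le> indicator (cb x l) y * cmod (T y - b) + indicator (cb x l) y * CK"
        by (auto simp: indicator_def)
    qed
  qed (use i1 i2 i3 in auto)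
  also have "\<dots> = (LINT y:cb x l|\<mu>. cmod (T y - b)) + CK * m"
    using i1 i2 by (simp add: set_lebesgue_integral_def m_def mult.commute)
  also have "(LINT y:cb x l|\<mu>. cmod (T y - b)) \<le> C / K_single n \<mu> (x, l) * m"
    using b m by (simp add: T_def m_def divide_le_eq)
  also have "C / K_single n \<mu> (x, l) \<le> C" using C K_single_ge_1[of "(x, l)"] by (simp add: divide_le_eq)
  finally have "cmod b * m \<le> (CK + C) * m" using m by (simp add: algebra_simps)
  then show ?thesis using m by simp
qed

text \<open>
  Bounds for T_\<epsilon> f: for its mean oscillation, for the comparison of its numbers, and for its integral.
\<close>

definition "c_mean A C = c_top * C + (6 * A\<^sup>2 * c_jn\<^sup>2 * \<beta> + 1) / 2 + c_pert"
definition "c_comp C = c_top * C + (c_conc * (1 + G + G * C0) + c_rec) * (CK + C) + c_cen * (1 + G + G * C0) + c_cen_rec"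
definition "c_int A = (A\<^sup>2 * c_sq + mass) / 2"

lemma c_mean_pos: "C > 0 \<Longrightarrow> c_mean A C > 0"
proof -
  assume "C > 0"
  then have "c_top * C > 0" "(6 * A\<^sup>2 * c_jn\<^sup>2 * \<beta> + 1) / 2 \<ge> 0" using global_constants_pos beta2 by auto
  then show ?thesis using c_pert unfolding c_mean_def by linarith
qed

lemma c_comp_pos: "C > 0 \<Longrightarrow> c_comp C > 0"
proof -
  assume C: "C > 0"
  have g: "1 + G + G * C0 \<ge> 0" using G GC0 by simp
  have "c_top * C > 0" "c_cen * (1 + G + G * C0) \<ge> 0" using global_constants_pos c_cen C g by auto
  moreover have "(c_conc * (1 + G + G * C0) + c_rec) * (CK + C) \<ge> 0"
    using constants_pos CK C G C0 by (intro mult_nonneg_nonneg add_nonneg_nonneg) auto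
  ultimately show ?thesis using c_cen_rec by (simp add: c_comp_def)
qed

lemma c_int_nonneg: "c_int A \<ge> 0" using global_constants_pos mass by (simp add: c_int_def)

end

context cz_rbmo begin

text \<open>
  The decomposition of T_\<epsilon> f at a point of Q.  For \<epsilon> \<le> 2l the local part on 2Q is split off,
  because there the kernel is not bounded at the scale l.  For \<epsilon> > 2l the cutoff at \<epsilon> does
  this by itself, and there is no local part.
\<close>

lemma truncation_split:
  assumes e: "\<epsilon> > 0" and d: "\<And>i. \<bar>y $ i - x $ i\<bar> \<le> l / 2" and l: "l > 0" and x: "x \<in> supp \<mu>"
    and \<rho>: "\<rho> = max (2 * l) \<epsilon>" and H: "H = (if \<epsilon> \<le> 2 * l then cb x \<rho> else {})"
  shows "cmod (truncation \<mu> K \<epsilon> f y - (f_anc x \<rho> * b + center_value x \<rho>)) \<le>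
     cmod (f_anc x \<rho>) * cmod (truncation \<mu> K \<epsilon> (\<lambda>_. 1) y - b)
     + cmod (truncation \<mu> K \<epsilon> (\<lambda>z. indicator H z *\<^sub>R (f z - f_anc x \<rho>)) y) + c_pert * D"
proof -
  define a where "a = f_anc x \<rho>"
  have r: "\<rho> > 0" "2 * l \<le> \<rho>" "\<epsilon> \<le> \<rho>" using l e by (auto simp: \<rho>)
  have [measurable]: "H \<in> sets borel" by (simp add: H)
  \<comment> \<open>The kernel of the truncation at \<open>y\<close> with the local part removed.\<close>
  define \<kappa> where "\<kappa> z = indicator (- H) z *\<^sub>R K_trunc \<epsilon> y z" for z
  have Km[measurable]: "K_trunc \<epsilon> y \<in> borel_measurable borel" by (rule K_trunc_measurable[OF e])
  have km: "\<kappa> \<in> borel_measurable borel" unfolding \<kappa>_def by measurable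
  have pm: "CK * (\<sigma> / 2) powr (- n) \<le> CK * (\<rho> / 4) powr (- n)" if "\<rho> \<le> 2 * \<sigma>" for \<sigma>
    using that r n_pos CK by (intro mult_left_mono powr_mono2') auto
  have kb: "cmod (\<kappa> z) \<le> CK * (\<rho> / 4) powr (- n)" for z
  proof (cases "\<epsilon> \<le> 2 * l")
    case False
    then have "\<rho> = \<epsilon>" by (simp add: \<rho>)
    then have "cmod (\<kappa> z) \<le> CK * (\<rho> / 2) powr (- n)" using False K_trunc_bound[OF e, of y z] by (simp add: \<kappa>_def H)
    then show ?thesis using pm[of \<rho>] r by simp
  next
    case True
    then have rl: "\<rho> = 2 * l" by (simp add: \<rho>)
    show ?thesis
    proof (cases "z \<in> H \<or> z \<in> cb y \<epsilon>")
      case True then show ?thesis using CK by (auto simp: \<kappa>_def K_trunc_def)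
    next
      case F: False
      have "cb y l \<subseteq> cb x \<rho>" using d by (rule cb_subset_cb) (simp add: rl)
      then have "z \<notin> cb y l" using F True by (auto simp: H)
      then have "cmod (K y z) \<le> CK * (l / 2) powr (- n)" using l by (rule K_off_cube)
      then show ?thesis using F rl by (simp add: \<kappa>_def K_trunc_def)
    qed
  qed
  have Kb: "cmod (K_trunc \<rho> x z) \<le> CK * (\<rho> / 4) powr (- n)" for z
    using K_trunc_bound[OF r(1), of x z] pm[of \<rho>] r by simp
  have "cmod ((LINT z|\<mu>. K_trunc \<rho> x z * (f z - f_anc x \<rho>)) - (LINT z|\<mu>. \<kappa> z * (f z - f_anc x \<rho>))) \<le> c_pert * D"
  proof (rule kernel_perturbation[OF x r(1) _ K_trunc_measurable[OF r(1)] km Kb kb])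
    show "\<bar>x $ i - y $ i\<bar> \<le> \<rho> / 4" for i using d[of i] r(2) by linarith
    fix z assume z: "z \<notin> cb x (2 ^ CARD('m) * \<rho>)"
    have "(2::real) ^ 1 \<le> 2 ^ CARD('m)" by (intro power_increasing) (auto simp: Suc_leI)
    then have 2: "2 * \<rho> \<le> 2 ^ CARD('m) * \<rho>" using r by simp
    have "cb x \<rho> \<subseteq> cb x (2 ^ CARD('m) * \<rho>)" using 2 r by (intro cb_mono) auto
    moreover have "cb y \<epsilon> \<subseteq> cb x (2 ^ CARD('m) * \<rho>)" using d
      by (rule cb_subset_cb) (use 2 r in linarith)
    ultimately have "z \<notin> cb x \<rho>" "z \<notin> cb y \<epsilon>" using z by blast+
    then show "K_trunc \<rho> x z = K x z \<and> \<kappa> z = K y z" by (simp add: K_trunc_def \<kappa>_def H)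
  qed
  then have near: "cmod ((LINT z|\<mu>. \<kappa> z * (f z - a)) - center_value x \<rho>) \<le> c_pert * D"
    by (simp add: center_value_def truncation_eq_integral_K_trunc a_def norm_minus_commute)
  define h where "h z = indicator H z *\<^sub>R (f z - a)" for z
  have hi: "integrable \<mu> h" unfolding h_def using f_minus_integrable_global[of a] by (intro integrable_mult_indicator) auto
  have "truncation \<mu> K \<epsilon> f y = truncation \<mu> K \<epsilon> (\<lambda>z. f z - a) y + (a - 0) * truncation \<mu> K \<epsilon> (\<lambda>_. 1) y"
    using truncation_change_constant[OF e, of 0 y a] by simp
  also have "truncation \<mu> K \<epsilon> (\<lambda>z. f z - a) y = (LINT z|\<mu>. K_trunc \<epsilon> y z * h z + \<kappa> z * (f z - a))"
    unfolding truncation_eq_integral_K_trunc by (rule arg_cong[where f="lebesgue_integral \<mu>"]) (auto simp: h_def \<kappa>_def indicator_def fun_eq_iff)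
  also have "\<dots> = truncation \<mu> K \<epsilon> h y + (LINT z|\<mu>. \<kappa> z * (f z - a))"
    unfolding truncation_eq_integral_K_trunc by (intro Bochner_Integration.integral_add K_trunc_integrable e hi bounded_mult_integrable[OF f_minus_integrable_global km kb])
  finally have eq: "truncation \<mu> K \<epsilon> f y - (a * b + center_value x \<rho>) = a * (truncation \<mu> K \<epsilon> (\<lambda>_. 1) y - b) + truncation \<mu> K \<epsilon> h y
      + ((LINT z|\<mu>. \<kappa> z * (f z - a)) - center_value x \<rho>)" by (simp add: algebra_simps)
  have "cmod (truncation \<mu> K \<epsilon> f y - (a * b + center_value x \<rho>)) \<le> cmod (a * (truncation \<mu> K \<epsilon> (\<lambda>_. 1) y - b)) + cmod (truncation \<mu> K \<epsilon> h y)
      + cmod ((LINT z|\<mu>. \<kappa> z * (f z - a)) - center_value x \<rho>)"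
    unfolding eq by (intro order_trans[OF norm_triangle_ineq] add_mono norm_triangle_ineq order_refl)
  then show ?thesis using near by (simp add: a_def h_def[abs_def] norm_mult)
qed

text \<open>
  In the case \<epsilon> \<le> 2l one has \<rho> = 2l, so the enlarged cube in the L^2 oscillation is 4Q, whose
  measure is controlled since Q is doubling.
\<close>

lemma local_part_L2:
  assumes d: "doubling n \<mu> (x, l)" and \<rho>: "\<rho> = max (2 * l) \<epsilon>" and H: "H = (if \<epsilon> \<le> 2 * l then cb x \<rho> else {})"
  defines "h \<equiv> \<lambda>z. indicator H z *\<^sub>R (f z - f_anc x \<rho>)"
  shows "h \<in> L2 \<mu>" "(LINT z|\<mu>. (cmod (h z))\<^sup>2) \<le> 6 * (c_jn * D)\<^sup>2 * \<beta> * measure \<mu> (cb x l)"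
proof -
  have x: "x \<in> supp \<mu>" and l: "l > 0" and \<beta>: "measure \<mu> (cb x (4 * l)) \<le> \<beta> * measure \<mu> (cb x l)" using d by (auto simp: doubling_iff)
  have [measurable]: "H \<in> sets borel" by (simp add: H)
  have hm[measurable]: "h \<in> borel_measurable borel" unfolding h_def by measurable
  define R where "R = 6 * (c_jn * D)\<^sup>2 * \<beta> * measure \<mu> (cb x l)"
  have R: "R \<ge> 0" using beta2 by (simp add: R_def)
  have nn: "(\<integral>\<^sup>+z. ennreal ((cmod (h z))\<^sup>2) \<partial>\<mu>) \<le> ennreal R"
  proof (cases "\<epsilon> \<le> 2 * l")
    case False then show ?thesis by (simp add: h_def H)
  next
    case True
    then have rl: "\<rho> = 2 * l" by (simp add: \<rho>)
    have "(\<integral>\<^sup>+z. ennreal ((cmod (h z))\<^sup>2) \<partial>\<mu>) = (\<integral>\<^sup>+z. ennreal ((cmod (f z - f_anc x \<rho>))\<^sup>2) * indicator (cb x \<rho>) z \<partial>\<mu>)"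
      using True by (intro nn_integral_cong) (auto simp: h_def H indicator_def)
    also have "\<dots> \<le> ennreal (6 * (c_jn * D)\<^sup>2 * measure \<mu> (cb x (2 * \<rho>)))" using l rl by (intro L2_oscillation x) auto
    also have "\<dots> \<le> ennreal R"
    proof (rule ennreal_leI)
      have "measure \<mu> (cb x (2 * \<rho>)) \<le> \<beta> * measure \<mu> (cb x l)" using \<beta> rl by simp
      then have "6 * (c_jn * D)\<^sup>2 * measure \<mu> (cb x (2 * \<rho>)) \<le> 6 * (c_jn * D)\<^sup>2 * (\<beta> * measure \<mu> (cb x l))" by (intro mult_left_mono) auto
      then show "6 * (c_jn * D)\<^sup>2 * measure \<mu> (cb x (2 * \<rho>)) \<le> R" by (simp add: R_def mult_ac)
    qed
    finally show ?thesis .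
  qed
  have int: "integrable \<mu> (\<lambda>z. (cmod (h z))\<^sup>2)"
  proof (rule integrableI_bounded)
    show "(\<integral>\<^sup>+z. ennreal (norm ((cmod (h z))\<^sup>2)) \<partial>\<mu>) < \<infinity>" using le_less_trans[OF nn ennreal_less_top] by simp
  qed measurable
  then show "h \<in> L2 \<mu>" by (simp add: L2_def)
  have "ennreal (LINT z|\<mu>. (cmod (h z))\<^sup>2) \<le> ennreal R"
    using nn nn_integral_eq_integral[OF int] by simp
  then show "(LINT z|\<mu>. (cmod (h z))\<^sup>2) \<le> 6 * (c_jn * D)\<^sup>2 * \<beta> * measure \<mu> (cb x l)"
    using R by (subst (asm) ennreal_le_iff) (auto simp: R_def)
qed

lemma L2_nrm_square:
  assumes "L2_nrm \<mu> g \<le> A * L2_nrm \<mu> h"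
  shows "(LINT z|\<mu>. (cmod (g z))\<^sup>2) \<le> A\<^sup>2 * (LINT z|\<mu>. (cmod (h z))\<^sup>2)"
proof -
  have nn: "0 \<le> (LINT z|\<mu>. (cmod (g z))\<^sup>2)" "0 \<le> (LINT z|\<mu>. (cmod (h z))\<^sup>2)" by (auto intro: integral_nonneg_AE)
  have "(L2_nrm \<mu> g)\<^sup>2 \<le> (A * L2_nrm \<mu> h)\<^sup>2" using assms nn by (intro power_mono) (auto simp: L2_nrm_def)
  then show ?thesis using nn by (simp add: L2_nrm_def power_mult_distrib)
qed

text \<open>
  The three parts have bounded means on Q: the first by the hypothesis on T_\<epsilon> 1 and
  |a| \<le> C K(Q), the local one by boundedness on L^2, the far one pointwise.
\<close>

lemma truncation_oscillation:
  assumes e: "\<epsilon> > 0" and d: "doubling n \<mu> (x, l)" and C: "C > 0"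
    and L2: "\<And>g. g \<in> L2 \<mu> \<Longrightarrow> truncation \<mu> K \<epsilon> g \<in> L2 \<mu> \<and> L2_nrm \<mu> (truncation \<mu> K \<epsilon> g) \<le> A * L2_nrm \<mu> g"
    and b: "(LINT y:cb x l|\<mu>. cmod (truncation \<mu> K \<epsilon> (\<lambda>_. 1) y - b)) / measure \<mu> (cb x l) \<le> C / K_single n \<mu> (x, l)"
    and \<rho>: "\<rho> = max (2 * l) \<epsilon>"
  shows "(LINT y:cb x l|\<mu>. cmod (truncation \<mu> K \<epsilon> f y - (f_anc x \<rho> * b + center_value x \<rho>))) / measure \<mu> (cb x l) \<le> c_mean A C * D_full"
proof -
  have x: "x \<in> supp \<mu>" and l: "l > 0" using d by (auto simp: doubling_iff)
  define m where "m = measure \<mu> (cb x l)"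
  have m: "m > 0" using measure_pos[OF x l] by (simp add: m_def)
  define a where "a = f_anc x \<rho>"
  define T1 where "T1 = truncation \<mu> K \<epsilon> (\<lambda>_. 1)"
  define H where "H = (if \<epsilon> \<le> 2 * l then cb x \<rho> else {})"
  define h where "h = (\<lambda>z. indicator H z *\<^sub>R (f z - f_anc x \<rho>))"
  define Tloc where "Tloc = truncation \<mu> K \<epsilon> h"
  have h: "h \<in> L2 \<mu>" "(LINT z|\<mu>. (cmod (h z))\<^sup>2) \<le> 6 * (c_jn * D)\<^sup>2 * \<beta> * measure \<mu> (cb x l)"
    unfolding h_def by (rule local_part_L2[OF d \<rho> H_def])+
  have Tloc_L2: "Tloc \<in> L2 \<mu>" and Tloc_n: "L2_nrm \<mu> Tloc \<le> A * L2_nrm \<mu> h" using L2[OF h(1)] by (auto simp: Tloc_def)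
  then have Tloc_i: "integrable \<mu> (\<lambda>z. (cmod (Tloc z))\<^sup>2)" by (simp add: L2_def)
  have Tloc_b: "(LINT z|\<mu>. (cmod (Tloc z))\<^sup>2) \<le> A\<^sup>2 * (6 * (c_jn * D)\<^sup>2 * \<beta> * m)"
    using L2_nrm_square[OF Tloc_n] mult_left_mono[OF h(2), of "A\<^sup>2"] by (simp add: m_def)
  have hi: "integrable \<mu> h" unfolding h_def H_def
    by (intro integrable_mult_indicator f_minus_integrable_global) auto
  have one: "integrable \<mu> (\<lambda>_. 1 :: complex)" by (rule integrable_const)
  let ?I = "indicator (cb x l) :: real ^ 'm \<Rightarrow> real"
  have i0: "integrable \<mu> (\<lambda>y. ?I y * cmod (truncation \<mu> K \<epsilon> f y - (a * b + center_value x \<rho>)))"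
    by (intro set_integrable_cmod truncation_minus_integrable e f_integrable)
  have i1: "integrable \<mu> (\<lambda>y. ?I y * cmod (T1 y - b))"
    unfolding T1_def by (intro set_integrable_cmod truncation_minus_integrable e one)
  have i2: "integrable \<mu> (\<lambda>y. ?I y * ((c_pert + 1 / 2) * D))" by (rule indicator_cb_integrable)
  have i3: "integrable \<mu> (\<lambda>y. (cmod (Tloc y))\<^sup>2 / (2 * D))" using Tloc_i by simp
  have pt: "?I y * cmod (truncation \<mu> K \<epsilon> f y - (a * b + center_value x \<rho>))
     \<le> cmod a * (?I y * cmod (T1 y - b)) + (cmod (Tloc y))\<^sup>2 / (2 * D) + ?I y * ((c_pert + 1 / 2) * D)" for y
  proof (cases "y \<in> cb x l")
    case False then show ?thesis using D by simp
  next
    case True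
    then have "\<bar>y $ i - x $ i\<bar> \<le> l / 2" for i by (simp add: mem_cb)
    from truncation_split[OF e this l x \<rho> H_def, of b]
    have "cmod (truncation \<mu> K \<epsilon> f y - (a * b + center_value x \<rho>)) \<le> cmod a * cmod (T1 y - b) + cmod (Tloc y) + c_pert * D"
      by (simp add: a_def T1_def Tloc_def h_def)
    moreover have "cmod (Tloc y) \<le> (cmod (Tloc y))\<^sup>2 / (2 * D) + D / 2" using amgm[OF D, of "cmod (Tloc y)"] by (simp add: field_simps)
    ultimately show ?thesis using True by (simp add: algebra_simps)
  qed
  have "(LINT y:cb x l|\<mu>. cmod (truncation \<mu> K \<epsilon> f y - (a * b + center_value x \<rho>)))
     \<le> (LINT y|\<mu>. cmod a * (?I y * cmod (T1 y - b)) + (cmod (Tloc y))\<^sup>2 / (2 * D) + ?I y * ((c_pert + 1 / 2) * D))"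
    unfolding set_lebesgue_integral_def real_scaleR_def
    by (intro integral_mono i0 Bochner_Integration.integrable_add integrable_mult_right i1 i2 i3 pt)
  also have "\<dots> = cmod a * (LINT y|\<mu>. ?I y * cmod (T1 y - b)) + (LINT y|\<mu>. (cmod (Tloc y))\<^sup>2) / (2 * D) + m * ((c_pert + 1 / 2) * D)"
    using i1 i2 i3 by (simp add: m_def)
  also have "\<dots> \<le> c_top * C * D_full * m + A\<^sup>2 * (6 * (c_jn * D)\<^sup>2 * \<beta> * m) / (2 * D) + m * ((c_pert + 1 / 2) * D)"
  proof (intro add_mono divide_right_mono Tloc_b order_refl)
    define Ks where "Ks = K_single n \<mu> (x, l)"
    have Ks: "Ks \<ge> 1" by (simp add: Ks_def K_single_ge_1)
    have 1: "(LINT y|\<mu>. ?I y * cmod (T1 y - b)) \<le> C / Ks * m"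
      using b m by (simp add: T1_def m_def Ks_def divide_le_eq set_lebesgue_integral_def)
    have "l \<le> \<rho>" using l by (simp add: \<rho>)
    then have 2: "cmod a \<le> c_top * D_full * Ks" unfolding a_def Ks_def by (rule f_anc_le_K_single[OF d])
    have "cmod a * (LINT y|\<mu>. ?I y * cmod (T1 y - b)) \<le> c_top * D_full * Ks * (C / Ks * m)"
      using global_constants_pos D_full Ks by (intro mult_mono 1 2 integral_nonneg_AE AE_I2) (auto simp: zero_le_mult_iff)
    also have "\<dots> = c_top * C * D_full * m" using Ks by simp
    finally show "cmod a * (LINT y|\<mu>. ?I y * cmod (T1 y - b)) \<le> c_top * C * D_full * m" .
  qed (use D in auto)
  also have "A\<^sup>2 * (6 * (c_jn * D)\<^sup>2 * \<beta> * m) / (2 * D) = (6 * A\<^sup>2 * c_jn\<^sup>2 * \<beta>) / 2 * D * m"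
    using D by (simp add: power2_eq_square)
  also have "c_top * C * D_full * m + (6 * A\<^sup>2 * c_jn\<^sup>2 * \<beta>) / 2 * D * m + m * ((c_pert + 1 / 2) * D) = c_top * C * D_full * m + ((6 * A\<^sup>2 * c_jn\<^sup>2 * \<beta> + 1) / 2 + c_pert) * m * D"
    by (simp add: algebra_simps add_divide_distrib)
  also have "\<dots> \<le> c_top * C * D_full * m + ((6 * A\<^sup>2 * c_jn\<^sup>2 * \<beta> + 1) / 2 + c_pert) * m * D_full"
    using D_full m c_pert beta2 by (intro add_mono mult_left_mono order_refl mult_nonneg_nonneg add_nonneg_nonneg) auto
  also have "\<dots> = c_mean A C * D_full * m" by (simp add: c_mean_def algebra_simps add_divide_distrib)
  finally show ?thesis using m by (simp add: m_def a_def divide_le_eq)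
qed

text \<open>
  The product is expanded as a b - a' b' = a (b - b') + (a - a') b'.  The factor K(Q) in the bound of
  a cancels against the hypothesis on b - b', and b' is bounded.
\<close>

lemma truncation_compare:
  assumes e: "\<epsilon> > 0" and d: "doubling n \<mu> (x, l)" "doubling n \<mu> (x', l')" and sub: "cb x l \<subseteq> cb x' l'" and C: "C > 0"
    and b: "cmod (b - b') \<le> C * (K_pair n \<mu> (x, l) (x', l') / K_single n \<mu> (x, l))" "cmod b' \<le> CK + C"
    and \<rho>: "\<rho> = max (2 * l) \<epsilon>" "\<rho>' = max (2 * l') \<epsilon>"
  shows "cmod ((f_anc x \<rho> * b + center_value x \<rho>) - (f_anc x' \<rho>' * b' + center_value x' \<rho>')) \<le> c_comp C * D_full * K_pair n \<mu> (x, l) (x', l')"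
proof -
  define kp where "kp = K_pair n \<mu> (x, l) (x', l')"
  have kp: "kp \<ge> 1" by (simp add: kp_def K_pair_ge_1)
  have x: "x \<in> supp \<mu>" "x' \<in> supp \<mu>" and l: "l > 0" "l' > 0" using d by (auto simp: doubling_iff)
  note ll = cube_set_subset_imp[OF sub l(1)]
  have r: "\<rho> > 0" "\<rho> \<le> \<rho>'" "\<rho>' > 0" "l \<le> \<rho>" using e ll(1) l by (auto simp: \<rho>)
  have dd: "\<bar>x $ i - x' $ i\<bar> \<le> \<rho>' / 4" for i using ll(2)[of i] by (simp add: \<rho>)
  have dd': "\<bar>x $ i - x' $ i\<bar> \<le> \<rho>'" for i using dd[of i] r(3) by linarith
  have th: "scale_sum x \<rho> \<rho>' \<le> (G + G * C0) * kp"
  proof (cases "2 * l' \<le> \<epsilon>")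
    case True
    then have "\<rho>' \<le> \<rho>" by (simp add: \<rho>)
    then show ?thesis using scale_sum_empty[OF r(3)] G GC0 kp by simp
  next
    case False
    then have "\<rho>' = 2 * l'" by (simp add: \<rho>)
    then have "scale_sum x \<rho> \<rho>' \<le> scale_sum x l (2 * l')" using r l by (intro scale_sum_mono) auto
    also have "\<dots> \<le> scale_sum x l l' + scale_sum x l' (2 * l')" using l by (intro scale_sum_subadd) auto
    also have "\<dots> \<le> G * kp + G * C0 * 1"
      using scale_sum_le_K_pair[of l "(x', l')" x] scale_sum_const[OF x(1) l(2), of 1] l by (simp add: kp_def)
    also have "\<dots> \<le> G * kp + G * C0 * kp" using kp GC0 G by (intro add_mono mult_left_mono) auto
    finally show ?thesis by (simp add: algebra_simps)
  qed
  then have th1: "1 + scale_sum x \<rho> \<rho>' \<le> (1 + G + G * C0) * kp" using kp by (simp add: algebra_simps)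
  have D_full0: "D_full \<ge> 0" using D_full by simp
  have aa: "cmod (f_anc x \<rho> - f_anc x' \<rho>') \<le> (c_conc * (1 + G + G * C0) + c_rec) * D_full * kp"
  proof -
    have "cmod (f_anc x \<rho> - f_anc x' \<rho>') \<le> cmod (f_anc x \<rho> - f_anc x \<rho>') + cmod (f_anc x \<rho>' - f_anc x' \<rho>')"
      using norm_triangle_ineq[of "f_anc x \<rho> - f_anc x \<rho>'" "f_anc x \<rho>' - f_anc x' \<rho>'"] by simp
    also have "\<dots> \<le> c_conc * D * (1 + scale_sum x \<rho> \<rho>') + c_rec * D" by (intro add_mono f_anc_concentric f_anc_recenter x r dd')
    also have "\<dots> \<le> c_conc * D_full * ((1 + G + G * C0) * kp) + c_rec * D_full * kp"
    proof (rule add_mono)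
      show "c_conc * D * (1 + scale_sum x \<rho> \<rho>') \<le> c_conc * D_full * ((1 + G + G * C0) * kp)"
        using constants_pos D_full scale_sum_nonneg[of x \<rho> \<rho>'] D by (intro mult_mono th1) auto
      have "c_rec * D \<le> c_rec * D_full * 1" using constants_pos D_full by (simp add: mult_left_mono)
      also have "\<dots> \<le> c_rec * D_full * kp" using constants_pos D_full kp by (intro mult_left_mono) auto
      finally show "c_rec * D \<le> c_rec * D_full * kp" .
    qed
    finally show ?thesis by (simp add: algebra_simps)
  qed
  have cc: "cmod (center_value x \<rho> - center_value x' \<rho>') \<le> (c_cen * (1 + G + G * C0) + c_cen_rec) * D_full * kp"
  proof -
    have "cmod (center_value x \<rho> - center_value x' \<rho>') \<le> cmod (center_value x \<rho> - center_value x \<rho>') + cmod (center_value x \<rho>' - center_value x' \<rho>')"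
      using norm_triangle_ineq[of "center_value x \<rho> - center_value x \<rho>'" "center_value x \<rho>' - center_value x' \<rho>'"] by simp
    also have "\<dots> \<le> c_cen * D * (1 + scale_sum x \<rho> \<rho>') + c_cen_rec * D" by (intro add_mono center_value_concentric center_value_recenter x r dd)
    also have "\<dots> \<le> c_cen * D_full * ((1 + G + G * C0) * kp) + c_cen_rec * D_full * kp"
    proof (rule add_mono)
      show "c_cen * D * (1 + scale_sum x \<rho> \<rho>') \<le> c_cen * D_full * ((1 + G + G * C0) * kp)"
        using c_cen D_full scale_sum_nonneg[of x \<rho> \<rho>'] D by (intro mult_mono th1) auto
      have "c_cen_rec * D \<le> c_cen_rec * D_full * 1" using c_cen_rec D_full by (simp add: mult_left_mono)
      also have "\<dots> \<le> c_cen_rec * D_full * kp" using c_cen_rec D_full kp by (intro mult_left_mono) auto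
      finally show "c_cen_rec * D \<le> c_cen_rec * D_full * kp" .
    qed
    finally show ?thesis by (simp add: algebra_simps)
  qed
  have bb: "cmod (f_anc x \<rho>) * cmod (b - b') \<le> c_top * C * D_full * kp"
  proof -
    define Ks where "Ks = K_single n \<mu> (x, l)"
    have Ks: "Ks \<ge> 1" by (simp add: Ks_def K_single_ge_1)
    have 1: "cmod (f_anc x \<rho>) \<le> c_top * D_full * Ks" unfolding Ks_def by (rule f_anc_le_K_single[OF d(1) r(4)])
    have 2: "cmod (b - b') \<le> C * (kp / Ks)" using b(1) by (simp add: kp_def Ks_def)
    have "cmod (f_anc x \<rho>) * cmod (b - b') \<le> c_top * D_full * Ks * (C * (kp / Ks))"
      using global_constants_pos D_full Ks by (intro mult_mono 1 2) auto
    also have "\<dots> = c_top * C * D_full * kp" using Ks by simp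
    finally show ?thesis .
  qed
  have "cmod (f_anc x \<rho> - f_anc x' \<rho>') * cmod b' \<le> (c_conc * (1 + G + G * C0) + c_rec) * D_full * kp * (CK + C)"
    using constants_pos D_full0 kp G C0 by (intro mult_mono aa b(2) mult_nonneg_nonneg add_nonneg_nonneg) auto
  moreover have "(f_anc x \<rho> * b + center_value x \<rho>) - (f_anc x' \<rho>' * b' + center_value x' \<rho>') = f_anc x \<rho> * (b - b') + (f_anc x \<rho> - f_anc x' \<rho>') * b' + (center_value x \<rho> - center_value x' \<rho>')"
    by (simp add: algebra_simps)
  then have "cmod ((f_anc x \<rho> * b + center_value x \<rho>) - (f_anc x' \<rho>' * b' + center_value x' \<rho>')) \<le> cmod (f_anc x \<rho> * (b - b')) + cmod ((f_anc x \<rho> - f_anc x' \<rho>') * b') + cmod (center_value x \<rho> - center_value x' \<rho>')"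
    by (simp only:) (intro order_trans[OF norm_triangle_ineq] add_mono norm_triangle_ineq order_refl)
  ultimately have "cmod ((f_anc x \<rho> * b + center_value x \<rho>) - (f_anc x' \<rho>' * b' + center_value x' \<rho>'))
     \<le> c_top * C * D_full * kp + (c_conc * (1 + G + G * C0) + c_rec) * D_full * kp * (CK + C) + (c_cen * (1 + G + G * C0) + c_cen_rec) * D_full * kp"
    using bb cc unfolding norm_mult by linarith
  also have "\<dots> = c_comp C * D_full * kp" by (simp add: c_comp_def algebra_simps)
  finally show ?thesis by (simp add: kp_def)
qed

lemma truncation_integral_bound:
  assumes e: "\<epsilon> > 0"
    and L2: "\<And>g. g \<in> L2 \<mu> \<Longrightarrow> truncation \<mu> K \<epsilon> g \<in> L2 \<mu> \<and> L2_nrm \<mu> (truncation \<mu> K \<epsilon> g) \<le> A * L2_nrm \<mu> g"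
  shows "cmod (LINT y|\<mu>. truncation \<mu> K \<epsilon> f y) \<le> c_int A * D_full"
proof -
  define T where "T = truncation \<mu> K \<epsilon> f"
  have "f \<in> L2 \<mu>" using f_square_integrable by (simp add: L2_def)
  from L2[OF this] have T: "T \<in> L2 \<mu>" "L2_nrm \<mu> T \<le> A * L2_nrm \<mu> f" by (auto simp: T_def)
  have Ti2: "integrable \<mu> (\<lambda>y. (cmod (T y))\<^sup>2)" using T(1) by (simp add: L2_def)
  have Ti: "integrable \<mu> T" using truncation_minus_integrable[OF e f_integrable, of 0] by (simp add: T_def)
  have "cmod (LINT y|\<mu>. T y) \<le> (LINT y|\<mu>. cmod (T y))" by (rule integral_norm_bound)
  also have "\<dots> \<le> (LINT y|\<mu>. ((cmod (T y))\<^sup>2 / D_full + D_full) / 2)"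
    using Ti Ti2 by (intro integral_mono amgm D_full(1)) auto
  also have "\<dots> = ((LINT y|\<mu>. (cmod (T y))\<^sup>2) / D_full + D_full * mass) / 2" using Ti2 by (simp add: mass_def mult.commute)
  also have "\<dots> \<le> (A\<^sup>2 * (c_sq * D_full\<^sup>2) / D_full + D_full * mass) / 2"
  proof (intro divide_right_mono add_right_mono)
    show "(LINT y|\<mu>. (cmod (T y))\<^sup>2) \<le> A\<^sup>2 * (c_sq * D_full\<^sup>2)"
      using L2_nrm_square[OF T(2)] mult_left_mono[OF f_L2_bound, of "A\<^sup>2"] by simp
  qed (use D_full in auto)
  also have "\<dots> = c_int A * D_full" using D_full by (simp add: c_int_def power2_eq_square algebra_simps add_divide_distrib)
  finally show ?thesis by (simp add: T_def)
qed

lemma truncation_RBMO_constant: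
  assumes e: "\<epsilon> > 0" and C: "C > 0"
    and L2: "\<And>g. g \<in> L2 \<mu> \<Longrightarrow> truncation \<mu> K \<epsilon> g \<in> L2 \<mu> \<and> L2_nrm \<mu> (truncation \<mu> K \<epsilon> g) \<le> A * L2_nrm \<mu> g"
    and b1: "\<And>Q. doubling n \<mu> Q \<Longrightarrow>
           (LINT x:cube_set Q|\<mu>. cmod (truncation \<mu> K \<epsilon> (\<lambda>_. 1) x - b Q)) / measure \<mu> (cube_set Q) \<le> C / K_single n \<mu> Q"
    and b2: "\<And>Q R. doubling n \<mu> Q \<Longrightarrow> doubling n \<mu> R \<Longrightarrow> cube_set Q \<subseteq> cube_set R \<Longrightarrow>
           cmod (b Q - b R) \<le> C * (K_pair n \<mu> Q R / K_single n \<mu> Q)"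
  shows "RBMO_constant n \<mu> (truncation \<mu> K \<epsilon> f) ((c_mean A C + c_comp C) * D_full)"
proof -
  define gQ where "gQ Q = f_anc (fst Q) (max (2 * snd Q) \<epsilon>) * b Q + center_value (fst Q) (max (2 * snd Q) \<epsilon>)" for Q
  have pos: "c_mean A C > 0" "c_comp C > 0" using c_mean_pos[OF C] c_comp_pos[OF C] .
  show ?thesis
    unfolding RBMO_constant_def
  proof (intro conjI exI[of _ gQ] allI impI)
    show "(c_mean A C + c_comp C) * D_full > 0" using pos D_full by simp
  next
    fix Q assume d: "doubling n \<mu> Q"
    obtain x l where Q: "Q = (x, l)" by (cases Q)
    have "(LINT y:cb x l|\<mu>. cmod (truncation \<mu> K \<epsilon> f y - gQ (x, l))) / measure \<mu> (cb x l) \<le> c_mean A C * D_full"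
      unfolding gQ_def fst_conv snd_conv
      using truncation_oscillation[OF e d[unfolded Q] C L2 b1[OF d, unfolded Q] refl] .
    also have "\<dots> \<le> (c_mean A C + c_comp C) * D_full" using pos D_full by (intro mult_right_mono) auto
    finally show "(LINT y:cube_set Q|\<mu>. cmod (truncation \<mu> K \<epsilon> f y - gQ Q)) / measure \<mu> (cube_set Q) \<le> (c_mean A C + c_comp C) * D_full"
      by (simp add: Q)
  next
    fix Q R assume a: "doubling n \<mu> Q \<and> doubling n \<mu> R \<and> cube_set Q \<subseteq> cube_set R"
    obtain x l where Q: "Q = (x, l)" by (cases Q)
    obtain x' l' where R: "R = (x', l')" by (cases R)
    have dQ: "doubling n \<mu> (x, l)" and dR: "doubling n \<mu> (x', l')" and sub: "cb x l \<subseteq> cb x' l'" using a by (auto simp: Q R)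
    have "cmod (gQ (x, l) - gQ (x', l')) \<le> c_comp C * D_full * K_pair n \<mu> (x, l) (x', l')"
      unfolding gQ_def fst_conv snd_conv
      by (rule truncation_compare[OF e dQ dR sub C b2[OF dQ dR sub] mean_of_truncated_one_bounded[OF e dR C b1[OF dR]] refl refl])
    also have "\<dots> \<le> (c_mean A C + c_comp C) * D_full * K_pair n \<mu> (x, l) (x', l')"
      using pos D_full K_pair_ge_1[of "(x, l)" "(x', l')"] by (intro mult_right_mono) auto
    finally show "cmod (gQ Q - gQ R) \<le> (c_mean A C + c_comp C) * D_full * K_pair n \<mu> Q R" by (simp add: Q R)
  qed
qed

lemma truncation_L1_loc: "\<epsilon> > 0 \<Longrightarrow> truncation \<mu> K \<epsilon> f \<in> L1_loc \<mu>"
proof -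
  assume e: "\<epsilon> > 0"
  have i: "integrable \<mu> (truncation \<mu> K \<epsilon> f)" using truncation_minus_integrable[OF e f_integrable, of 0] by simp
  then have "set_integrable \<mu> S (truncation \<mu> K \<epsilon> f)" if "compact S" for S
    unfolding set_integrable_def using that by (intro integrable_mult_indicator) (auto intro: borel_compact)
  then show ?thesis using i by (simp add: L1_loc_def)
qed

end

text \<open>
  A bound in terms of every RBMO constant of \<open>f\<close> passes to the infimum of these constants.
\<close>

lemma RBMO_norm_le:
  assumes f: "f \<in> RBMO n \<mu>" and c: "c > 0" "c' \<ge> 0"
    and const: "\<And>D. RBMO_constant n \<mu> f D \<Longrightarrow> RBMO_constant n \<mu> g (c * (D + cmod (LINT x|\<mu>. f x)))"
    and mean: "\<And>D. RBMO_constant n \<mu> f D \<Longrightarrow> cmod (LINT x|\<mu>. g x) \<le> c' * (D + cmod (LINT x|\<mu>. f x))"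
  shows "RBMO_norm n \<mu> g \<le> (c + c') * RBMO_norm n \<mu> f"
proof -
  define I where "I = cmod (LINT x|\<mu>. f x)"
  have "RBMO_norm n \<mu> g / (c + c') - I \<le> D" if D: "RBMO_constant n \<mu> f D" for D
  proof -
    have "bdd_below {C. RBMO_constant n \<mu> g C}" by (intro bdd_belowI[of _ 0]) (simp add: RBMO_constant_def)
    then have "RBMO_seminorm n \<mu> g \<le> c * (D + I)"
      unfolding RBMO_seminorm_def I_def using const[OF D] by (intro cInf_lower) auto
    then have "RBMO_norm n \<mu> g \<le> (c + c') * (D + I)" using mean[OF D] by (simp add: RBMO_norm_def I_def algebra_simps)
    then show ?thesis using c by (simp add: field_simps)
  qed
  then have "RBMO_norm n \<mu> g / (c + c') - I \<le> Inf {C. RBMO_constant n \<mu> f C}"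
    using f by (intro cInf_greatest) (auto simp: RBMO_def)
  then show ?thesis using c by (simp add: RBMO_norm_def RBMO_seminorm_def I_def field_simps)
qed

text \<open>
  The zero measure has no doubling cubes, so every function has norm zero.
\<close>

lemma bounded_on_RBMO_null_measure:
  fixes \<mu> :: "(real ^ 'm) measure"
  assumes sets: "sets \<mu> = sets borel" and null: "emeasure \<mu> UNIV = 0"
  shows "bounded_on_RBMO n \<mu> K"
proof -
  have N: "UNIV \<in> null_sets \<mu>" using sets null by (simp add: null_sets_def)
  have z: "(LINT x|\<mu>. g x) = 0" for g :: "real ^ 'm \<Rightarrow> complex"
    by (rule integral_eq_zero_AE, rule AE_I'[OF N]) simp
  have t: "truncation \<mu> K \<epsilon> g = (\<lambda>_. 0)" for \<epsilon> g by (simp add: truncation_def set_lebesgue_integral_def z fun_eq_iff)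
  have nd: "\<not> doubling n \<mu> Q" for Q using null by (auto simp: doubling_def ab_doubling_def is_cube_def supp_def)
  have R: "RBMO_constant n \<mu> g C \<longleftrightarrow> C > 0" for g C by (simp add: RBMO_constant_def nd)
  have s: "RBMO_seminorm n \<mu> g = 0" for g
  proof -
    have "{C. RBMO_constant n \<mu> g C} = {0<..}" by (auto simp: R)
    then show ?thesis by (simp add: RBMO_seminorm_def)
  qed
  have "(\<lambda>_. 0) \<in> RBMO n \<mu>" by (auto simp: RBMO_def L1_loc_def R set_integrable_def intro: exI[of _ 1])
  then show ?thesis unfolding bounded_on_RBMO_def by (intro exI[of _ 0]) (simp add: t RBMO_norm_def s)
qed

theorem theorem1p1:
  fixes \<mu> :: "(real ^ 'm) measure"
    and n C :: real
    and K :: "real ^ 'm \<Rightarrow> real ^ 'm \<Rightarrow> complex"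
    and b :: "real \<Rightarrow> (real ^ 'm) cube \<Rightarrow> complex"
  assumes "0 < n" and "n \<le> real CARD('m)"
    and "sets \<mu> = sets borel" and "finite_measure \<mu>" and "n_dimensional n \<mu>"
    and "CZ_kernel n \<mu> K"
    and "bounded_on_L2 \<mu> K"
    and "C > 0"
    and "\<And>\<epsilon> Q. \<epsilon> > 0 \<Longrightarrow> doubling n \<mu> Q \<Longrightarrow>
           (LINT x:cube_set Q|\<mu>. cmod (truncation \<mu> K \<epsilon> (\<lambda>_. 1) x - b \<epsilon> Q)) / measure \<mu> (cube_set Q)
             \<le> C / K_single n \<mu> Q"
    and "\<And>\<epsilon> Q R. \<epsilon> > 0 \<Longrightarrow> doubling n \<mu> Q \<Longrightarrow> doubling n \<mu> R \<Longrightarrow>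
           cube_set Q \<subseteq> cube_set R \<Longrightarrow>
           cmod (b \<epsilon> Q - b \<epsilon> R) \<le> C * (K_pair n \<mu> Q R / K_single n \<mu> Q)"
  shows "bounded_on_RBMO n \<mu> K"
proof (cases "emeasure \<mu> UNIV = 0")
  case True
  then show ?thesis by (rule bounded_on_RBMO_null_measure[OF assms(3)])
next
  case False
  interpret finite_measure \<mu> by fact
  have pos: "measure \<mu> UNIV > 0" using False by (simp add: emeasure_eq_measure zero_less_measure_iff)
  obtain x0 where x0: "x0 \<in> supp \<mu>"
  proof -
    have "supp \<mu> \<noteq> {}" using compl_supp_null[OF assms(3)] False by auto
    then show ?thesis using that by blast
  qed
  obtain k where k: "measure \<mu> (cb x0 (2 ^ k * 1)) > measure \<mu> UNIV / 2"
    using large_cubes[OF assms(3,4) pos zero_less_one, of x0] by blast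
  obtain C0 where C0: "C0 > 0" "\<And>Q. is_cube \<mu> Q \<Longrightarrow> emeasure \<mu> (cube_set Q) \<le> ennreal (C0 * snd Q powr n)"
    using assms(5) by (auto simp: n_dimensional_def)
  interpret G: growth_measure \<mu> n C0 x0 "2 ^ k * 1"
  proof
    fix x s assume "x \<in> supp \<mu>" "s > (0::real)"
    then have "emeasure \<mu> (cb x s) \<le> ennreal (C0 * s powr n)" using C0(2)[of "(x, s)"] by (simp add: is_cube_def)
    then show "measure \<mu> (cb x s) \<le> C0 * s powr n" using C0(1) by (simp add: emeasure_eq_measure ennreal_le_iff)
  qed (use assms(1,3,4) C0(1) x0 k in simp_all)
  obtain CK \<delta> where CK: "CK > 0" and \<delta>: "0 < \<delta>"
    and size: "\<forall>x y. x \<noteq> y \<longrightarrow> cmod (K x y) \<le> CK * dist x y powr (- n)"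
    and regular: "\<forall>x1 x2 y. x1 \<noteq> y \<and> 2 * dist x1 x2 \<le> dist x1 y \<longrightarrow>
           cmod (K x1 y - K x2 y) + cmod (K y x1 - K y x2) \<le> CK * (dist x1 x2 powr \<delta> / dist x1 y powr (n + \<delta>))"
    and cancel: "\<forall>x\<in>supp \<mu>. \<forall>r R. 0 < r \<and> r < R \<longrightarrow> cmod (LINT y:cb x R - cb x r|\<mu>. K x y) \<le> CK"
    using assms(6) unfolding CZ_kernel_def by (elim conjE exE) (rule that)
  interpret Z: cz_growth \<mu> n C0 x0 "2 ^ k * 1" K CK \<delta>
  proof
    show "(\<lambda>(x, y). K x y) \<in> borel_measurable (restrict_space borel {(x, y). x \<noteq> y})" using assms(6) by (simp add: CZ_kernel_def)
    show "CK > 0" "0 < \<delta>" by (rule CK, rule \<delta>)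
    show "cmod (K x y) \<le> CK * dist x y powr (- n)" if "x \<noteq> y" for x y using size that by simp
    show "cmod (K x1 y - K x2 y) \<le> CK * (dist x1 x2 powr \<delta> / dist x1 y powr (n + \<delta>))"
      if "x1 \<noteq> y" "2 * dist x1 x2 \<le> dist x1 y" for x1 x2 y
      using regular[rule_format, OF conjI[OF that]] norm_ge_zero[of "K y x1 - K y x2"] by linarith
    show "cmod (LINT y:cb x R - cb x r|\<mu>. K x y) \<le> CK" if "x \<in> supp \<mu>" "0 < r" "r < R" for x r R
      by (rule cancel[rule_format, OF that(1) conjI[OF that(2,3)]])
  qed
  obtain A where A0: "\<forall>\<epsilon>>0. \<forall>g\<in>L2 \<mu>. truncation \<mu> K \<epsilon> g \<in> L2 \<mu> \<and> L2_nrm \<mu> (truncation \<mu> K \<epsilon> g) \<le> A * L2_nrm \<mu> g"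
    using assms(7) unfolding bounded_on_L2_def by (elim exE) (rule that)
  have A: "truncation \<mu> K \<epsilon> g \<in> L2 \<mu> \<and> L2_nrm \<mu> (truncation \<mu> K \<epsilon> g) \<le> A * L2_nrm \<mu> g" if "\<epsilon> > 0" "g \<in> L2 \<mu>" for \<epsilon> g
    by (rule A0[rule_format, OF that])
  define c where "c = Z.c_mean A C + Z.c_comp C"
  have c: "c > 0" unfolding c_def by (intro add_pos_pos Z.c_mean_pos Z.c_comp_pos assms(8))
  show ?thesis unfolding bounded_on_RBMO_def
  proof (intro exI[of _ "c + Z.c_int A"] allI impI ballI)
    fix \<epsilon> :: real and f assume e: "\<epsilon> > 0" and f: "f \<in> RBMO n \<mu>"
    have step: "RBMO_constant n \<mu> (truncation \<mu> K \<epsilon> f) (c * (D + cmod (LINT x|\<mu>. f x)))"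
      "cmod (LINT x|\<mu>. truncation \<mu> K \<epsilon> f x) \<le> Z.c_int A * (D + cmod (LINT x|\<mu>. f x))"
      "truncation \<mu> K \<epsilon> f \<in> L1_loc \<mu>"
      if D: "RBMO_constant n \<mu> f D" for D
    proof -
      obtain fQ where fQ: "\<forall>Q. doubling n \<mu> Q \<longrightarrow> (LINT x:cube_set Q|\<mu>. cmod (f x - fQ Q)) / measure \<mu> (cube_set Q) \<le> D"
        "\<forall>Q R. doubling n \<mu> Q \<and> doubling n \<mu> R \<and> cube_set Q \<subseteq> cube_set R \<longrightarrow> cmod (fQ Q - fQ R) \<le> D * K_pair n \<mu> Q R"
        using D unfolding RBMO_constant_def by (elim conjE exE) (rule that)
      interpret F: cz_rbmo \<mu> n C0 x0 "2 ^ k * 1" K CK \<delta> f fQ D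
      proof
        show "f \<in> L1_loc \<mu>" using f by (simp add: RBMO_def)
        show "D > 0" using D by (simp add: RBMO_constant_def)
        show "(LINT x:cube_set Q|\<mu>. cmod (f x - fQ Q)) / measure \<mu> (cube_set Q) \<le> D" if "doubling n \<mu> Q" for Q
          by (rule fQ(1)[rule_format, OF that])
        show "cmod (fQ Q - fQ R) \<le> D * K_pair n \<mu> Q R"
          if "doubling n \<mu> Q" "doubling n \<mu> R" "cube_set Q \<subseteq> cube_set R" for Q R
          by (rule fQ(2)[rule_format, OF conjI[OF that(1) conjI[OF that(2,3)]]])
      qed
      show "RBMO_constant n \<mu> (truncation \<mu> K \<epsilon> f) (c * (D + cmod (LINT x|\<mu>. f x)))"
        unfolding c_def F.D_full_def[symmetric]
        by (rule F.truncation_RBMO_constant[OF e assms(8) A[OF e] assms(9)[OF e] assms(10)[OF e]])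
      show "cmod (LINT x|\<mu>. truncation \<mu> K \<epsilon> f x) \<le> Z.c_int A * (D + cmod (LINT x|\<mu>. f x))"
        unfolding F.D_full_def[symmetric] by (rule F.truncation_integral_bound[OF e A[OF e]])
      show "truncation \<mu> K \<epsilon> f \<in> L1_loc \<mu>" by (rule F.truncation_L1_loc[OF e])
    qed
    obtain D where D: "RBMO_constant n \<mu> f D" using f by (auto simp: RBMO_def)
    have "truncation \<mu> K \<epsilon> f \<in> RBMO n \<mu>" using step[OF D] by (auto simp: RBMO_def)
    moreover have "RBMO_norm n \<mu> (truncation \<mu> K \<epsilon> f) \<le> (c + Z.c_int A) * RBMO_norm n \<mu> f"
      by (rule RBMO_norm_le[OF f c Z.c_int_nonneg step(1,2)])
    ultimately show "truncation \<mu> K \<epsilon> f \<in> RBMO n \<mu> \<and>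
        RBMO_norm n \<mu> (truncation \<mu> K \<epsilon> f) \<le> (c + Z.c_int A) * RBMO_norm n \<mu> f" ..
  qed
qed

end
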